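(* For every integer $n\ge2$ and any $k\in\{0,\ldots,n-1\}$ there exists an $n$-dimensional Zoll manifold with connected boundary whose free boundary geodesics have Morse index equal to $k$.
   Context: Zoll manifolds with boundary. Let $(M,g)$ be a compact connected Riemannian manifold of dimension $n\ge 2$ with nonempty smooth boundary $\partial M$, and let $\nu$ be the unit inward-pointing normal field along $\partial M$. For $p\in\partial M$ let $\gamma_p(t)=\exp_p(t\nu_p)$ be the unit-speed geodesic of $M$ issuing orthogonally from $p$, defined on an interval $[0,R_p]$ (or $[0,+\infty)$). $(M,g)$ is a Zoll manifold with boundary if for every $p\in\partial M$ the number $R_p$ is (finite and) the first positive instant at which $\gamma_p$ meets $\partial M$, and $\gamma_p'(R_p)$ is orthogonal to $T_{\gamma_p(R_p)}\partial M$. The geodesics $\gamma_p:[0,R_p]\to M$ are called the free boundary geodesics of $M$. Morse index. Let $\gamma:[0,1]\to M$ be an affinely parametrized free boundary geodesic. Let $\mathcal S_{\eta}(V,W)=g(\nabla_V W,\eta)$ denote the second fundamental form of $\partial M$ in the normal direction $\eta$, and let $\mathcal R_\gamma=\mathcal R(\gamma',\cdot)\gamma'$ with $\mathcal R(X,Y)=[\nabla_X,\nabla_Y]-\nabla_{[X,Y]}$. The Morse index of $\gamma$ is the index (maximal dimension of a subspace on which the form is negative definite) of the symmetric bilinear form $$I_\gamma(V,W)=\int_0^1 g(V',W')+g(\mathcal R_\gamma V,W)\,\mathrm dt+\mathcal S_{\gamma'(1)}(V(1),W(1))-\mathcal S_{\gamma'(0)}(V(0),W(0))$$ on the space $\mathcal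 H_\gamma$ of $H^1$ vector fields along $\gamma$ that are tangent to $\partial M$ at both endpoints. *)

theory Defs
  imports
    "HOL-Analysis.Analysis"
    "HOL-Library.Function_Algebras"
    "HOL-Library.Extended_Nat"
begin

section \<open>Smooth maps between subsets of Euclidean spaces\<close>

fun Ck_on :: "nat \<Rightarrow> 'a::euclidean_space set \<Rightarrow> ('a \<Rightarrow> 'b::real_normed_vector) \<Rightarrow> bool" where
  "Ck_on 0 W f \<longleftrightarrow> continuous_on W f"
| "Ck_on (Suc k) W f \<longleftrightarrow>
     (\<forall>x\<in>W. f differentiable (at x)) \<and>
     (\<forall>v. Ck_on k W (\<lambda>x. frechet_derivative f (at x) v))"

text \<open>On a set \<open>A\<close> that need not be open, smooth means: locally the restriction of a smooth map
  that is defined on an open set.\<close>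

definition smooth_on :: "'a::euclidean_space set \<Rightarrow> ('a \<Rightarrow> 'b::real_normed_vector) \<Rightarrow> bool" where
  "smooth_on A f \<longleftrightarrow>
     (\<forall>x\<in>A. \<exists>W F. open W \<and> x \<in> W \<and> (\<forall>k. Ck_on k W F) \<and> (\<forall>y\<in>A \<inter> W. F y = f y))"


section \<open>Riemannian manifolds with boundary\<close>

text \<open>The model space is the half space on which one fixed coordinate is nonnegative; since the
  index type \<open>'n\<close> carries no order, that coordinate is an arbitrary but fixed index.\<close>

definition normal_coord :: "'n::finite" where
  "normal_coord = (SOME i. True)"

definition half_space :: "(real^'n) set" where
  "half_space = {x. 0 \<le> x $ normal_coord}"

text \<open>A chart is a pair of its domain and its coordinate map; only the values of the map on the
  domain matter.\<close>

type_synonym ('a, 'n) chart = "'a set \<times> ('a \<Rightarrow> real^'n)"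

text \<open>The metric is given by its local expressions: \<open>metric M c x\<close> is the bilinear form which
  represents it in the chart \<open>c\<close> at the point with coordinates \<open>x\<close>. The type \<open>'a\<close> only
  provides the points; the topology is part of the data. Any type with at least continuum many
  elements can carry every manifold.\<close>

record ('a, 'n::finite) riem =
  space_of :: "'a topology"
  atlas :: "('a, 'n) chart set"
  metric :: "('a, 'n) chart \<Rightarrow> real^'n \<Rightarrow> real^'n \<Rightarrow> real^'n \<Rightarrow> real"

abbreviation img :: "('a, 'n::finite) chart \<Rightarrow> (real^'n) set" where
  "img c \<equiv> snd c ` fst c"

definition transition :: "('a, 'n::finite) chart \<Rightarrow> ('a, 'n) chart \<Rightarrow> real^'n \<Rightarrow> real^'n" where
  "transition c d = snd d \<circ> inv_into (fst c) (snd c)"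

text \<open>All derivatives with respect to coordinates are taken within the half space, so that they
  are one-sided in the normal coordinate at boundary points.\<close>

abbreviation deriv_half :: "(real^'n \<Rightarrow> 'b::real_normed_vector) \<Rightarrow> real^'n \<Rightarrow> real^'n \<Rightarrow> 'b" where
  "deriv_half f x \<equiv> frechet_derivative f (at x within half_space)"

definition smooth_atlas :: "('a, 'n::finite) riem \<Rightarrow> bool" where
  "smooth_atlas M \<longleftrightarrow>
     (\<Union>c\<in>atlas M. fst c) = topspace (space_of M) \<and>
     (\<forall>c\<in>atlas M. openin (space_of M) (fst c) \<and>
        openin (top_of_set half_space) (img c) \<and>
        homeomorphic_map (subtopology (space_of M) (fst c)) (top_of_set (img c)) (snd c)) \<and>
     (\<forall>c\<in>atlas M. \<forall>d\<in>atlas M. smooth_on (snd c ` (fst c \<inter> fst d)) (transition c d))"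

definition riemannian_metric :: "('a, 'n::finite) riem \<Rightarrow> bool" where
  "riemannian_metric M \<longleftrightarrow>
     (\<forall>c\<in>atlas M.
        (\<forall>x\<in>img c. bilinear (metric M c x) \<and>
           (\<forall>u v. metric M c x u v = metric M c x v u) \<and>
           (\<forall>v. v \<noteq> 0 \<longrightarrow> 0 < metric M c x v v)) \<and>
        (\<forall>u v. smooth_on (img c) (\<lambda>x. metric M c x u v))) \<and>
     (\<forall>c\<in>atlas M. \<forall>d\<in>atlas M. \<forall>x \<in> snd c ` (fst c \<inter> fst d). \<forall>u v.
        metric M c x u v =
        metric M d (transition c d x)
          (deriv_half (transition c d) x u) (deriv_half (transition c d) x v))"

definition bdry :: "('a, 'n::finite) riem \<Rightarrow> 'a set" where
  "bdry M = {p. \<exists>c\<in>atlas M. p \<in> fst c \<and> snd c p $ normal_coord = 0}"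

definition compact_riemannian_manifold_with_boundary :: "('a, 'n::finite) riem \<Rightarrow> bool" where
  "compact_riemannian_manifold_with_boundary M \<longleftrightarrow>
     Hausdorff_space (space_of M) \<and> second_countable (space_of M) \<and>
     compact_space (space_of M) \<and> connected_space (space_of M) \<and>
     smooth_atlas M \<and> riemannian_metric M \<and> bdry M \<noteq> {}"


section \<open>Levi-Civita connection, curvature, second fundamental form\<close>

text \<open>Everything in this section is expressed in the coordinates of a chart \<open>c\<close>. The Christoffel
  symbols form a bilinear map, which is determined by the Koszul formula for constant vector
  fields.\<close>

definition christoffel ::
  "('a, 'n::finite) riem \<Rightarrow> ('a, 'n) chart \<Rightarrow> real^'n \<Rightarrow> real^'n \<Rightarrow> real^'n \<Rightarrow> real^'n" where
  "christoffel M c x u v =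
     (THE z. \<forall>w. 2 * metric M c x z w =
        deriv_half (\<lambda>y. metric M c y v w) x u
        + deriv_half (\<lambda>y. metric M c y u w) x v
        - deriv_half (\<lambda>y. metric M c y u v) x w)"

definition nabla :: "('a, 'n::finite) riem \<Rightarrow> ('a, 'n) chart \<Rightarrow>
    (real^'n \<Rightarrow> real^'n) \<Rightarrow> (real^'n \<Rightarrow> real^'n) \<Rightarrow> real^'n \<Rightarrow> real^'n" where
  "nabla M c X Y x = deriv_half Y x (X x) + christoffel M c x (X x) (Y x)"

definition lie_bracket ::
  "(real^'n \<Rightarrow> real^'n) \<Rightarrow> (real^'n \<Rightarrow> real^'n) \<Rightarrow> real^'n \<Rightarrow> real^'n" where
  "lie_bracket X Y x = deriv_half Y x (X x) - deriv_half X x (Y x)"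

text \<open>The curvature and the second fundamental form are tensors; they are evaluated on vectors by
  extending these to vector fields that are constant in the chart. At a boundary point the constant
  extension of a vector tangent to the boundary is tangent to the boundary.\<close>

definition curvature :: "('a, 'n::finite) riem \<Rightarrow> ('a, 'n) chart \<Rightarrow>
    real^'n \<Rightarrow> real^'n \<Rightarrow> real^'n \<Rightarrow> real^'n \<Rightarrow> real^'n" where
  "curvature M c x u v w =
     (let X = (\<lambda>_. u); Y = (\<lambda>_. v); Z = (\<lambda>_. w) in
        nabla M c X (nabla M c Y Z) x - nabla M c Y (nabla M c X Z) x
        - nabla M c (lie_bracket X Y) Z x)"

definition second_fundamental_form :: "('a, 'n::finite) riem \<Rightarrow> ('a, 'n) chart \<Rightarrow>
    real^'n \<Rightarrow> real^'n \<Rightarrow> real^'n \<Rightarrow> real^'n \<Rightarrow> real" where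
  "second_fundamental_form M c x \<eta> v w = metric M c x (nabla M c (\<lambda>_. v) (\<lambda>_. w) x) \<eta>"

definition tangent_to_bdry :: "real^'n \<Rightarrow> bool" where
  "tangent_to_bdry v \<longleftrightarrow> v $ normal_coord = 0"

definition normal_to_bdry ::
  "('a, 'n::finite) riem \<Rightarrow> ('a, 'n) chart \<Rightarrow> real^'n \<Rightarrow> real^'n \<Rightarrow> bool" where
  "normal_to_bdry M c x v \<longleftrightarrow> (\<forall>w. tangent_to_bdry w \<longrightarrow> metric M c x v w = 0)"

definition unit_inward_normal ::
  "('a, 'n::finite) riem \<Rightarrow> ('a, 'n) chart \<Rightarrow> real^'n \<Rightarrow> real^'n \<Rightarrow> bool" where
  "unit_inward_normal M c x v \<longleftrightarrow>
     metric M c x v v = 1 \<and> normal_to_bdry M c x v \<and> 0 < v $ normal_coord"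


section \<open>Geodesics and Zoll manifolds with boundary\<close>

abbreviation velocity ::
  "real set \<Rightarrow> (real \<Rightarrow> 'a) \<Rightarrow> ('a, 'n::finite) chart \<Rightarrow> real \<Rightarrow> real^'n" where
  "velocity J \<gamma> c t \<equiv> vector_derivative (snd c \<circ> \<gamma>) (at t within J)"

definition geodesic_on :: "('a, 'n::finite) riem \<Rightarrow> real set \<Rightarrow> (real \<Rightarrow> 'a) \<Rightarrow> bool" where
  "geodesic_on M J \<gamma> \<longleftrightarrow>
     continuous_map (top_of_set J) (space_of M) \<gamma> \<and>
     (\<forall>c\<in>atlas M. \<forall>t\<in>J. \<gamma> t \<in> fst c \<longrightarrow>
        (snd c \<circ> \<gamma>) differentiable (at t within J) \<and>
        (velocity J \<gamma> c has_vector_derivative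
           - christoffel M c (snd c (\<gamma> t)) (velocity J \<gamma> c t) (velocity J \<gamma> c t)) (at t within J))"

text \<open>\<open>\<gamma>\<close> restricted to \<open>[0, R]\<close> is the geodesic that issues from \<open>\<gamma> 0\<close> in the direction of the
  unit inward normal; \<open>R\<close> is the first positive instant at which it meets the boundary, and there
  it is orthogonal to the boundary.\<close>

definition free_boundary_geodesic :: "('a, 'n::finite) riem \<Rightarrow> real \<Rightarrow> (real \<Rightarrow> 'a) \<Rightarrow> bool" where
  "free_boundary_geodesic M R \<gamma> \<longleftrightarrow>
     0 < R \<and> geodesic_on M {0..R} \<gamma> \<and>
     \<gamma> 0 \<in> bdry M \<and> \<gamma> R \<in> bdry M \<and> (\<forall>t. 0 < t \<and> t < R \<longrightarrow> \<gamma> t \<notin> bdry M) \<and>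
     (\<forall>c\<in>atlas M. \<gamma> 0 \<in> fst c \<longrightarrow>
        unit_inward_normal M c (snd c (\<gamma> 0)) (velocity {0..R} \<gamma> c 0)) \<and>
     (\<forall>c\<in>atlas M. \<gamma> R \<in> fst c \<longrightarrow>
        normal_to_bdry M c (snd c (\<gamma> R)) (velocity {0..R} \<gamma> c R))"

definition zoll_manifold_with_boundary :: "('a, 'n::finite) riem \<Rightarrow> bool" where
  "zoll_manifold_with_boundary M \<longleftrightarrow>
     CARD('n) \<ge> 2 \<and> compact_riemannian_manifold_with_boundary M \<and>
     (\<forall>p\<in>bdry M. \<exists>R \<gamma>. free_boundary_geodesic M R \<gamma> \<and> \<gamma> 0 = p)"


section \<open>Vector fields along a curve and the Morse index\<close>

text \<open>A vector field along \<open>\<gamma> : [0,1] \<rightarrow> M\<close> is the family of its local expressions: \<open>V c t\<close> is the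
  coordinate vector in the chart \<open>c\<close> of the value at time \<open>t\<close>. Where this makes no sense, \<open>V c t\<close>
  is set to zero, so that distinct functions represent distinct fields.\<close>

type_synonym ('a, 'n) field = "('a, 'n) chart \<Rightarrow> real \<Rightarrow> real^'n"

definition field_along :: "('a, 'n::finite) riem \<Rightarrow> (real \<Rightarrow> 'a) \<Rightarrow> ('a, 'n) field \<Rightarrow> bool" where
  "field_along M \<gamma> V \<longleftrightarrow>
     (\<forall>c t. \<not> (c \<in> atlas M \<and> t \<in> {0..1} \<and> \<gamma> t \<in> fst c) \<longrightarrow> V c t = 0) \<and>
     (\<forall>c\<in>atlas M. \<forall>d\<in>atlas M. \<forall>t\<in>{0..1}. \<gamma> t \<in> fst c \<inter> fst d \<longrightarrow>
        V d t = deriv_half (transition c d) (snd c (\<gamma> t)) (V c t))"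

text \<open>\<open>W\<close> is a weak covariant derivative of class \<open>L\<^sup>2\<close> of \<open>V\<close>: in every chart,
  \<open>W = V' + \<Gamma>(\<gamma>', V)\<close>, where \<open>V\<close> is an indefinite integral of its weak derivative \<open>V'\<close>. Such a \<open>W\<close>
  is unique up to sets of measure zero. On a compact interval whose image lies in the domain of one
  chart, square integrability does not depend on the norms that are used.\<close>

definition weak_cov_deriv ::
  "('a, 'n::finite) riem \<Rightarrow> (real \<Rightarrow> 'a) \<Rightarrow> ('a, 'n) field \<Rightarrow> ('a, 'n) field \<Rightarrow> bool" where
  "weak_cov_deriv M \<gamma> V W \<longleftrightarrow>
     field_along M \<gamma> W \<and>
     (\<forall>c\<in>atlas M. \<forall>a b. 0 \<le> a \<and> a \<le> b \<and> b \<le> 1 \<and> \<gamma> ` {a..b} \<subseteq> fst c \<longrightarrow>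
        W c absolutely_integrable_on {a..b} \<and>
        (\<lambda>t. (norm (W c t))\<^sup>2) integrable_on {a..b} \<and>
        ((\<lambda>t. W c t - christoffel M c (snd c (\<gamma> t)) (velocity {0..1} \<gamma> c t) (V c t))
           has_integral (V c b - V c a)) {a..b})"

text \<open>The space of \<open>H\<^sup>1\<close> vector fields along \<open>\<gamma>\<close> that are tangent to the boundary at both
  endpoints.\<close>

definition H1_fields :: "('a, 'n::finite) riem \<Rightarrow> (real \<Rightarrow> 'a) \<Rightarrow> ('a, 'n) field set" where
  "H1_fields M \<gamma> =
     {V. field_along M \<gamma> V \<and> (\<exists>W. weak_cov_deriv M \<gamma> V W) \<and>
         (\<forall>c\<in>atlas M. \<forall>t\<in>{0, 1}. \<gamma> t \<in> fst c \<longrightarrow> tangent_to_bdry (V c t))}"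

definition cov_deriv ::
  "('a, 'n::finite) riem \<Rightarrow> (real \<Rightarrow> 'a) \<Rightarrow> ('a, 'n) field \<Rightarrow> ('a, 'n) field" where
  "cov_deriv M \<gamma> V = (SOME W. weak_cov_deriv M \<gamma> V W)"

text \<open>The terms of the index form do not depend on the choice of a chart around \<open>\<gamma> t\<close>.\<close>

definition chart_at :: "('a, 'n::finite) riem \<Rightarrow> 'a \<Rightarrow> ('a, 'n) chart" where
  "chart_at M p = (SOME c. c \<in> atlas M \<and> p \<in> fst c)"

definition index_form ::
  "('a, 'n::finite) riem \<Rightarrow> (real \<Rightarrow> 'a) \<Rightarrow> ('a, 'n) field \<Rightarrow> ('a, 'n) field \<Rightarrow> real" where
  "index_form M \<gamma> V W =
     (let c = (\<lambda>t. chart_at M (\<gamma> t));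
          x = (\<lambda>t. snd (c t) (\<gamma> t));
          \<gamma>' = (\<lambda>t. velocity {0..1} \<gamma> (c t) t);
          V' = cov_deriv M \<gamma> V;
          W' = cov_deriv M \<gamma> W;
          S = (\<lambda>t. second_fundamental_form M (c t) (x t) (\<gamma>' t) (V (c t) t) (W (c t) t))
      in integral {0..1} (\<lambda>t.
           metric M (c t) (x t) (V' (c t) t) (W' (c t) t)
           + metric M (c t) (x t) (curvature M (c t) (x t) (\<gamma>' t) (V (c t) t) (\<gamma>' t)) (W (c t) t))
         + S 1 - S 0)"

definition field_scale :: "real \<Rightarrow> ('a, 'n::finite) field \<Rightarrow> ('a, 'n) field" where
  "field_scale r V = (\<lambda>c t. r *\<^sub>R V c t)"

global_interpretation vfield: vector_space field_scale
  by standard (auto simp: field_scale_def fun_eq_iff algebra_simps)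

text \<open>The supremum in \<^typ>\<open>enat\<close> of the dimensions of the finite-dimensional subspaces of
  \<^const>\<open>H1_fields\<close> on which the index form is negative definite.\<close>

definition morse_index :: "('a, 'n::finite) riem \<Rightarrow> (real \<Rightarrow> 'a) \<Rightarrow> enat" where
  "morse_index M \<gamma> =
     (SUP B \<in> {B. finite B \<and> vfield.independent B \<and> vfield.span B \<subseteq> H1_fields M \<gamma> \<and>
                  (\<forall>V\<in>vfield.span B. V \<noteq> 0 \<longrightarrow> index_form M \<gamma> V V < 0)}. enat (card B))"

end

theory Submission
  imports Defs
begin

text \<open>
  Put \<open>m = n - k - 1\<close>. The manifold is the flat quotient of \<open>D \<times> \<real>\<^sup>m\<close>, where \<open>D\<close> is the closed unit
  ball of \<open>\<real>\<^sup>k\<^sup>+\<^sup>1\<close>, by the lattice of integer vectors \<open>a\<close>, which act by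
  \<open>(y, x) \<mapsto> (\<plusminus>y, x + a)\<close>, with the minus sign if the sum of the entries of \<open>a\<close> is odd. For \<open>k \<ge> 1\<close> the
  boundary is connected because the unit sphere of \<open>\<real>\<^sup>k\<^sup>+\<^sup>1\<close> is; for \<open>k = 0\<close> the ball is an interval,
  and it is the sign that joins its two ends (\<open>connected_bdry\<close>). For \<open>k = n - 1\<close> the lattice is trivial
  and the manifold is the flat ball.

  The geodesic which leaves the boundary orthogonally at the class of \<open>(y, x)\<close> is the image of
  the diameter of the ball through \<open>y\<close>, at constant \<open>x\<close>. It meets the boundary again after time 2,
  and orthogonally (\<open>free_boundary_geodesic_ray\<close>); since in flat coordinates the geodesic equation says
  that the second derivative vanishes, there are no other free boundary geodesics
  (\<open>free_boundary_geodesic_unique\<close>).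

  Along such a geodesic, parametrized by \<open>[0,1]\<close>, parallel transport is the identity of \<open>\<real>\<^sup>n\<close> and the
  curvature vanishes. The second fundamental form of the boundary is that of the unit sphere in the
  ball directions and zero in the others, so that the index form is
  \<open>\<integral>|V'|\<^sup>2 - 2|V(0)\<^sub>D|\<^sup>2 - 2|V(1)\<^sub>D|\<^sup>2\<close>, where the subscript marks the component in \<open>\<real>\<^sup>k\<^sup>+\<^sup>1\<close>
  (\<open>index_form_developed\<close>). It is negative on the \<open>k\<close>-dimensional space of constant fields with values
  in the tangent space of the sphere (\<open>index_form_parallel\<close>). Conversely, if
  \<open>V(1)\<^sub>D = - V(0)\<^sub>D\<close>, then \<open>\<integral>|V'|\<^sup>2 \<ge> |V(1)\<^sub>D - V(0)\<^sub>D|\<^sup>2 = 4|V(0)\<^sub>D|\<^sup>2\<close> by \<open>energy_ge\<close>, so that the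
  form is nonnegative (\<open>index_form_nonneg\<close>). As \<open>V(0)\<^sub>D + V(1)\<^sub>D\<close> takes values in the same
  \<open>k\<close>-dimensional space, no subspace of larger dimension is negative (\<open>morse_index_ray\<close>).
\<close>

section \<open>Calculus of smooth functions\<close>

declare Ck_on.simps [simp del]

lemma Ck_on_cong:
  fixes f :: "'a::euclidean_space \<Rightarrow> 'b::real_normed_vector"
  assumes "open W" "\<And>x. x \<in> W \<Longrightarrow> f x = g x"
  shows "Ck_on k W f \<longleftrightarrow> Ck_on k W g"
  using assms(2)
proof (induction k arbitrary: f g)
  case 0
  then show ?case by (simp add: Ck_on.simps cong: continuous_on_cong)
next
  case (Suc k)
  have der: "(f has_derivative D) (at x) \<longleftrightarrow> (g has_derivative D) (at x)" if "x \<in> W" for x D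
    using has_derivative_transform_within_open[OF _ assms(1) that, of f _ UNIV g]
      has_derivative_transform_within_open[OF _ assms(1) that, of g _ UNIV f] Suc.prems by auto
  have fd: "frechet_derivative f (at x) = frechet_derivative g (at x)" if "x \<in> W" for x
    unfolding frechet_derivative_def using der[OF that] by simp
  have "Ck_on k W (\<lambda>x. frechet_derivative f (at x) v) \<longleftrightarrow> Ck_on k W (\<lambda>x. frechet_derivative g (at x) v)" for v
    by (rule Suc.IH) (simp add: fd)
  moreover have "(\<forall>x\<in>W. f differentiable (at x)) \<longleftrightarrow> (\<forall>x\<in>W. g differentiable (at x))"
    unfolding differentiable_def using der by blast
  ultimately show ?case by (simp add: Ck_on.simps)
qed

lemma Ck_on_SucI:
  fixes f :: "'a::euclidean_space \<Rightarrow> 'b::real_normed_vector"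
  assumes "open W" "\<And>x. x \<in> W \<Longrightarrow> (f has_derivative D x) (at x)"
    and "\<And>v. Ck_on k W (\<lambda>x. D x v)"
  shows "Ck_on (Suc k) W f"
proof -
  have "Ck_on k W (\<lambda>x. frechet_derivative f (at x) v)" for v
    using Ck_on_cong[OF assms(1), of "\<lambda>x. frechet_derivative f (at x) v" "\<lambda>x. D x v" k]
      frechet_derivative_at[OF assms(2)] assms(3) by metis
  then show ?thesis
    using assms(2) unfolding Ck_on.simps differentiable_def by blast
qed

lemma Ck_on_SucD:
  assumes "Ck_on (Suc k) W f"
  shows "x \<in> W \<Longrightarrow> (f has_derivative frechet_derivative f (at x)) (at x)"
    and "Ck_on k W (\<lambda>x. frechet_derivative f (at x) v)"
  using assms by (auto simp: Ck_on.simps frechet_derivative_works)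

lemma Ck_on_Suc_imp:
  fixes f :: "'a::euclidean_space \<Rightarrow> 'b::real_normed_vector"
  shows "Ck_on (Suc k) W f \<Longrightarrow> Ck_on k W f"
proof (induction k arbitrary: f)
  case 0
  then show ?case
    by (auto simp: Ck_on.simps intro!: continuous_at_imp_continuous_on differentiable_imp_continuous_within)
next
  case (Suc k)
  then show ?case using Ck_on.simps(2) by metis
qed

lemma Ck_on_const [simp]: "open W \<Longrightarrow> Ck_on k W (\<lambda>x. c)"
proof (induction k arbitrary: c)
  case (Suc k)
  show ?case by (rule Ck_on_SucI[where D="\<lambda>_ _. 0"]) (use Suc in auto)
qed (simp add: Ck_on.simps)

lemma Ck_on_linear_compose:
  fixes f :: "'a::euclidean_space \<Rightarrow> 'b::real_normed_vector"
  assumes "open W" "bounded_linear L" "Ck_on k W f"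
  shows "Ck_on k W (\<lambda>x. L (f x))"
  using assms(3)
proof (induction k arbitrary: f)
  case 0
  then show ?case using assms(2) by (simp add: Ck_on.simps bounded_linear.continuous_on)
next
  case (Suc k)
  show ?case
    by (rule Ck_on_SucI[OF assms(1) bounded_linear.has_derivative[OF assms(2) Ck_on_SucD(1)[OF Suc.prems]]])
      (auto intro: Suc.IH Ck_on_SucD(2)[OF Suc.prems])
qed

lemma Ck_on_add:
  fixes f g :: "'a::euclidean_space \<Rightarrow> 'b::real_normed_vector"
  assumes "open W" "Ck_on k W f" "Ck_on k W g"
  shows "Ck_on k W (\<lambda>x. f x + g x)"
  using assms(2,3)
proof (induction k arbitrary: f g)
  case 0
  then show ?case by (simp add: Ck_on.simps continuous_on_add)
next
  case (Suc k)
  show ?case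
    by (rule Ck_on_SucI[OF assms(1) has_derivative_add[OF Ck_on_SucD(1)[OF Suc.prems(1)] Ck_on_SucD(1)[OF Suc.prems(2)]]])
      (auto intro: Suc.IH Ck_on_SucD(2)[OF Suc.prems(1)] Ck_on_SucD(2)[OF Suc.prems(2)])
qed

text \<open>The product rule turns a derivative of \<open>b (f x) (g x)\<close> into a sum of terms of the same form; hence
  the induction is on the order, for arbitrary factors.\<close>

lemma Ck_on_bilinear:
  fixes f :: "'a::euclidean_space \<Rightarrow> 'b::real_normed_vector" and g :: "'a \<Rightarrow> 'c::real_normed_vector"
    and b :: "'b \<Rightarrow> 'c \<Rightarrow> 'd::real_normed_vector"
  assumes "open W" "bounded_bilinear b" "Ck_on k W f" "Ck_on k W g"
  shows "Ck_on k W (\<lambda>x. b (f x) (g x))"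
  using assms(3,4)
proof (induction k arbitrary: f g)
  case 0
  then show ?case by (simp add: Ck_on.simps bounded_bilinear.continuous_on[OF assms(2)])
next
  case (Suc k)
  show ?case
    by (rule Ck_on_SucI[OF assms(1) bounded_bilinear.FDERIV[OF assms(2) Ck_on_SucD(1)[OF Suc.prems(1)] Ck_on_SucD(1)[OF Suc.prems(2)]]])
      (auto intro!: Suc.IH Ck_on_add Ck_on_Suc_imp[OF Suc.prems(1)] Ck_on_Suc_imp[OF Suc.prems(2)] Ck_on_SucD(2)[OF Suc.prems(1)] Ck_on_SucD(2)[OF Suc.prems(2)] assms(1))
qed

lemma Ck_on_inverse:
  fixes f :: "'a::euclidean_space \<Rightarrow> real"
  assumes "open W" "Ck_on k W f" "\<And>x. x \<in> W \<Longrightarrow> f x \<noteq> 0"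
  shows "Ck_on k W (\<lambda>x. inverse (f x))"
  using assms(2)
proof (induction k)
  case 0
  then show ?case using assms(3) by (auto simp: Ck_on.simps intro!: continuous_on_inverse)
next
  case (Suc k)
  have *: "Ck_on k W (\<lambda>x. inverse (f x))" by (rule Suc.IH[OF Ck_on_Suc_imp[OF Suc.prems]])
  have "Ck_on k W (\<lambda>x. - (inverse (f x) * frechet_derivative f (at x) v * inverse (f x)))" for v
    by (intro Ck_on_bilinear[OF assms(1) bounded_bilinear_mult] *
        Ck_on_SucD(2)[OF Suc.prems] Ck_on_linear_compose[OF assms(1) bounded_linear_minus[OF bounded_linear_ident]])
  then show ?case
    by (intro Ck_on_SucI[OF assms(1) Deriv.has_derivative_inverse[OF assms(3) Ck_on_SucD(1)[OF Suc.prems]]]) auto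
qed

lemma Ck_on_sqrt:
  fixes f :: "'a::euclidean_space \<Rightarrow> real"
  assumes "open W" "Ck_on k W f" "\<And>x. x \<in> W \<Longrightarrow> 0 < f x"
  shows "Ck_on k W (\<lambda>x. sqrt (f x))"
  using assms(2)
proof (induction k)
  case 0
  then show ?case by (auto simp: Ck_on.simps intro!: continuous_on_real_sqrt)
next
  case (Suc k)
  have *: "Ck_on k W (\<lambda>x. sqrt (f x))" by (rule Suc.IH[OF Ck_on_Suc_imp[OF Suc.prems]])
  have der: "((\<lambda>x. sqrt (f x)) has_derivative
      (\<lambda>v. (1 / 2) *\<^sub>R (frechet_derivative f (at x) v * inverse (sqrt (f x))))) (at x)" if "x \<in> W" for x
    using Ck_on_SucD(1)[OF Suc.prems that] assms(3)[OF that]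
    by (auto intro!: derivative_eq_intros simp: field_simps)
  have "Ck_on k W (\<lambda>x. (1 / 2) *\<^sub>R (frechet_derivative f (at x) v * inverse (sqrt (f x))))" for v
    using assms(3)
    by (intro Ck_on_bilinear[OF assms(1) bounded_bilinear_mult] Ck_on_inverse *  assms(1)
        Ck_on_SucD(2)[OF Suc.prems] Ck_on_linear_compose[OF assms(1) bounded_linear_scaleR_right]) (metis less_irrefl real_sqrt_gt_0_iff)
  then show ?case
    by (intro Ck_on_SucI[OF assms(1) der]) auto
qed

lemma Ck_on_ident: "open W \<Longrightarrow> Ck_on k W (\<lambda>x::'a::euclidean_space. x)"
  by (cases k) (auto simp: Ck_on.simps(1) intro!: Ck_on_SucI[where D="\<lambda>_ v. v"])

lemmas Ck_on_scaleR = Ck_on_bilinear[OF _ bounded_bilinear_scaleR]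
lemmas Ck_on_mult = Ck_on_bilinear[OF _ bounded_bilinear_mult]
lemmas Ck_on_inner = Ck_on_bilinear[OF _ bounded_bilinear_inner]

lemma Ck_on_minus:
  "open W \<Longrightarrow> Ck_on k W f \<Longrightarrow> Ck_on k W (\<lambda>x. - f x)"
  by (rule Ck_on_linear_compose[OF _ bounded_linear_minus[OF bounded_linear_ident]])

lemma Ck_on_diff:
  "open W \<Longrightarrow> Ck_on k W f \<Longrightarrow> Ck_on k W g \<Longrightarrow> Ck_on k W (\<lambda>x. f x - g x)"
  using Ck_on_add[of W k f "\<lambda>x. - g x"] Ck_on_minus[of W k g] by simp

lemma Ck_on_vec_nth:
  "open W \<Longrightarrow> Ck_on k W f \<Longrightarrow> Ck_on k W (\<lambda>x. f x $ i)"
  by (rule Ck_on_linear_compose[OF _ bounded_linear_vec_nth])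

lemmas Ck_on_intros = Ck_on_const Ck_on_ident Ck_on_add Ck_on_diff Ck_on_minus Ck_on_scaleR
  Ck_on_mult Ck_on_inner Ck_on_vec_nth Ck_on_inverse Ck_on_sqrt

section \<open>Derivatives within the half space\<close>

text \<open>Derivatives within the half space are unique also at its boundary points, because from each of
  its points one can move to one side along every coordinate axis.\<close>

lemma frechet_derivative_half_space:
  fixes f :: "real^'n::finite \<Rightarrow> 'b::real_normed_vector"
  assumes "(f has_derivative D) (at x within half_space)" "x \<in> half_space"
  shows "deriv_half f x = D"
proof -
  have S: "\<exists>d. 0 < \<bar>d\<bar> \<and> \<bar>d\<bar> < r \<and> x + d *\<^sub>R i \<in> half_space" if "i \<in> Basis" "0 < r" for i :: "real^'n" and r
  proof -
    obtain j where i: "i = axis j 1" using \<open>i \<in> Basis\<close> by (auto simp: Basis_vec_def)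
    show ?thesis
      by (rule exI[of _ "r/2"]) (use assms(2) \<open>0 < r\<close> in \<open>auto simp: half_space_def i axis_def\<close>)
  qed
  have "(f has_derivative deriv_half f x) (at x within half_space)"
    using assms(1) frechet_derivative_works differentiable_def by blast
  from frechet_derivative_unique_within[OF this assms(1) S] show ?thesis by simp
qed

lemma smooth_onI:
  assumes "\<And>x. x \<in> S \<Longrightarrow> \<exists>W F. open W \<and> x \<in> W \<and> (\<forall>k. Ck_on k W F) \<and> (\<forall>y\<in>S \<inter> W. F y = f y)"
  shows "smooth_on S f"
  using assms unfolding smooth_on_def by blast

section \<open>Functions with vanishing indefinite integral\<close>

lemma sigma_finite_lebesgue: "sigma_finite_measure (lebesgue :: real measure)"
proof
  have "emeasure lebesgue {- real n..real n} \<noteq> \<infinity>" for n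
    using emeasure_completion[of "{- real n..real n}" lborel] by simp
  moreover have "(\<Union>n. {- real n..real n}) = UNIV"
  proof (intro equalityI subsetI UNIV_I)
    fix x :: real
    obtain n where "\<bar>x\<bar> \<le> real n" using real_arch_simple by blast
    then show "x \<in> (\<Union>n. {- real n..real n})" by (auto simp: abs_le_iff intro!: exI[of _ n])
  qed
  ultimately show "\<exists>A. countable A \<and> A \<subseteq> sets (lebesgue :: real measure) \<and>
      \<Union>A = space lebesgue \<and> (\<forall>a\<in>A. emeasure lebesgue a \<noteq> \<infinity>)"
    by (intro exI[of _ "range (\<lambda>n. {- real n..real n})"]) auto
qed

text \<open>The integral over a Borel set vanishes because intervals generate the Borel sets; a Lebesgue
  measurable set differs from a Borel set by a null set. This determines the weak derivative of a
  constant field almost everywhere.\<close>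

lemma negligible_nonzero_of_integrals_zero:
  fixes f :: "real \<Rightarrow> 'b::euclidean_space"
  assumes f: "f absolutely_integrable_on {a..b}"
    and zero: "\<And>c d. a \<le> c \<Longrightarrow> c \<le> d \<Longrightarrow> d \<le> b \<Longrightarrow> integral {c..d} f = 0"
  shows "negligible {t \<in> {a..b}. f t \<noteq> 0}"
proof -
  define g where "g x = indicator {a..b} x *\<^sub>R f x" for x
  have g: "integrable lebesgue g" using f by (simp add: set_integrable_def g_def[abs_def])
  have gA: "set_integrable lebesgue A g" if "A \<in> sets lebesgue" for A
    unfolding set_integrable_def by (rule integrable_mult_indicator[OF that g])
  have interval: "set_lebesgue_integral lebesgue {c..d} g = 0" for c d
  proof (cases "max a c \<le> min b d")
    case True
    have sub: "{max a c..min b d} \<subseteq> {a..b}" by auto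
    have "set_lebesgue_integral lebesgue {c..d} g = set_lebesgue_integral lebesgue {max a c..min b d} f"
      unfolding set_lebesgue_integral_def g_def
      by (rule Bochner_Integration.integral_cong) (auto simp: indicator_def)
    also have "\<dots> = integral {max a c..min b d} f"
      by (rule set_lebesgue_integral_eq_integral(2)[OF set_integrable_subset[OF f _ sub]]) simp
    also have "\<dots> = 0" by (rule zero) (use True in auto)
    finally show ?thesis .
  next
    case False
    then have "(\<lambda>x. indicator {c..d} x *\<^sub>R g x) = (\<lambda>x. 0)" by (auto simp: fun_eq_iff g_def indicator_def)
    then show ?thesis by (simp only: set_lebesgue_integral_def Bochner_Integration.integral_zero)
  qed
  have total: "integral\<^sup>L lebesgue g = 0"
  proof -
    have "integral\<^sup>L lebesgue g = set_lebesgue_integral lebesgue {a..b} g"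
      unfolding set_lebesgue_integral_def
      by (rule Bochner_Integration.integral_cong) (auto simp: g_def indicator_def)
    then show ?thesis by (simp add: interval)
  qed
  have borel: "set_lebesgue_integral lebesgue A g = 0" if "A \<in> sets borel" for A
    using that
  proof (induction rule: borel_set_induct)
    case empty
    then show ?case by (simp add: set_lebesgue_integral_def)
  next
    case (interval c d)
    then show ?case by (simp add: \<open>\<And>c d. set_lebesgue_integral lebesgue {c..d} g = 0\<close>)
  next
    case (compl A)
    then have A: "A \<in> sets lebesgue" "- A \<in> sets lebesgue" by (auto simp: Compl_in_sets_lebesgue)
    have "set_lebesgue_integral lebesgue (A \<union> - A) g
        = set_lebesgue_integral lebesgue A g + set_lebesgue_integral lebesgue (- A) g"
      by (rule set_integral_Un) (auto intro: gA A)
    then show ?case using compl total by (simp add: set_lebesgue_integral_def)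
  next
    case (union F)
    have "set_lebesgue_integral lebesgue (\<Union>i. F i) g = (\<Sum>i. set_lebesgue_integral lebesgue (F i) g)"
    proof (rule lebesgue_integral_countable_add)
      show "\<And>i. F i \<in> sets lebesgue" using union by auto
      then show "set_integrable lebesgue (\<Union>i. F i) g" by (intro gA) auto
      show "\<And>i j. i \<noteq> j \<Longrightarrow> F i \<inter> F j = {}" using union by (auto simp: disjoint_family_on_def)
    qed
    then show ?case using union by simp
  qed
  have "AE x in lebesgue. g x = 0"
  proof (rule sigma_finite_measure.density_zero[OF sigma_finite_lebesgue g])
    fix A :: "real set" assume A: "A \<in> sets lebesgue"
    then obtain S N N' where S: "A = S \<union> N" "N \<subseteq> N'" "N' \<in> null_sets lborel" "S \<in> sets lborel"
      by (rule sets_completionE)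
    have "N' \<in> null_sets lebesgue" using S(3) by (rule null_sets_completionI)
    then have "AE x in lebesgue. x \<notin> N'" by (rule AE_not_in)
    then have "AE x in lebesgue. indicator A x *\<^sub>R g x = indicator S x *\<^sub>R g x"
      by eventually_elim (use S in \<open>auto simp: indicator_def\<close>)
    then have "set_lebesgue_integral lebesgue A g = set_lebesgue_integral lebesgue S g"
      unfolding set_lebesgue_integral_def
      using borel_measurable_integrable[OF integrable_mult_indicator[OF A g]]
        borel_measurable_integrable[OF integrable_mult_indicator[OF sets_completionI_sets[OF S(4)] g]]
      by (intro integral_cong_AE) auto
    then show "set_lebesgue_integral lebesgue A g = 0" using borel S(4) by simp
  qed
  then obtain N where "negligible N" "{x. g x \<noteq> 0} \<subseteq> N"
    unfolding eventually_ae_filter_negligible by auto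
  then have "negligible {x. g x \<noteq> 0}" by (rule negligible_subset)
  then show ?thesis by (rule negligible_subset) (auto simp: g_def)
qed

text \<open>The manifold is covered by charts of two kinds, which differ in the function that serves as the
  normal coordinate: \<open>Core\<close> charts stay away from the boundary, \<open>Collar\<close> charts stay away from the
  central fibre.\<close>

datatype patch = Core | Collar

text \<open>The coordinates in \<open>A\<close> are those of the ball, the others those of the torus; with \<open>k + 1\<close> elements in
  \<open>A\<close> one obtains Morse index \<open>k\<close>. The normal coordinate of the model half space has to be one of the
  ball because the boundary is the sphere bundle.\<close>

locale disc_bundle =
  fixes A :: "'n::finite set"
  assumes nc_A: "normal_coord \<in> A"
begin

section \<open>The tube and its deck transformations\<close>

text \<open>The orthogonal projection to the ball factor. The inner product of that factor is written
  \<open>fib u \<bullet> v\<close>.\<close>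

definition fib :: "real^'n \<Rightarrow> real^'n" where
  "fib z = (\<chi> i. if i \<in> A then z $ i else 0)"

abbreviation nc :: 'n where "nc \<equiv> normal_coord"
abbreviation e :: "real^'n" where "e \<equiv> axis normal_coord 1"

definition tube :: "(real^'n) set" where
  "tube = {z. fib z \<bullet> z \<le> 1}"

lemma fib_nth: "fib z $ i = (if i \<in> A then z $ i else 0)"
  by (simp add: fib_def)

lemma fib_nc [simp]: "fib z $ nc = z $ nc"
  by (simp add: fib_nth nc_A)

lemma e_nth: "e $ i = (if i = nc then 1 else 0)"
  by (simp add: axis_def)

lemma linear_fib: "linear fib"
  by (rule linearI) (auto simp: vec_eq_iff fib_nth)

lemma bounded_linear_fib: "bounded_linear fib"
  by (simp add: linear_fib linear_conv_bounded_linear[symmetric])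

lemmas fib_add = linear_add[OF linear_fib] and fib_diff = linear_diff[OF linear_fib]
  and fib_scale = linear_scale[OF linear_fib] and fib_minus = linear_neg[OF linear_fib]
  and fib_0 [simp] = linear_0[OF linear_fib]

lemma fib_e [simp]: "fib e = e"
  by (auto simp: vec_eq_iff fib_nth e_nth nc_A)

lemma fib_fib [simp]: "fib (fib z) = fib z"
  by (simp add: vec_eq_iff fib_nth)

lemma inner_fib: "u \<bullet> fib v = fib u \<bullet> v"
  by (auto simp: inner_vec_def fib_nth intro!: sum.cong)

lemma inner_fib_commute: "fib u \<bullet> v = fib v \<bullet> u"
  by (metis inner_commute inner_fib)

lemma fib_inner_ge: "(z $ nc)\<^sup>2 \<le> fib z \<bullet> z"
proof -
  have "fib z \<bullet> z = fib z \<bullet> fib z" by (simp add: inner_fib)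
  also have "\<dots> = (norm (fib z))\<^sup>2" by (simp add: dot_square_norm)
  finally show ?thesis
    using component_le_norm_cart[of "fib z" nc] by (metis abs_le_square_iff abs_norm_cancel fib_nc)
qed

lemma inner_e: "u \<bullet> e = u $ nc" "e \<bullet> u = u $ nc"
  by (simp_all add: inner_axis inner_axis' )

lemma fib_inner_e: "fib u \<bullet> e = u $ nc"
  by (simp add: inner_e)

lemmas bl_fib_has_derivative [derivative_intros] = bounded_linear.has_derivative[OF bounded_linear_fib]
lemmas bl_fib_continuous_on [continuous_intros] = bounded_linear.continuous_on[OF bounded_linear_fib]
lemmas bl_fib_has_vector_derivative = bounded_linear.has_vector_derivative[OF bounded_linear_fib]

lemma Ck_on_fib: "open W \<Longrightarrow> Ck_on k W f \<Longrightarrow> Ck_on k W (\<lambda>x. fib (f x))"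
  by (rule Ck_on_linear_compose[OF _ bounded_linear_fib])

text \<open>The isometries of Euclidean space which preserve the two factors of the tube and act on the
  second factor by translations. All coordinate changes of the manifold are built from them.\<close>

definition Iso :: "(real^'n \<Rightarrow> real^'n) set" where
  "Iso = {g. \<exists>T c. orthogonal_transformation T \<and> (\<forall>u i. i \<notin> A \<longrightarrow> T u $ i = u $ i) \<and>
            (\<forall>i\<in>A. c $ i = 0) \<and> g = (\<lambda>z. T z + c)}"

definition lin :: "(real^'n \<Rightarrow> real^'n) \<Rightarrow> real^'n \<Rightarrow> real^'n" where
  "lin g u = g u - g 0"

lemma IsoE:
  assumes "g \<in> Iso"
  obtains T c where "orthogonal_transformation T" "\<And>u i. i \<notin> A \<Longrightarrow> T u $ i = u $ i"
    "\<And>i. i \<in> A \<Longrightarrow> c $ i = 0" "\<And>z. g z = T z + c" "lin g = T"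
proof -
  from assms obtain T c where T: "orthogonal_transformation T" "\<And>u i. i \<notin> A \<Longrightarrow> T u $ i = u $ i"
    "\<And>i. i \<in> A \<Longrightarrow> c $ i = 0" "g = (\<lambda>z. T z + c)"
    unfolding Iso_def by blast
  moreover from T(1) have "T 0 = 0" by (simp add: orthogonal_transformation_def linear_0)
  ultimately show thesis by (intro that[of T c]) (auto simp: lin_def fun_eq_iff)
qed

lemma IsoI:
  assumes "orthogonal_transformation T" "\<And>u i. i \<notin> A \<Longrightarrow> T u $ i = u $ i" "\<And>i. i \<in> A \<Longrightarrow> c $ i = 0"
  shows "(\<lambda>z. T z + c) \<in> Iso"
  using assms unfolding Iso_def by blast

context
  fixes g assumes g: "g \<in> Iso"
begin

lemma linear_lin: "linear (lin g)"
  using g by (elim IsoE) (simp add: orthogonal_transformation_def)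

lemma bounded_linear_lin: "bounded_linear (lin g)"
  using linear_lin by (simp add: linear_conv_bounded_linear)

lemma lin_inner: "lin g u \<bullet> lin g v = u \<bullet> v"
  using g by (elim IsoE) (simp add: orthogonal_transformation_def)

lemma lin_nth: "i \<notin> A \<Longrightarrow> lin g u $ i = u $ i"
  using g by (elim IsoE) simp

text \<open>The linear part is orthogonal and does not change the coordinates outside \<open>A\<close>. So it preserves the
  norm of the component in the ball factor, and vectors without such a component are mapped to vectors
  of the same kind.\<close>

lemma lin_fib: "lin g (fib u) = fib (lin g u)"
proof -
  have split: "u \<bullet> v = fib u \<bullet> fib v + (u - fib u) \<bullet> (v - fib v)" for u v
    by (simp add: inner_diff_left inner_diff_right inner_fib fib_diff)
  have B: "lin g u - fib (lin g u) = u - fib u" for u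
    by (auto simp: vec_eq_iff fib_nth lin_nth)
  have 1: "fib (lin g u) \<bullet> fib (lin g u) = fib u \<bullet> fib u" for u
    using split[of "lin g u" "lin g u"] split[of u u] by (simp add: B lin_inner)
  have "fib (lin g (u - fib u)) = 0"
    using 1[of "u - fib u"] by (simp add: fib_diff)
  then have "fib (lin g u) = fib (lin g (fib u))"
    by (simp add: linear_diff[OF linear_lin] fib_diff)
  also have "\<dots> = lin g (fib u)"
    using B[of "fib u"] by simp
  finally show ?thesis by simp
qed

lemma lin_fib_inner: "fib (lin g u) \<bullet> lin g v = fib u \<bullet> v"
  by (metis lin_fib lin_inner)

lemma fib_iso: "fib (g z) = fib (lin g z)"
proof -
  have "fib (g 0) = 0" using g
    by (elim IsoE) (auto simp: vec_eq_iff fib_nth orthogonal_transformation_def linear_0)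
  then show ?thesis by (simp add: lin_def fib_diff)
qed

lemma iso_diff: "g z - g w = lin g (z - w)"
  using linear_diff[OF linear_lin, of z w] by (simp add: lin_def)

lemma iso_add: "g (z + w) = g z + lin g w"
  using iso_diff[of "z + w" z] by (simp add: algebra_simps)

lemma fib_iso_inner: "fib (g z) \<bullet> g w = fib z \<bullet> w"
  by (metis fib_iso fib_fib inner_fib lin_fib_inner)

lemma fib_iso_lin_inner: "fib (g z) \<bullet> lin g w = fib z \<bullet> w"
  by (metis fib_iso lin_fib_inner)

lemma iso_tube: "g z \<in> tube \<longleftrightarrow> z \<in> tube"
  by (simp add: tube_def fib_iso_inner)

lemma iso_nth_diff: "i \<notin> A \<Longrightarrow> g z $ i - g w $ i = z $ i - w $ i"
  by (metis iso_diff lin_nth vector_minus_component)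

lemma iso_has_derivative: "(g has_derivative lin g) (at z within S)"
proof -
  have "g = (\<lambda>z. lin g z + g 0)" by (simp add: lin_def)
  moreover have "((\<lambda>z. lin g z + g 0) has_derivative lin g) (at z within S)"
    by (auto intro!: derivative_eq_intros bounded_linear_imp_has_derivative bounded_linear_lin)
  ultimately show ?thesis by simp
qed

lemma iso_continuous_on: "continuous_on S g"
  by (rule has_derivative_continuous_on) (rule iso_has_derivative)

lemma bij_iso: "bij g"
proof -
  obtain T c where T: "orthogonal_transformation T" "\<And>z. g z = T z + c" using g by (elim IsoE) blast
  have "g = (\<lambda>z. z + c) \<circ> T" using T by auto
  moreover have "bij (\<lambda>z. z + c)" by (rule bij_betw_byWitness[where f'="\<lambda>z. z - c"]) auto
  ultimately show ?thesis
    using bij_comp[OF orthogonal_transformation_bij[OF T(1)]] by simp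
qed

lemma inj_lin: "lin g u = lin g v \<longleftrightarrow> u = v"
proof
  assume "lin g u = lin g v"
  then have "lin g (u - v) = 0" by (simp add: linear_diff[OF linear_lin])
  then show "u = v" using lin_inner[of "u - v" "u - v"] by simp
qed simp

lemma iso_inverse: "inv g \<in> Iso" "inv g (g z) = z" "g (inv g z) = z"
proof -
  show inv: "inv g (g z) = z" "g (inv g z) = z" for z
    using bij_iso by (auto simp: bij_is_inj bij_is_surj surj_f_inv_f)
  obtain T c where T: "orthogonal_transformation T" "\<And>u i. i \<notin> A \<Longrightarrow> T u $ i = u $ i"
    "\<And>i. i \<in> A \<Longrightarrow> c $ i = 0" "\<And>z. g z = T z + c" using g by (elim IsoE) blast
  note Ti = orthogonal_transformation_inv[OF T(1)]
  have TT: "T (inv T u) = u" "inv T (T u) = u" for u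
    using orthogonal_transformation_bij[OF T(1)] by (auto simp: bij_is_inj bij_is_surj surj_f_inv_f)
  have lTi: "linear (inv T)" using Ti by (simp add: orthogonal_transformation_def)
  have nth: "inv T u $ i = u $ i" if "i \<notin> A" for u i
    using T(2)[OF that, of "inv T u"] by (simp add: TT)
  have Tc: "T c = c"
  proof -
    have f0: "fib c = 0" using T(3) by (simp add: vec_eq_iff fib_nth)
    have "lin g = T" using T by (simp add: lin_def fun_eq_iff) (metis T(1) orthogonal_transformation_def linear_0)
    then have "fib (T c) = 0" using lin_fib[of c] f0 T(1)
      by (metis orthogonal_transformation_def linear_0)
    then have "T c $ i = 0" if "i \<in> A" for i using that by (metis fib_nth zero_index)
    then show ?thesis using T(2,3) by (metis vec_eq_iff)
  qed
  then have Tc': "inv T c = c" using TT by metis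
  have "inv g = (\<lambda>z. inv T z + (- c))"
  proof
    fix z
    have "g (inv T z + (- c)) = z"
      using T(1) by (simp add: T(4) orthogonal_transformation_def linear_diff TT Tc)
    then show "inv g z = inv T z + (- c)" by (metis inv(1))
  qed
  then show "inv g \<in> Iso" using IsoI[OF Ti nth, of "- c"] T(3) by simp
qed

end

lemma lin_inv:
  assumes "g \<in> Iso"
  shows "lin (inv g) (lin g u) = u" "lin g (lin (inv g) u) = u"
proof -
  note i = iso_inverse[OF assms]
  show "lin (inv g) (lin g u) = u"
    using iso_diff[OF i(1), of "g u" "g 0"] i(2) by (simp add: lin_def)
  show "lin g (lin (inv g) u) = u"
    using iso_diff[OF assms, of "inv g u" "inv g 0"] i(3) by (simp add: lin_def)
qed

lemma iso_id: "(\<lambda>z. z) \<in> Iso"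
  using IsoI[of "\<lambda>z. z" 0] by (simp add: orthogonal_transformation_id)

lemma iso_compose:
  assumes "g \<in> Iso" "h \<in> Iso"
  shows "(\<lambda>z. h (g z)) \<in> Iso" "lin (\<lambda>z. h (g z)) u = lin h (lin g u)"
proof -
  obtain T c where T: "orthogonal_transformation T" "\<And>u i. i \<notin> A \<Longrightarrow> T u $ i = u $ i"
    "\<And>i. i \<in> A \<Longrightarrow> c $ i = 0" "\<And>z. g z = T z + c" using assms(1) by (elim IsoE) blast
  obtain T' c' where T': "orthogonal_transformation T'" "\<And>u i. i \<notin> A \<Longrightarrow> T' u $ i = u $ i"
    "\<And>i. i \<in> A \<Longrightarrow> c' $ i = 0" "\<And>z. h z = T' z + c'" "lin h = T'" using assms(2) by (elim IsoE) blast
  have "fib c = 0" using T(3) by (simp add: vec_eq_iff fib_nth)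
  then have "fib (T' c) = 0"
    using lin_fib[OF assms(2), of c] T'(1,5) by (metis orthogonal_transformation_def linear_0)
  then have "T' c $ i = 0" if "i \<in> A" for i using that by (metis fib_nth zero_index)
  then have 1: "(T' c + c') $ i = 0" if "i \<in> A" for i using that T'(3) by simp
  have lT': "linear T'" using T'(1) by (simp add: orthogonal_transformation_def)
  have "(\<lambda>z. h (g z)) = (\<lambda>z. (T' \<circ> T) z + (T' c + c'))"
    by (simp add: T(4) T'(4) linear_add[OF lT'] add.assoc)
  then show "(\<lambda>z. h (g z)) \<in> Iso"
    using IsoI[OF orthogonal_transformation_compose[OF T'(1) T(1)], of "T' c + c'"] T(2) T'(2) 1 by simp
  show "lin (\<lambda>z. h (g z)) u = lin h (lin g u)"
    using iso_diff[OF assms(2)] by (simp add: lin_def)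
qed

lemma translation_iso:
  assumes "fib c = 0"
  shows "(\<lambda>z. z + c) \<in> Iso" "lin (\<lambda>z. z + c) u = u"
proof -
  have "c $ i = 0" if "i \<in> A" for i using assms that by (metis fib_nth zero_index)
  then show "(\<lambda>z. z + c) \<in> Iso" using IsoI[of "\<lambda>z. z" c] by (simp add: orthogonal_transformation_id)
qed (simp add: lin_def)

text \<open>The reflection in the bisector of two unit vectors of the disc factor exchanges them.\<close>

lemma iso_moving:
  assumes "fib p = p" "norm p = 1" "fib c = 0"
  obtains g where "g \<in> Iso" "lin g e = p" "\<And>z. g z = lin g z + c"
proof (cases "p = e")
  case True
  then show ?thesis
    using that[OF translation_iso(1)[OF assms(3)]] translation_iso(2)[OF assms(3)] by metis
next
  case False
  define v where "v = p - e"
  define T where "T = (\<lambda>z. z - (2 * (z \<bullet> v) / (v \<bullet> v)) *\<^sub>R v)"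
  have v0: "v \<bullet> v \<noteq> 0" using False by (simp add: v_def)
  have lT: "linear T"
    by (rule linearI) (simp_all add: T_def inner_add_left algebra_simps add_divide_distrib)
  have "T u \<bullet> T w = u \<bullet> w" for u w
    using v0 by (simp add: T_def inner_diff_left inner_diff_right field_simps inner_commute)
  with lT have oT: "orthogonal_transformation T" by (simp add: orthogonal_transformation_def)
  have "fib v = v" using assms(1) by (simp add: v_def fib_diff)
  then have "v $ i = 0" if "i \<notin> A" for i using that by (metis fib_nth)
  then have nth: "T u $ i = u $ i" if "i \<notin> A" for u i using that by (simp add: T_def)
  have pp: "p \<bullet> p = 1" using assms(2) by (simp add: dot_square_norm)
  have "e \<bullet> v = p $ nc - 1" "v \<bullet> v = 2 - 2 * p $ nc"
    using pp by (simp_all add: v_def inner_diff_left inner_diff_right inner_e e_nth)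
  then have "2 * (e \<bullet> v) / (v \<bullet> v) = - 1" using v0 by (simp add: field_simps)
  then have Te: "T e = p" by (simp add: T_def v_def)
  have c0: "c $ i = 0" if "i \<in> A" for i using assms(3) that by (metis fib_nth zero_index)
  have T0: "T 0 = 0" by (simp add: linear_0 lT)
  show ?thesis
    by (rule that[OF IsoI[OF oT nth c0]]) (auto simp: lin_def T0 Te)
qed

text \<open>The action of the lattice. The vector is given by a function on all indices, of which only the
  values outside \<open>A\<close> matter. The quotient is realised on a fundamental domain, in which \<open>proj z\<close> is the
  representative of the orbit of \<open>z\<close>: its coordinates outside \<open>A\<close> lie in \<open>[0,1)\<close>.\<close>

definition deck :: "('n \<Rightarrow> int) \<Rightarrow> real^'n \<Rightarrow> real^'n" where
  "deck m z = (\<chi> i. if i \<in> A then (if even (\<Sum>j\<in>-A. m j) then z $ i else - z $ i) else z $ i + of_int (m i))"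

definition proj :: "real^'n \<Rightarrow> real^'n" where
  "proj z = deck (\<lambda>i. - \<lfloor>z $ i\<rfloor>) z"

lemma deck_iso: "deck m \<in> Iso"
proof -
  define T where "T = (\<lambda>z::real^'n. (\<chi> i. if i \<in> A then (if even (\<Sum>j\<in>-A. m j) then z $ i else - z $ i) else z $ i) :: real^'n)"
  define c where "c = ((\<chi> i. if i \<in> A then 0 else of_int (m i)) :: real^'n)"
  have "linear T" by (rule linearI) (auto simp: T_def vec_eq_iff)
  moreover have "T u \<bullet> T v = u \<bullet> v" for u v
    by (auto simp: T_def inner_vec_def intro!: sum.cong)
  ultimately have "orthogonal_transformation T" by (simp add: orthogonal_transformation_def)
  then have "(\<lambda>z. T z + c) \<in> Iso" by (rule IsoI) (auto simp: T_def c_def)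
  moreover have "(\<lambda>z. T z + c) = deck m" by (auto simp: T_def c_def deck_def vec_eq_iff fun_eq_iff)
  ultimately show ?thesis by simp
qed

lemma deck_deck: "deck m (deck m' z) = deck (\<lambda>i. m i + m' i) z"
  by (auto simp: deck_def vec_eq_iff sum.distrib)

lemma deck_0 [simp]: "deck (\<lambda>i. 0) z = z"
  by (simp add: deck_def vec_eq_iff)

lemma deck_cong: "(\<And>i. i \<notin> A \<Longrightarrow> m i = m' i) \<Longrightarrow> deck m = deck m'"
proof -
  assume m: "\<And>i. i \<notin> A \<Longrightarrow> m i = m' i"
  then have "sum m (- A) = sum m' (- A)" by (intro sum.cong) auto
  with m show ?thesis by (auto simp: deck_def fun_eq_iff vec_eq_iff)
qed

lemma proj_deck [simp]: "proj (deck m z) = proj z"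
proof -
  have "deck (\<lambda>i. - \<lfloor>deck m z $ i\<rfloor>) (deck m z) = deck (\<lambda>i. - \<lfloor>deck m z $ i\<rfloor> + m i) z"
    by (rule deck_deck)
  also have "\<dots> = deck (\<lambda>i. - \<lfloor>z $ i\<rfloor>) z"
    by (rule fun_cong[OF deck_cong]) (simp add: deck_def)
  finally show ?thesis by (simp add: proj_def)
qed

lemma proj_proj [simp]: "proj (proj z) = proj z"
  by (metis proj_deck proj_def)

lemma proj_eqD:
  assumes "proj z = proj z'"
  obtains m where "z' = deck m z"
proof
  have "z' = deck (\<lambda>i. \<lfloor>z' $ i\<rfloor>) (proj z')" by (simp add: proj_def deck_deck)
  also have "\<dots> = deck (\<lambda>i. \<lfloor>z' $ i\<rfloor> + (- \<lfloor>z $ i\<rfloor>)) z"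
    unfolding assms[symmetric] unfolding proj_def by (rule deck_deck)
  finally show "z' = deck (\<lambda>i. \<lfloor>z' $ i\<rfloor> + (- \<lfloor>z $ i\<rfloor>)) z" .
qed

lemma proj_in_tube [simp]: "proj z \<in> tube \<longleftrightarrow> z \<in> tube"
  by (simp add: proj_def iso_tube[OF deck_iso])

lemma fib_proj_inner: "fib (proj z) \<bullet> proj z = fib z \<bullet> z"
  by (simp add: proj_def fib_iso_inner[OF deck_iso])

lemma proj_nth: "i \<notin> A \<Longrightarrow> 0 \<le> proj z $ i \<and> proj z $ i < 1"
  by (simp add: proj_def deck_def) linarith

text \<open>A deck transformation that moves no torus coordinate by as much as 1 is the identity. This is why
  patches of width less than 1 embed into the quotient.\<close>

lemma proj_separated:
  assumes "proj z = proj z'" "\<And>i. i \<notin> A \<Longrightarrow> \<bar>z $ i - z' $ i\<bar> < 1"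
  shows "z = z'"
proof -
  obtain m where m: "z' = deck m z" using assms(1) by (rule proj_eqD)
  have "m i = 0" if "i \<notin> A" for i
  proof -
    have "\<bar>of_int (m i) :: real\<bar> < 1" using assms(2)[OF that] that by (simp add: m deck_def)
    then show ?thesis by linarith
  qed
  then have "deck m = deck (\<lambda>i. 0)" by (rule deck_cong)
  then show ?thesis by (simp add: m)
qed

text \<open>Some deck transformation maps \<open>k z\<close> to \<open>k' z'\<close>, and \<open>g\<close> is obtained by inserting it between \<open>k\<close> and
  the inverse of \<open>k'\<close>. This is what makes all coordinate changes come from elements of \<open>Iso\<close>.\<close>

lemma proj_eq_iso:
  assumes "k \<in> Iso" "k' \<in> Iso" "proj (k z) = proj (k' z')"
  obtains g where "g \<in> Iso" "g z = z'" "\<And>w. proj (k' (g w)) = proj (k w)"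
proof -
  obtain m where m: "k' z' = deck m (k z)" using assms(3) by (rule proj_eqD)
  show thesis
  proof
    show "(\<lambda>w. inv k' (deck m (k w))) \<in> Iso"
      using iso_compose(1)[OF iso_compose(1)[OF assms(1) deck_iso] iso_inverse(1)[OF assms(2)]] .
    show "inv k' (deck m (k z)) = z'"
      by (metis m iso_inverse(2)[OF assms(2)])
    show "proj (k' (inv k' (deck m (k w)))) = proj (k w)" for w
      by (simp add: iso_inverse(3)[OF assms(2)])
  qed
qed

section \<open>Coordinates on the tube\<close>

text \<open>Both kinds of charts use a point \<open>z\<close> of the tube as a preliminary coordinate and modify only its
  normal coordinate. On the core it is shifted by 2, which makes it larger than 1. On the collar,
  where \<open>z $ nc > 0\<close>, it is replaced by \<open>1 - |y|\<^sup>2\<close> with \<open>y = fib z\<close>: this polynomial is nonnegative on the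
  tube, vanishes exactly on its boundary, and is less than 1 on the collar. So the size of the normal
  coordinate tells the kind of the chart, and the metric can be given by one formula for all charts.

  The inverse of the collar coordinates has to recover \<open>z $ nc\<close>, which is the square root of \<open>rad x\<close>.
  The form \<open>side\<close> is the inner product of the ball factor without the normal coordinate, and \<open>- ell x\<close> is
  the differential of \<open>rad\<close> at \<open>x\<close>.\<close>

definition side :: "real^'n \<Rightarrow> real^'n \<Rightarrow> real" where
  "side u v = fib u \<bullet> v - u $ nc * v $ nc"

definition rad :: "real^'n \<Rightarrow> real" where
  "rad x = 1 - x $ nc - side x x"

definition ell :: "real^'n \<Rightarrow> real^'n \<Rightarrow> real" where
  "ell x u = u $ nc + 2 * side x u"

definition small :: "real^'n \<Rightarrow> bool" where
  "small z \<longleftrightarrow> (\<forall>i. i \<notin> A \<longrightarrow> \<bar>z $ i\<bar> < 1/2)"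

primrec region :: "patch \<Rightarrow> (real^'n) set" where
  "region Core = {z. small z \<and> fib z \<bullet> z < 1}"
| "region Collar = {z. small z \<and> 0 < z $ nc}"

definition patch_set :: "patch \<Rightarrow> (real^'n) set" where
  "patch_set p = tube \<inter> region p"

primrec fwd :: "patch \<Rightarrow> real^'n \<Rightarrow> real^'n" where
  "fwd Core z = z + 2 *\<^sub>R e"
| "fwd Collar z = z + (1 - fib z \<bullet> z - z $ nc) *\<^sub>R e"

primrec bwd :: "patch \<Rightarrow> real^'n \<Rightarrow> real^'n" where
  "bwd Core x = x - 2 *\<^sub>R e"
| "bwd Collar x = x + (sqrt (rad x) - x $ nc) *\<^sub>R e"

primrec coord_region :: "patch \<Rightarrow> (real^'n) set" where
  "coord_region Core = {x. bwd Core x \<in> region Core}"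
| "coord_region Collar = {x. small x \<and> 0 < rad x}"

primrec dfwd :: "patch \<Rightarrow> real^'n \<Rightarrow> real^'n \<Rightarrow> real^'n" where
  "dfwd Core z w = w"
| "dfwd Collar z w = w + (- 2 * (fib z \<bullet> w) - w $ nc) *\<^sub>R e"

primrec dbwd :: "patch \<Rightarrow> real^'n \<Rightarrow> real^'n \<Rightarrow> real^'n" where
  "dbwd Core x u = u"
| "dbwd Collar x u = u + (- ell x u / (2 * sqrt (rad x)) - u $ nc) *\<^sub>R e"

lemma patch_eta:
  "fwd Collar = (\<lambda>z. z + (1 - fib z \<bullet> z - z $ nc) *\<^sub>R e)" "fwd Core = (\<lambda>z. z + 2 *\<^sub>R e)"
  "bwd Collar = (\<lambda>x. x + (sqrt (rad x) - x $ nc) *\<^sub>R e)" "bwd Core = (\<lambda>x. x - 2 *\<^sub>R e)"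
  "dfwd Collar z = (\<lambda>w. w + (- 2 * (fib z \<bullet> w) - w $ nc) *\<^sub>R e)" "dfwd Core z = (\<lambda>w. w)"
  "dbwd Collar x = (\<lambda>u. u + (- ell x u / (2 * sqrt (rad x)) - u $ nc) *\<^sub>R e)" "dbwd Core x = (\<lambda>u. u)"
  by (simp_all add: fun_eq_iff)

lemma side_commute: "side u v = side v u"
  by (simp add: side_def inner_fib_commute mult.commute)

lemma side_linear:
  "side (u + u') v = side u v + side u' v" "side (r *\<^sub>R u) v = r * side u v"
  "side (u - u') v = side u v - side u' v" "side (- u) v = - side u v"
  "side v (u + u') = side v u + side v u'" "side v (r *\<^sub>R u) = r * side v u"
  "side v (u - u') = side v u - side v u'" "side v (- u) = - side v u"
  by (simp_all add: side_def fib_add fib_diff fib_scale fib_minus inner_add_left inner_add_right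
      inner_diff_left inner_diff_right algebra_simps)

lemma side_e [simp]: "side u e = 0" "side e u = 0" "side 0 u = 0" "side u 0 = 0"
  by (simp_all add: side_def fib_inner_e inner_e e_nth)

lemma side_nonneg: "0 \<le> side u u"
  using fib_inner_ge[of u] by (simp add: side_def power2_eq_square)

lemma fib_inner_side: "fib u \<bullet> v = side u v + u $ nc * v $ nc"
  by (simp add: side_def)

lemma ell_linear:
  "ell x (u + v) = ell x u + ell x v" "ell x (r *\<^sub>R u) = r * ell x u" "ell x e = 1" "ell x 0 = 0"
  by (simp_all add: ell_def side_linear e_nth algebra_simps)

lemma fwd_nth: "i \<noteq> nc \<Longrightarrow> fwd p z $ i = z $ i"
  and bwd_nth: "i \<noteq> nc \<Longrightarrow> bwd p x $ i = x $ i"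
  and dfwd_nth: "i \<noteq> nc \<Longrightarrow> dfwd p z w $ i = w $ i"
  and dbwd_nth: "i \<noteq> nc \<Longrightarrow> dbwd p x u $ i = u $ i"
  by (cases p; simp add: e_nth)+

lemma fwd_Collar_nc: "fwd Collar z $ nc = 1 - fib z \<bullet> z"
  by (simp add: e_nth)

lemma small_cong: "(\<And>i. i \<noteq> nc \<Longrightarrow> z $ i = w $ i) \<Longrightarrow> small z = small w"
  unfolding small_def using nc_A by metis

lemma rad_fwd: "rad (fwd Collar z) = (z $ nc)\<^sup>2"
  by (simp add: rad_def side_linear e_nth fib_inner_side power2_eq_square)

lemma ell_fwd: "ell (fwd Collar z) (dfwd Collar z w) = - 2 * z $ nc * w $ nc"
  by (simp add: ell_def side_linear e_nth fib_inner_side)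

lemma side_dfwd: "side (dfwd p z w) (dfwd p z w') = side w w'"
  by (cases p) (simp_all add: side_linear)

lemma bwd_fwd: "z \<in> region p \<Longrightarrow> bwd p (fwd p z) = z"
proof (cases p)
  case Collar
  assume "z \<in> region p"
  then have "sqrt (rad (fwd Collar z)) = z $ nc"
    using Collar unfolding rad_fwd by (simp add: real_sqrt_unique)
  then show ?thesis using Collar by (simp add: e_nth algebra_simps vec_eq_iff)
qed simp

lemma coord_region_nc: "x \<in> coord_region p \<Longrightarrow> (x $ nc < 1) = (p = Collar)" "x \<in> coord_region p \<Longrightarrow> x $ nc \<noteq> 1"
proof -
  assume x: "x \<in> coord_region p"
  have "p = Collar \<and> x $ nc < 1 \<or> p = Core \<and> x $ nc > 1"
  proof (cases p)
    case Core
    have "(x $ nc - 2)\<^sup>2 \<le> fib (bwd Core x) \<bullet> bwd Core x"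
      using fib_inner_ge[of "bwd Core x"] by (simp add: e_nth)
    also have "\<dots> < 1" using x Core by simp
    finally have "\<bar>x $ nc - 2\<bar> < 1" using abs_square_less_1 by blast
    then show ?thesis using Core by linarith
  next
    case Collar
    then show ?thesis using x side_nonneg[of x] by (simp add: rad_def)
  qed
  then show "(x $ nc < 1) = (p = Collar)" "x $ nc \<noteq> 1" by auto
qed

lemma fwd_bwd: "x \<in> coord_region p \<Longrightarrow> fwd p (bwd p x) = x"
proof (cases p)
  case Collar
  assume "x \<in> coord_region p"
  then have "(sqrt (rad x))\<^sup>2 = rad x" using Collar by simp
  moreover have "bwd Collar x $ nc = sqrt (rad x)" by (simp add: e_nth)
  moreover have "side (bwd Collar x) (bwd Collar x) = side x x" by (simp add: side_linear)
  ultimately have "1 - fib (bwd Collar x) \<bullet> bwd Collar x = x $ nc"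
    by (simp add: fib_inner_side rad_def power2_eq_square del: bwd.simps)
  then have "fwd Collar (bwd Collar x) $ i = x $ i" for i
    by (cases "i = nc") (simp_all only: fwd_Collar_nc fwd_nth bwd_nth not_False_eq_True)
  then show ?thesis using Collar by (simp add: vec_eq_iff)
qed simp

lemma half_space_fwd: "z \<in> patch_set p \<Longrightarrow> fwd p z \<in> half_space"
proof (cases p)
  case Core
  assume "z \<in> patch_set p"
  then have "(z $ nc)\<^sup>2 < 1" using Core fib_inner_ge[of z] by (simp add: patch_set_def)
  then have "\<bar>z $ nc\<bar> < 1" using abs_square_less_1 by blast
  then show ?thesis using Core by (simp add: half_space_def e_nth)
next
  case Collar
  assume "z \<in> patch_set p"
  then show ?thesis using Collar fwd_Collar_nc[of z] by (simp add: half_space_def patch_set_def tube_def)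
qed

lemma fwd_coord_region: "z \<in> region p \<Longrightarrow> fwd p z \<in> coord_region p"
proof (cases p)
  case Collar
  assume "z \<in> region p"
  then show ?thesis using Collar rad_fwd[of z] small_cong[of "fwd Collar z" z] fwd_nth[of _ Collar z] by auto
qed (simp add: bwd_fwd)

lemma bwd_dom: "x \<in> half_space \<Longrightarrow> x \<in> coord_region p \<Longrightarrow> bwd p x \<in> patch_set p"
proof (cases p)
  case Core
  assume "x \<in> coord_region p"
  then show ?thesis using Core by (simp add: patch_set_def tube_def)
next
  case Collar
  assume x: "x \<in> half_space" "x \<in> coord_region p"
  have "1 - fib (bwd Collar x) \<bullet> bwd Collar x = x $ nc"
    using fwd_Collar_nc[of "bwd Collar x"] fwd_bwd[OF x(2)] Collar by (simp del: bwd.simps fwd.simps)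
  moreover have "small (bwd Collar x) = small x"
    by (rule small_cong) (simp only: bwd_nth not_False_eq_True)
  moreover have "bwd Collar x $ nc = sqrt (rad x)" by (simp add: e_nth)
  ultimately show ?thesis using x Collar by (simp add: patch_set_def tube_def half_space_def del: bwd.simps)
qed

lemma fwd_image: "fwd p ` patch_set p = half_space \<inter> coord_region p"
proof
  show "fwd p ` patch_set p \<subseteq> half_space \<inter> coord_region p"
    using half_space_fwd fwd_coord_region by (auto simp: patch_set_def)
  show "half_space \<inter> coord_region p \<subseteq> fwd p ` patch_set p"
    using bwd_dom fwd_bwd by (metis IntD1 IntD2 image_eqI subsetI)
qed

lemma dbwd_dfwd: "z \<in> region p \<Longrightarrow> dbwd p (fwd p z) (dfwd p z w) = w"
proof (cases p)
  case Collar
  assume z: "z \<in> region p"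
  then have "sqrt (rad (fwd Collar z)) = z $ nc"
    using Collar unfolding rad_fwd by (simp add: real_sqrt_unique)
  then have "dbwd Collar (fwd Collar z) (dfwd Collar z w) $ nc = w $ nc"
    using z Collar by (simp add: ell_fwd e_nth del: fwd.simps dfwd.simps)
  then have "dbwd Collar (fwd Collar z) (dfwd Collar z w) $ i = w $ i" for i
    by (cases "i = nc") (simp_all only: dbwd_nth dfwd_nth not_False_eq_True)
  then show ?thesis using Collar by (simp add: vec_eq_iff)
qed simp

lemma dfwd_dbwd: "x \<in> coord_region p \<Longrightarrow> dfwd p (bwd p x) (dbwd p x u) = u"
proof (cases p)
  case Collar
  assume "x \<in> coord_region p"
  then have "0 < sqrt (rad x)" using Collar by simp
  moreover have "bwd Collar x $ nc = sqrt (rad x)" "dbwd Collar x u $ nc = - ell x u / (2 * sqrt (rad x))"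
    by (simp_all add: e_nth)
  moreover have "side (bwd Collar x) (dbwd Collar x u) = side x u" by (simp add: side_linear)
  ultimately have "- 2 * (fib (bwd Collar x) \<bullet> dbwd Collar x u) = u $ nc"
    by (simp add: fib_inner_side ell_def field_simps del: bwd.simps dbwd.simps)
  then have "dfwd Collar (bwd Collar x) (dbwd Collar x u) $ nc = u $ nc"
    by (simp add: e_nth del: bwd.simps dbwd.simps)
  then have "dfwd Collar (bwd Collar x) (dbwd Collar x u) $ i = u $ i" for i
    by (cases "i = nc") (simp_all only: dbwd_nth dfwd_nth not_False_eq_True)
  then show ?thesis using Collar by (simp add: vec_eq_iff)
qed simp

lemmas vec_nth_has_derivative [derivative_intros] = bounded_linear.has_derivative[OF bounded_linear_vec_nth]

lemma fwd_has_derivative: "(fwd p has_derivative dfwd p z) (at z within S)"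
proof (cases p)
  case Collar
  have "((\<lambda>z. z + (1 - fib z \<bullet> z - z $ nc) *\<^sub>R e) has_derivative
      (\<lambda>w. w + (- 2 * (fib z \<bullet> w) - w $ nc) *\<^sub>R e)) (at z within S)"
    by (rule derivative_eq_intros refl)+ (auto simp: fun_eq_iff inner_fib_commute[of _ z])
  then show ?thesis using Collar by (simp only: patch_eta)
qed (auto simp: patch_eta intro!: derivative_eq_intros)

lemma rad_has_derivative: "(rad has_derivative (\<lambda>u. - ell x u)) (at x within S)"
  unfolding rad_def side_def
  by (rule derivative_eq_intros refl)+
    (auto simp: fun_eq_iff ell_def side_def inner_fib_commute[of _ x])

lemma ell_has_derivative: "((\<lambda>x. ell x v) has_derivative (\<lambda>u. 2 * side u v)) (at x within S)"
  unfolding ell_def side_def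
  by (rule derivative_eq_intros refl)+ (auto simp: fun_eq_iff)

lemma bwd_has_derivative:
  assumes "x \<in> coord_region p"
  shows "(bwd p has_derivative dbwd p x) (at x within S)"
proof (cases p)
  case Collar
  have "0 < rad x" using Collar assms by simp
  have "((\<lambda>x. sqrt (rad x)) has_derivative (\<lambda>u. - ell x u * (inverse (sqrt (rad x)) / 2))) (at x within S)"
    by (rule DERIV_compose_FDERIV[OF DERIV_real_sqrt[OF \<open>0 < rad x\<close>] rad_has_derivative])
  then have "((\<lambda>x. sqrt (rad x)) has_derivative (\<lambda>u. - ell x u / (2 * sqrt (rad x)))) (at x within S)"
    by (simp add: field_simps)
  then have "((\<lambda>x. x + (sqrt (rad x) - x $ nc) *\<^sub>R e) has_derivative
      (\<lambda>u. u + (- ell x u / (2 * sqrt (rad x)) - u $ nc) *\<^sub>R e)) (at x within S)"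
    by (intro has_derivative_add has_derivative_ident has_derivative_scaleR_left has_derivative_diff vec_nth_has_derivative)
  then show ?thesis using Collar by (simp only: patch_eta)
qed (auto simp: patch_eta intro!: derivative_eq_intros)

lemma linear_dfwd: "linear (dfwd p z)"
  using fwd_has_derivative has_derivative_linear by blast

lemma linear_dbwd: "x \<in> coord_region p \<Longrightarrow> linear (dbwd p x)"
  using bwd_has_derivative has_derivative_linear by blast

lemma fwd_continuous_on: "continuous_on S (fwd p)"
  by (rule has_derivative_continuous_on) (rule fwd_has_derivative)

lemma bwd_continuous_on: "continuous_on (coord_region p) (bwd p)"
  by (rule has_derivative_continuous_on) (rule bwd_has_derivative)

lemma open_small: "open {z. small z}"
proof -
  have "{z. small z} = (\<Inter>i\<in>-A. {z. \<bar>z $ i\<bar> < 1/2})" by (auto simp: small_def)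
  moreover have "open {z::real^'n. \<bar>z $ i\<bar> < 1/2}" for i
    by (intro open_Collect_less continuous_intros)
  ultimately show ?thesis by auto
qed

lemma open_region: "open (region p)"
proof (cases p)
  case Core
  have "open ({z. small z} \<inter> {z. fib z \<bullet> z < 1})"
    by (intro open_Int open_small open_Collect_less continuous_intros)
  then show ?thesis using Core by (simp add: Int_def)
next
  case Collar
  have "open ({z. small z} \<inter> {z. 0 < z $ nc})"
    by (intro open_Int open_small open_Collect_less continuous_intros)
  then show ?thesis using Collar by (simp add: Int_def)
qed

lemma open_coord_region: "open (coord_region p)"
proof (cases p)
  case Core
  have "open (bwd Core -` region Core)"
    by (intro continuous_open_vimage open_region) (auto simp: patch_eta intro!: continuous_intros)
  then show ?thesis using Core by (simp add: vimage_def)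
next
  case Collar
  have "continuous_on UNIV rad" by (rule has_derivative_continuous_on) (rule rad_has_derivative)
  then have "open ({z. small z} \<inter> {z. 0 < rad z})"
    by (intro open_Int open_small open_Collect_less continuous_intros)
  then show ?thesis using Collar by (simp add: Int_def)
qed

lemma Ck_on_side:
  fixes f :: "real^'n \<Rightarrow> real^'n"
  shows "open W \<Longrightarrow> Ck_on k W f \<Longrightarrow> Ck_on k W g \<Longrightarrow> Ck_on k W (\<lambda>x. side (f x) (g x))"
  unfolding side_def by (intro Ck_on_intros Ck_on_fib)

lemma Ck_on_rad: "open W \<Longrightarrow> Ck_on k W f \<Longrightarrow> Ck_on k W (\<lambda>x. rad (f x))"
  for f :: "real^'n \<Rightarrow> real^'n"
  unfolding rad_def by (intro Ck_on_intros Ck_on_side)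

lemma Ck_on_ell: "open W \<Longrightarrow> Ck_on k W f \<Longrightarrow> Ck_on k W (\<lambda>x. ell (f x) u)"
  for f :: "real^'n \<Rightarrow> real^'n"
  unfolding ell_def by (intro Ck_on_intros Ck_on_side)

lemma Ck_on_fwd: "open W \<Longrightarrow> Ck_on k W f \<Longrightarrow> Ck_on k W (\<lambda>x. fwd p (f x))"
  for f :: "real^'n \<Rightarrow> real^'n"
  by (cases p) (auto intro!: Ck_on_intros Ck_on_fib)

lemma Ck_on_bwd: "open W \<Longrightarrow> W \<subseteq> coord_region p \<Longrightarrow> Ck_on k W (bwd p)"
proof (cases p)
  case Core
  assume "open W"
  then have "Ck_on k W (\<lambda>x. x - 2 *\<^sub>R e)" by (intro Ck_on_intros)
  then show ?thesis using Core by (simp only: patch_eta)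
next
  case Collar
  assume "open W" "W \<subseteq> coord_region p"
  then have "Ck_on k W (\<lambda>x. x + (sqrt (rad x) - x $ nc) *\<^sub>R e)"
    using Collar by (intro Ck_on_intros Ck_on_rad) auto
  then show ?thesis using Collar by (simp only: patch_eta)
qed

lemma Ck_on_iso: "g \<in> Iso \<Longrightarrow> open W \<Longrightarrow> Ck_on k W f \<Longrightarrow> Ck_on k W (\<lambda>x. g (f x))"
  for f :: "real^'n \<Rightarrow> real^'n"
proof -
  assume *: "g \<in> Iso" "open W" "Ck_on k W f"
  have "Ck_on k W (\<lambda>x. lin g (f x) + g 0)"
    by (intro Ck_on_add Ck_on_const Ck_on_linear_compose[OF _ bounded_linear_lin] *)
  then show ?thesis by (simp add: lin_def)
qed

section \<open>The flat metric in these coordinates\<close>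

text \<open>The Euclidean metric in the collar coordinates, that is, the pullback by \<open>bwd\<close> (lemma \<open>met_dbwd\<close>), is
  rational; the square roots cancel. Its Christoffel map is a multiple of \<open>e\<close>, as only the normal
  coordinate has been changed.\<close>

definition met :: "real^'n \<Rightarrow> real^'n \<Rightarrow> real^'n \<Rightarrow> real" where
  "met x u v = (if x $ nc < 1 then u \<bullet> v - u $ nc * v $ nc + ell x u * ell x v / (4 * rad x) else u \<bullet> v)"

definition chris :: "real^'n \<Rightarrow> real^'n \<Rightarrow> real^'n \<Rightarrow> real^'n" where
  "chris x u v = (if x $ nc < 1 then (2 * side u v + ell x u * ell x v / (2 * rad x)) *\<^sub>R e else 0)"

lemma met_dbwd:
  assumes "x \<in> coord_region p"
  shows "met x u v = dbwd p x u \<bullet> dbwd p x v"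
proof (cases p)
  case Collar
  then have r: "0 < rad x" "x $ nc < 1" using assms coord_region_nc[OF assms] by auto
  have s: "u \<bullet> v = (u - u $ nc *\<^sub>R e) \<bullet> (v - v $ nc *\<^sub>R e) + u $ nc * v $ nc" for u v
    by (simp add: inner_diff_left inner_diff_right inner_e e_nth)
  have "dbwd Collar x u \<bullet> dbwd Collar x v =
      (u - u $ nc *\<^sub>R e) \<bullet> (v - v $ nc *\<^sub>R e) + (- ell x u / (2 * sqrt (rad x))) * (- ell x v / (2 * sqrt (rad x)))"
    by (subst s) (simp add: e_nth algebra_simps)
  also have "\<dots> = met x u v"
    using r s[of u v] by (simp add: met_def field_simps)
  finally show ?thesis using Collar by simp
next
  case Core
  then show ?thesis using coord_region_nc[OF assms] by (simp add: met_def)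
qed

lemma met_dfwd: "z \<in> region p \<Longrightarrow> met (fwd p z) (dfwd p z u) (dfwd p z v) = u \<bullet> v"
  by (simp add: met_dbwd[OF fwd_coord_region] dbwd_dfwd)

lemma bilinear_met: "bilinear (met x)"
  unfolding bilinear_def
  by (auto intro!: linearI simp: met_def ell_linear inner_add_left inner_add_right algebra_simps add_divide_distrib)

lemma met_commute: "met x u v = met x v u"
  by (simp add: met_def inner_commute mult.commute)

lemma met_pos: "x \<in> coord_region p \<Longrightarrow> v \<noteq> 0 \<Longrightarrow> 0 < met x v v"
  using dfwd_dbwd[of x p v] linear_0[OF linear_dfwd, of p "bwd p x"] by (auto simp: met_dbwd)

lemma met_has_derivative:
  assumes "x \<in> coord_region p"
  shows "((\<lambda>y. met y v w) has_derivative
     (\<lambda>u. if x $ nc < 1 then (side u v * ell x w + side u w * ell x v) / (2 * rad x)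
                            + ell x u * ell x v * ell x w / (4 * (rad x)\<^sup>2) else 0)) (at x within S)"
proof (cases p)
  case Collar
  then have r: "0 < rad x" "x $ nc < 1" using assms coord_region_nc[OF assms] by auto
  have "((\<lambda>y. v \<bullet> w - v $ nc * w $ nc + ell y v * ell y w / (4 * rad y)) has_derivative
     (\<lambda>u. (side u v * ell x w + side u w * ell x v) / (2 * rad x)
                            + ell x u * ell x v * ell x w / (4 * (rad x)\<^sup>2))) (at x)"
    using r by (auto intro!: derivative_eq_intros rad_has_derivative ell_has_derivative
        simp: fun_eq_iff field_simps power2_eq_square)
  then have "((\<lambda>y. met y v w) has_derivative
     (\<lambda>u. (side u v * ell x w + side u w * ell x v) / (2 * rad x)
                            + ell x u * ell x v * ell x w / (4 * (rad x)\<^sup>2))) (at x)"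
    by (rule has_derivative_transform_within_open[OF _ open_coord_region assms])
      (use coord_region_nc(1)[of _ p] Collar in \<open>simp add: met_def\<close>)
  then show ?thesis using r by (simp add: has_derivative_at_withinI)
next
  case Core
  have "((\<lambda>y. met y v w) has_derivative (\<lambda>u. 0)) (at x)"
    by (rule has_derivative_transform_within_open[OF has_derivative_const open_coord_region assms])
      (use coord_region_nc(1)[of _ p] Core in \<open>simp add: met_def\<close>)
  then show ?thesis using Core coord_region_nc(1)[OF assms] by (simp add: has_derivative_at_withinI)
qed

lemma chris_has_derivative:
  assumes "x \<in> coord_region p"
  shows "((\<lambda>y. chris y v w) has_derivative
     (\<lambda>u. if x $ nc < 1 then ((side u v * ell x w + side u w * ell x v) / rad x
                            + ell x u * ell x v * ell x w / (2 * (rad x)\<^sup>2)) *\<^sub>R e else 0)) (at x within S)"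
proof (cases p)
  case Collar
  then have r: "0 < rad x" "x $ nc < 1" using assms coord_region_nc[OF assms] by auto
  have "((\<lambda>y. (2 * side v w + ell y v * ell y w / (2 * rad y)) *\<^sub>R e) has_derivative
     (\<lambda>u. ((side u v * ell x w + side u w * ell x v) / rad x
                            + ell x u * ell x v * ell x w / (2 * (rad x)\<^sup>2)) *\<^sub>R e)) (at x)"
    using r by (auto intro!: derivative_eq_intros rad_has_derivative ell_has_derivative
        simp: fun_eq_iff field_simps power2_eq_square)
  then have "((\<lambda>y. chris y v w) has_derivative
     (\<lambda>u. ((side u v * ell x w + side u w * ell x v) / rad x
                            + ell x u * ell x v * ell x w / (2 * (rad x)\<^sup>2)) *\<^sub>R e)) (at x)"
    by (rule has_derivative_transform_within_open[OF _ open_coord_region assms])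
      (use coord_region_nc(1)[of _ p] Collar in \<open>simp add: chris_def\<close>)
  then show ?thesis using r by (simp add: has_derivative_at_withinI)
next
  case Core
  have "((\<lambda>y. chris y v w) has_derivative (\<lambda>u. 0)) (at x)"
    by (rule has_derivative_transform_within_open[OF has_derivative_const open_coord_region assms])
      (use coord_region_nc(1)[of _ p] Core in \<open>simp add: chris_def\<close>)
  then show ?thesis using Core coord_region_nc(1)[OF assms] by (simp add: has_derivative_at_withinI)
qed

text \<open>For a pulled back flat metric the Christoffel map is minus the second derivative of the coordinates
  as functions on the flat space. Here the only second derivative is that of \<open>1 - |y|\<^sup>2\<close>. Geodesics,
  parallel fields and the second fundamental form are computed from this formula.\<close>

lemma chris_dfwd:
  assumes "z \<in> region p"
  shows "chris (fwd p z) (dfwd p z u) (dfwd p z v) = (if p = Collar then 2 * (fib u \<bullet> v) else 0) *\<^sub>R e"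
proof (cases p)
  case Collar
  then have "0 < z $ nc" "fwd p z $ nc < 1" using assms coord_region_nc[OF fwd_coord_region[OF assms]] by auto
  then show ?thesis
    unfolding chris_def Collar rad_fwd ell_fwd side_dfwd
    by (simp add: fib_inner_side power2_eq_square del: fwd.simps)
next
  case Core
  then show ?thesis using coord_region_nc[OF fwd_coord_region[OF assms]] by (simp add: chris_def del: fwd.simps)
qed

section \<open>The quotient space\<close>

definition quot :: "(real^'n) topology" where
  "quot = topology (\<lambda>U. U \<subseteq> proj ` tube \<and> openin (top_of_set tube) (tube \<inter> proj -` U))"

lemma openin_quot: "openin quot U \<longleftrightarrow> U \<subseteq> proj ` tube \<and> openin (top_of_set tube) (tube \<inter> proj -` U)"
proof -
  have "istopology (\<lambda>U. U \<subseteq> proj ` tube \<and> openin (top_of_set tube) (tube \<inter> proj -` U))"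
    unfolding istopology_def
  proof (intro conjI allI impI)
    fix U V assume "U \<subseteq> proj ` tube \<and> openin (top_of_set tube) (tube \<inter> proj -` U)"
      "V \<subseteq> proj ` tube \<and> openin (top_of_set tube) (tube \<inter> proj -` V)"
    moreover have "tube \<inter> proj -` (U \<inter> V) = (tube \<inter> proj -` U) \<inter> (tube \<inter> proj -` V)" by auto
    ultimately show "U \<inter> V \<subseteq> proj ` tube" "openin (top_of_set tube) (tube \<inter> proj -` (U \<inter> V))" by auto
  next
    fix K assume K: "\<forall>U\<in>K. U \<subseteq> proj ` tube \<and> openin (top_of_set tube) (tube \<inter> proj -` U)"
    then show "\<Union>K \<subseteq> proj ` tube" by auto
    have "tube \<inter> proj -` (\<Union>K) = \<Union>((\<lambda>U. tube \<inter> proj -` U) ` K)" by auto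
    also have "openin (top_of_set tube) \<dots>" using K by (intro openin_Union) auto
    finally show "openin (top_of_set tube) (tube \<inter> proj -` (\<Union>K))" .
  qed
  then show ?thesis by (simp add: quot_def topology_inverse')
qed

lemma topspace_quot: "topspace quot = proj ` tube"
proof -
  have "tube \<inter> proj -` (proj ` tube) = tube" by auto
  then have "openin quot (proj ` tube)" by (simp add: openin_quot)
  then show ?thesis by (metis openin_subset openin_topspace openin_quot subset_antisym)
qed

lemma continuous_map_proj: "continuous_map (top_of_set tube) quot proj"
proof -
  have "{x \<in> tube. proj x \<in> U} = tube \<inter> proj -` U" for U by auto
  then show ?thesis by (auto simp: continuous_map_def topspace_quot openin_quot)
qed

text \<open>The saturation of an open set is the union of its images under the deck transformations.\<close>

lemma open_map_proj: "open_map (top_of_set tube) quot proj"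
  unfolding open_map_def
proof (intro allI impI)
  fix U assume U: "openin (top_of_set tube) U"
  then have sub: "U \<subseteq> tube" by (rule openin_imp_subset)
  have "tube \<inter> proj -` (proj ` U) = (\<Union>m. tube \<inter> deck m -` U)"
  proof (intro equalityI subsetI)
    fix z assume "z \<in> tube \<inter> proj -` (proj ` U)"
    then obtain u where "u \<in> U" "proj z = proj u" "z \<in> tube" by auto
    then show "z \<in> (\<Union>m. tube \<inter> deck m -` U)" using proj_eqD[of z u] by auto
  next
    fix z assume "z \<in> (\<Union>m. tube \<inter> deck m -` U)"
    then obtain m where "z \<in> tube" "deck m z \<in> U" by auto
    then show "z \<in> tube \<inter> proj -` (proj ` U)" by (metis IntI imageI proj_deck vimageI)
  qed
  moreover have "openin (top_of_set tube) (tube \<inter> deck m -` U)" for m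
    by (rule continuous_openin_preimage[OF iso_continuous_on[OF deck_iso] _ U])
      (auto simp: iso_tube[OF deck_iso])
  ultimately have "openin (top_of_set tube) (tube \<inter> proj -` (proj ` U))" by (metis (no_types, lifting) openin_Union rangeE)
  then show "openin quot (proj ` U)" using sub by (auto simp: openin_quot)
qed

lemma quotient_map_proj: "quotient_map (top_of_set tube) quot proj"
  by (rule continuous_open_imp_quotient_map[OF continuous_map_proj open_map_proj]) (simp add: topspace_quot)

text \<open>A continuous invariant of the action that separates the orbits, for the Hausdorff property. The
  characters of the torus separate the torus coordinates; the sign by which the ball is twisted is
  compensated by a function of half the frequency.\<close>

definition sep :: "real^'n \<Rightarrow> complex^'n" where
  "sep z = (\<chi> i. if i \<in> A then cis (pi * (\<Sum>j\<in>-A. z $ j)) * of_real (z $ i) else cis (2 * pi * z $ i))"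

lemma sep_deck: "sep (deck m z) = sep z"
proof -
  have s: "(\<Sum>j\<in>-A. deck m z $ j) = (\<Sum>j\<in>-A. z $ j) + of_int (\<Sum>j\<in>-A. m j)"
    by (simp add: deck_def sum.distrib[symmetric])
  have c: "cis (pi * of_int l) = (if even l then 1 else - 1)" for l :: int
    by (simp add: complex_eq_iff cos_npi_int sin_npi_int)
  have c2: "cis (2 * pi * of_int l) = 1" for l :: int
    using c[of "2 * l"] by (simp add: mult.commute mult.left_commute)
  show ?thesis
    unfolding sep_def s
    by (simp add: vec_eq_iff distrib_left cis_mult[symmetric] c del: of_int_sum) (simp add: deck_def distrib_left cis_mult[symmetric] c2)
qed

lemma sep_proj: "sep (proj z) = sep z"
  by (simp add: proj_def sep_deck)

lemma inj_on_sep: "inj_on sep (proj ` tube)"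
proof (rule inj_onI)
  fix p q assume p: "p \<in> proj ` tube" and q: "q \<in> proj ` tube" and eq: "sep p = sep q"
  have nth: "sep p $ i = sep q $ i" for i using eq by simp
  have off: "p $ i = q $ i" if "i \<notin> A" for i
  proof -
    have r: "0 \<le> p $ i" "p $ i < 1" "0 \<le> q $ i" "q $ i < 1" using p q proj_nth[OF that] by auto
    have "cis (2 * pi * p $ i) = cis (2 * pi * q $ i)" using nth[of i] that by (simp add: sep_def)
    then have "sin (2 * pi * p $ i) = sin (2 * pi * q $ i)" "cos (2 * pi * p $ i) = cos (2 * pi * q $ i)"
      by (simp_all add: complex_eq_iff)
    then obtain n :: int where "2 * pi * p $ i = 2 * pi * q $ i + 2 * pi * of_int n"
      using sin_cos_eq_iff[of "2 * pi * p $ i" "2 * pi * q $ i"] by (auto simp: mult_ac)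
    then have "2 * pi * p $ i = 2 * pi * (q $ i + of_int n)" by (simp add: distrib_left)
    then have n: "p $ i = q $ i + of_int n" by simp
    then have "\<bar>of_int n :: real\<bar> < 1" using r by linarith
    then have "n = 0" by linarith
    then show ?thesis using n by simp
  qed
  then have "(\<Sum>j\<in>-A. p $ j) = (\<Sum>j\<in>-A. q $ j)" by (intro sum.cong) auto
  then have "p $ i = q $ i" if "i \<in> A" for i using nth[of i] that by (simp add: sep_def)
  then show "p = q" using off by (metis vec_eq_iff)
qed

lemma continuous_map_sep: "continuous_map quot euclidean sep"
proof -
  have "continuous_on tube sep"
    unfolding sep_def
  proof (rule continuous_on_vec_lambda)
    fix i
    show "continuous_on tube (\<lambda>z. if i \<in> A then cis (pi * (\<Sum>j\<in>-A. z $ j)) * of_real (z $ i) else cis (2 * pi * z $ i))"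
      by (cases "i \<in> A") (auto simp: cis_conv_exp intro!: continuous_intros)
  qed
  then have "continuous_map (top_of_set tube) euclidean (sep \<circ> proj)"
    by (simp add: comp_def sep_proj)
  then show ?thesis
    by (rule continuous_compose_quotient_map[OF quotient_map_proj])
qed

lemma Hausdorff_quot: "Hausdorff_space quot"
  by (rule Hausdorff_space_injective_preimage[OF _ continuous_map_sep]) (simp_all add: topspace_quot inj_on_sep)

lemma second_countable_quot: "second_countable quot"
proof -
  obtain \<B> :: "(real^'n) set set" where \<B>: "countable \<B>" "\<And>C. C \<in> \<B> \<Longrightarrow> open C"
    "\<And>S. open S \<Longrightarrow> \<exists>U. U \<subseteq> \<B> \<and> S = \<Union>U" using univ_second_countable by blast
  have "second_countable (euclidean :: (real^'n) topology)"
    unfolding second_countable_def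
  proof (intro exI[of _ \<B>] conjI ballI allI impI \<B>(1))
    fix U :: "(real^'n) set" and x assume "openin euclidean U \<and> x \<in> U"
    then show "\<exists>V\<in>\<B>. x \<in> V \<and> V \<subseteq> U" using \<B>(3)[of U] by auto
  qed (use \<B>(2) in auto)
  then have "second_countable (top_of_set tube)" by (rule second_countable_subtopology)
  from second_countable_open_map_image[OF continuous_map_proj open_map_proj _ this]
  show ?thesis by (simp add: topspace_quot)
qed

lemma tube_norm: "z \<in> tube \<longleftrightarrow> norm (fib z) \<le> 1"
  by (simp add: tube_def inner_fib[symmetric] norm_le_square[of 1, simplified] norm_eq_sqrt_inner)

lemma convex_tube: "convex tube"
proof -
  have "tube = fib -` cball 0 1" by (auto simp: tube_norm)
  then show ?thesis by (simp add: convex_linear_vimage linear_fib)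
qed

lemma compact_quot: "compact_space quot"
proof -
  define K where "K = tube \<inter> cbox (\<chi> i. - 1) (\<chi> i. 1)"
  have "tube = fib -` cball 0 1" by (auto simp: tube_norm)
  then have "closed tube"
    using continuous_closed_vimage[of "cball 0 1" fib] linear_continuous_at[OF bounded_linear_fib] by simp
  then have "compact K" unfolding K_def by (intro closed_Int_compact compact_cbox)
  then have "compactin (top_of_set tube) K" by (simp add: compactin_subtopology K_def)
  then have "compactin quot (proj ` K)" by (rule image_compactin[OF _ continuous_map_proj])
  moreover have "proj ` K = proj ` tube"
  proof
    show "proj ` tube \<subseteq> proj ` K"
    proof
      fix p assume "p \<in> proj ` tube"
      then obtain z where z: "z \<in> tube" "p = proj z" by auto
      have "- 1 \<le> p $ i \<and> p $ i \<le> 1" for i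
      proof (cases "i \<in> A")
        case True
        have "\<bar>fib p $ i\<bar> \<le> norm (fib p)" by (rule component_le_norm_cart)
        also have "\<dots> \<le> 1" using z by (simp add: tube_norm[symmetric])
        finally show ?thesis using True by (simp add: fib_nth abs_le_iff)
      next
        case False
        then show ?thesis using proj_nth[OF False, of z] z by simp
      qed
      then have "p \<in> K" using z by (simp add: K_def mem_box_cart)
      moreover have "proj p = p" using z by simp
      ultimately show "p \<in> proj ` K" by (metis imageI)
    qed
  qed (auto simp: K_def)
  ultimately show ?thesis by (simp add: compact_space_def topspace_quot)
qed

lemma connected_quot: "connected_space quot"
proof -
  have "connectedin (top_of_set tube) tube"
    using convex_connected[OF convex_tube] by (simp add: connectedin_subtopology)
  from connectedin_continuous_map_image[OF continuous_map_proj this]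
  show ?thesis by (simp add: topspace_quot[symmetric] connectedin_topspace)
qed

section \<open>The atlas\<close>

text \<open>The quotient map is injective on \<open>k ` patch_set p\<close>, and \<open>fwd p\<close> is applied to the point of
  \<open>patch_set p\<close> over the given point of the quotient. All \<open>k\<close> in \<open>Iso\<close> are admitted, which makes the atlas invariant
  under the symmetries.\<close>

definition chart :: "patch \<Rightarrow> (real^'n \<Rightarrow> real^'n) \<Rightarrow> (real^'n, 'n) chart" where
  "chart p k = ((\<lambda>z. proj (k z)) ` patch_set p, \<lambda>q. fwd p (inv_into (patch_set p) (\<lambda>z. proj (k z)) q))"

definition Mfd :: "(real^'n, 'n) riem" where
  "Mfd = \<lparr>space_of = quot, atlas = {chart p k | p k. k \<in> Iso}, metric = (\<lambda>c. met)\<rparr>"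

lemma bundle_simps [simp]:
  "space_of Mfd = quot" "metric Mfd c = met"
  "c \<in> atlas Mfd \<longleftrightarrow> (\<exists>p k. k \<in> Iso \<and> c = chart p k)"
  by (auto simp: Mfd_def)

lemma openin_dom: "openin (top_of_set tube) (patch_set p)"
  by (simp add: patch_set_def open_region openin_open_Int)

lemma small_diff: "small z \<Longrightarrow> small w \<Longrightarrow> i \<notin> A \<Longrightarrow> \<bar>z $ i - w $ i\<bar> < 1"
  unfolding small_def by (smt (verit) field_sum_of_halves)

lemma patch_set_small: "z \<in> patch_set p \<Longrightarrow> small z"
  by (cases p) (auto simp: patch_set_def)

lemma inj_on_chart:
  assumes "k \<in> Iso"
  shows "inj_on (\<lambda>z. proj (k z)) (patch_set p)"
proof (rule inj_onI)
  fix z w assume zw: "z \<in> patch_set p" "w \<in> patch_set p" "proj (k z) = proj (k w)"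
  have "k z = k w"
    by (rule proj_separated[OF zw(3)])
      (simp add: iso_nth_diff[OF assms] small_diff[OF patch_set_small[OF zw(1)] patch_set_small[OF zw(2)]])
  then show "z = w" by (metis assms iso_inverse(2))
qed

lemma chart_apply: "k \<in> Iso \<Longrightarrow> z \<in> patch_set p \<Longrightarrow> snd (chart p k) (proj (k z)) = fwd p z"
  using inv_into_f_f[OF inj_on_chart, of k z p] by (simp add: chart_def)

lemma fst_chart: "fst (chart p k) = (\<lambda>z. proj (k z)) ` patch_set p"
  by (simp add: chart_def)

lemma img_chart: "k \<in> Iso \<Longrightarrow> img (chart p k) = half_space \<inter> coord_region p"
proof -
  assume k: "k \<in> Iso"
  have "img (chart p k) = fwd p ` patch_set p"
    unfolding fst_chart image_image using chart_apply[OF k] by (simp cong: image_cong)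
  then show ?thesis by (simp add: fwd_image)
qed

lemma homeomorphic_map_local_section:
  assumes k: "k \<in> Iso"
  shows "homeomorphic_map (top_of_set (patch_set p)) (subtopology quot (fst (chart p k))) (\<lambda>z. proj (k z))"
    and "openin quot (fst (chart p k))"
proof -
  have kt: "k z \<in> tube" if "z \<in> patch_set p" for z using that by (simp add: patch_set_def iso_tube[OF k])
  have ck: "continuous_map (top_of_set (patch_set p)) (top_of_set tube) k"
    using iso_continuous_on[OF k] kt by (auto intro: continuous_map_into_subtopology)
  have ok: "open_map (top_of_set (patch_set p)) (top_of_set tube) k"
    unfolding open_map_def
  proof (intro allI impI)
    fix U assume "openin (top_of_set (patch_set p)) U"
    then have U: "openin (top_of_set tube) U" using openin_dom openin_trans by blast
    have "k ` U = tube \<inter> inv k -` U"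
      using openin_imp_subset[OF U] iso_inverse(2,3)[OF k] iso_tube[OF k]
      by (auto simp: image_iff) metis
    also have "openin (top_of_set tube) \<dots>"
      by (rule continuous_openin_preimage[OF iso_continuous_on[OF iso_inverse(1)[OF k]] _ U])
        (auto simp: iso_tube[OF iso_inverse(1)[OF k]])
    finally show "openin (top_of_set tube) (k ` U)" .
  qed
  have c: "continuous_map (top_of_set (patch_set p)) quot (\<lambda>z. proj (k z))"
    using continuous_map_compose[OF ck continuous_map_proj] by (simp add: comp_def)
  have o: "open_map (top_of_set (patch_set p)) quot (\<lambda>z. proj (k z))"
    using open_map_compose[OF ok open_map_proj] by (simp add: comp_def)
  show op: "openin quot (fst (chart p k))"
    using o unfolding open_map_def fst_chart by (metis openin_topspace topspace_euclidean_subtopology)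
  show "homeomorphic_map (top_of_set (patch_set p)) (subtopology quot (fst (chart p k))) (\<lambda>z. proj (k z))"
  proof (rule bijective_open_imp_homeomorphic_map)
    show "continuous_map (top_of_set (patch_set p)) (subtopology quot (fst (chart p k))) (\<lambda>z. proj (k z))"
      using c by (rule continuous_map_into_subtopology) (auto simp: fst_chart)
    show "open_map (top_of_set (patch_set p)) (subtopology quot (fst (chart p k))) (\<lambda>z. proj (k z))"
      using o by (rule open_map_into_subtopology) (auto simp: fst_chart)
    show "(\<lambda>z. proj (k z)) ` topspace (top_of_set (patch_set p)) = topspace (subtopology quot (fst (chart p k)))"
      using openin_subset[OF op] by (auto simp: fst_chart)
    show "inj_on (\<lambda>z. proj (k z)) (topspace (top_of_set (patch_set p)))"
      using inj_on_chart[OF k] by simp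
  qed
qed

lemma homeomorphic_map_chart:
  assumes k: "k \<in> Iso"
  shows "homeomorphic_map (subtopology quot (fst (chart p k))) (top_of_set (img (chart p k))) (snd (chart p k))"
proof -
  obtain g where g: "homeomorphic_maps (top_of_set (patch_set p)) (subtopology quot (fst (chart p k))) (\<lambda>z. proj (k z)) g"
    using homeomorphic_map_local_section(1)[OF k] homeomorphic_map_maps by metis
  then have "homeomorphic_map (subtopology quot (fst (chart p k))) (top_of_set (patch_set p)) g"
    using homeomorphic_maps_map by blast
  moreover have "homeomorphic_maps (top_of_set (patch_set p)) (top_of_set (img (chart p k))) (fwd p) (bwd p)"
    unfolding homeomorphic_maps_def img_chart[OF k]
    by (auto intro!: continuous_map_into_subtopology fwd_continuous_on continuous_on_subset[OF bwd_continuous_on]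
        simp: fwd_bwd bwd_fwd bwd_dom half_space_fwd fwd_coord_region patch_set_def)
       (use bwd_dom patch_set_def in blast)+
  then have "homeomorphic_map (top_of_set (patch_set p)) (top_of_set (img (chart p k))) (fwd p)"
    using homeomorphic_maps_map by blast
  ultimately have h: "homeomorphic_map (subtopology quot (fst (chart p k))) (top_of_set (img (chart p k))) (fwd p \<circ> g)"
    by (rule homeomorphic_map_compose)
  show ?thesis
  proof (rule homeomorphic_map_eq[OF h])
    fix q assume "q \<in> topspace (subtopology quot (fst (chart p k)))"
    then obtain z where z: "z \<in> patch_set p" "q = proj (k z)" by (auto simp: fst_chart)
    then have "g q = z" using g by (simp add: homeomorphic_maps_def)
    then show "(fwd p \<circ> g) q = snd (chart p k) q" using chart_apply[OF k z(1)] z(2) by simp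
  qed
qed

text \<open>The core is covered by translates of one patch. For a point off the central fibre there is a
  collar patch in which it has the preliminary coordinate \<open>r e\<close>, where \<open>r\<close> is its distance from that
  fibre.\<close>

lemma iso_core: "(\<lambda>w. w + (z - fib z)) \<in> Iso" "lin (\<lambda>w. w + (z - fib z)) u = u"
  using translation_iso[of "z - fib z"] by (simp_all add: fib_diff)

lemma patch_set_core: "fib z \<bullet> z < 1 \<Longrightarrow> fib z \<in> patch_set Core"
  by (simp add: patch_set_def tube_def small_def fib_nth inner_fib)

lemma iso_collar:
  assumes "fib z \<noteq> 0"
  obtains k where "k \<in> Iso" "lin k e = fib z /\<^sub>R norm (fib z)" "\<And>r. k (r *\<^sub>R e) = (r / norm (fib z)) *\<^sub>R fib z + (z - fib z)"
proof -
  have "fib (fib z /\<^sub>R norm (fib z)) = fib z /\<^sub>R norm (fib z)" by (simp add: fib_scale)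
  moreover have "norm (fib z /\<^sub>R norm (fib z)) = 1" using assms by simp
  moreover have "fib (z - fib z) = 0" by (simp add: fib_diff)
  ultimately obtain k where k: "k \<in> Iso" "lin k e = fib z /\<^sub>R norm (fib z)" "\<And>w. k w = lin k w + (z - fib z)"
    using iso_moving by metis
  have "k (r *\<^sub>R e) = (r / norm (fib z)) *\<^sub>R fib z + (z - fib z)" for r
    using k(2) linear_scale[OF linear_lin[OF k(1)]] by (subst k(3)) (simp add: divide_inverse)
  with k that show thesis by blast
qed

lemma patch_set_collar: "0 < r \<Longrightarrow> r \<le> 1 \<Longrightarrow> r *\<^sub>R e \<in> patch_set Collar"
  using nc_A by (auto simp: patch_set_def tube_def small_def fib_scale inner_e e_nth abs_square_le_1 power2_eq_square[symmetric] mult_le_one)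

lemma atlas_covers:
  assumes "z \<in> tube"
  obtains p k w where "k \<in> Iso" "w \<in> patch_set p" "k w = z"
proof (cases "fib z = 0")
  case True
  then have "fib z \<bullet> z < 1" by simp
  then show ?thesis using that[OF iso_core(1)[of z] patch_set_core] by simp
next
  case False
  obtain k where k: "k \<in> Iso" "\<And>r. k (r *\<^sub>R e) = (r / norm (fib z)) *\<^sub>R fib z + (z - fib z)"
    using iso_collar[OF False] by metis
  show ?thesis
    by (rule that[OF k(1) patch_set_collar[of "norm (fib z)"]]) (use False assms k(2) tube_norm in auto)
qed

lemma overlap:
  assumes "k \<in> Iso" "k' \<in> Iso" "q \<in> fst (chart p k)" "q \<in> fst (chart p' k')"
  obtains z g where "z \<in> patch_set p" "q = proj (k z)" "g \<in> Iso" "g z \<in> patch_set p'" "\<And>w. proj (k' (g w)) = proj (k w)"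
proof -
  obtain z z' where z: "z \<in> patch_set p" "q = proj (k z)" "z' \<in> patch_set p'" "q = proj (k' z')"
    using assms(3,4) by (auto simp: fst_chart)
  then have "proj (k z) = proj (k' z')" by simp
  from proj_eq_iso[OF assms(1,2) this] obtain g where "g \<in> Iso" "g z = z'" "\<And>w. proj (k' (g w)) = proj (k w)" by blast
  then show thesis using that z by blast
qed

definition overlap_coords :: "patch \<Rightarrow> patch \<Rightarrow> (real^'n \<Rightarrow> real^'n) \<Rightarrow> (real^'n) set" where
  "overlap_coords p p' g = {x \<in> coord_region p. g (bwd p x) \<in> region p'}"

lemma open_overlap_coords:
  assumes "g \<in> Iso"
  shows "open (overlap_coords p p' g)"
proof -
  have "overlap_coords p p' g = coord_region p \<inter> (\<lambda>x. g (bwd p x)) -` region p'" by (auto simp: overlap_coords_def)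
  moreover have "continuous_on (coord_region p) (\<lambda>x. g (bwd p x))"
    by (rule continuous_on_compose2[OF iso_continuous_on[OF assms] bwd_continuous_on]) auto
  ultimately show ?thesis using continuous_open_preimage[OF _ open_coord_region open_region] by metis
qed

context
  fixes p p' :: patch and k k' g
  assumes iso: "k \<in> Iso" "k' \<in> Iso" "g \<in> Iso" and gg: "\<And>w. proj (k' (g w)) = proj (k w)"
begin

lemma transition_fwd:
  assumes "z \<in> patch_set p" "g z \<in> patch_set p'"
  shows "transition (chart p k) (chart p' k') (fwd p z) = fwd p' (g z)"
proof -
  have "inj_on (snd (chart p k)) (fst (chart p k))"
  proof (rule inj_onI)
    fix q q' assume "q \<in> fst (chart p k)" "q' \<in> fst (chart p k)" "snd (chart p k) q = snd (chart p k) q'"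
    then obtain z w where zw: "z \<in> patch_set p" "q = proj (k z)" "w \<in> patch_set p" "q' = proj (k w)" "fwd p z = fwd p w"
      by (auto simp: fst_chart chart_apply[OF iso(1)])
    have "z \<in> region p" "w \<in> region p" using zw(1,3) by (auto simp: patch_set_def)
    then have "z = w" using zw(5) bwd_fwd by metis
    then show "q = q'" using zw by simp
  qed
  moreover have "proj (k z) \<in> fst (chart p k)" using assms by (auto simp: fst_chart)
  ultimately have "inv_into (fst (chart p k)) (snd (chart p k)) (fwd p z) = proj (k z)"
    using chart_apply[OF iso(1) assms(1)] inv_into_f_f[of "snd (chart p k)" "fst (chart p k)" "proj (k z)"] by simp
  then show ?thesis
    using chart_apply[OF iso(2) assms(2)] gg[of z] by (simp add: transition_def)
qed

lemma transition_overlap: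
  assumes "x \<in> half_space" "x \<in> overlap_coords p p' g"
  shows "transition (chart p k) (chart p' k') x = fwd p' (g (bwd p x))"
proof -
  have z: "bwd p x \<in> patch_set p" using assms bwd_dom by (simp add: overlap_coords_def)
  then have "g (bwd p x) \<in> patch_set p'" using assms iso_tube[OF iso(3)] by (simp add: patch_set_def overlap_coords_def)
  from transition_fwd[OF z this] show ?thesis using assms by (simp add: fwd_bwd overlap_coords_def)
qed

lemma transition_has_derivative:
  assumes "z \<in> patch_set p" "g z \<in> patch_set p'"
  shows "(transition (chart p k) (chart p' k') has_derivative
          (\<lambda>u. dfwd p' (g z) (lin g (dbwd p (fwd p z) u)))) (at (fwd p z) within half_space)"
proof -
  have r: "z \<in> region p" "g z \<in> region p'" using assms by (auto simp: patch_set_def)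
  have x: "fwd p z \<in> overlap_coords p p' g" "fwd p z \<in> half_space"
    using r half_space_fwd[OF assms(1)] fwd_coord_region[OF r(1)] by (auto simp: overlap_coords_def bwd_fwd)
  have 1: "(bwd p has_derivative dbwd p (fwd p z)) (at (fwd p z) within half_space)"
    using fwd_coord_region[OF r(1)] by (rule bwd_has_derivative)
  have 2: "((\<lambda>x. g (bwd p x)) has_derivative (\<lambda>u. lin g (dbwd p (fwd p z) u))) (at (fwd p z) within half_space)"
    using has_derivative_compose[OF 1 iso_has_derivative[OF iso(3)]] by simp
  have 3: "((\<lambda>x. fwd p' (g (bwd p x))) has_derivative
          (\<lambda>u. dfwd p' (g z) (lin g (dbwd p (fwd p z) u)))) (at (fwd p z) within half_space)"
    using has_derivative_compose[OF 2 fwd_has_derivative] r(1) by (simp add: bwd_fwd)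
  show ?thesis
  proof (rule has_derivative_transform_eventually[OF 3])
    show "\<forall>\<^sub>F y in at (fwd p z) within half_space.
        fwd p' (g (bwd p y)) = transition (chart p k) (chart p' k') y"
      unfolding eventually_at_topological
      using open_overlap_coords[OF iso(3)] x(1) transition_overlap by metis
  qed (use x transition_overlap in auto)
qed

lemma deriv_transition:
  assumes "z \<in> patch_set p" "g z \<in> patch_set p'"
  shows "deriv_half (transition (chart p k) (chart p' k')) (fwd p z) (dfwd p z w) = dfwd p' (g z) (lin g w)"
proof -
  have "z \<in> region p" using assms by (simp add: patch_set_def)
  then show ?thesis
    using frechet_derivative_half_space[OF transition_has_derivative[OF assms] half_space_fwd[OF assms(1)]]
    by (simp add: dbwd_dfwd)
qed

end

lemma smooth_atlas_bundle: "smooth_atlas Mfd"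
  unfolding smooth_atlas_def
proof (intro conjI ballI)
  show "(\<Union>c\<in>atlas Mfd. fst c) = topspace (space_of Mfd)"
  proof
    show "(\<Union>c\<in>atlas Mfd. fst c) \<subseteq> topspace (space_of Mfd)"
    proof
      fix q assume "q \<in> (\<Union>c\<in>atlas Mfd. fst c)"
      then obtain c where "c \<in> atlas Mfd" "q \<in> fst c" by blast
      then show "q \<in> topspace (space_of Mfd)"
        using openin_subset[OF homeomorphic_map_local_section(2)] by auto
    qed
    show "topspace (space_of Mfd) \<subseteq> (\<Union>c\<in>atlas Mfd. fst c)"
    proof
      fix q assume "q \<in> topspace (space_of Mfd)"
      then obtain z where "z \<in> tube" "q = proj z" by (auto simp: topspace_quot)
      then obtain p k w where "k \<in> Iso" "w \<in> patch_set p" "q = proj (k w)" using atlas_covers by metis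
      then have "chart p k \<in> atlas Mfd" "q \<in> fst (chart p k)" by (auto simp: fst_chart)
      then show "q \<in> (\<Union>c\<in>atlas Mfd. fst c)" by blast
    qed
  qed
next
  fix c assume "c \<in> atlas Mfd"
  then obtain p k where c: "k \<in> Iso" "c = chart p k" by auto
  then show "openin (space_of Mfd) (fst c)" by (simp add: homeomorphic_map_local_section(2))
  show "openin (top_of_set half_space) (img c)" using c open_coord_region by (simp add: img_chart openin_open_Int)
  show "homeomorphic_map (subtopology (space_of Mfd) (fst c)) (top_of_set (img c)) (snd c)"
    using c homeomorphic_map_chart by simp
next
  fix c d assume "c \<in> atlas Mfd" "d \<in> atlas Mfd"
  then obtain p k p' k' where c: "k \<in> Iso" "c = chart p k" and d: "k' \<in> Iso" "d = chart p' k'" by auto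
  show "smooth_on (snd c ` (fst c \<inter> fst d)) (transition c d)"
  proof (rule smooth_onI)
    fix x assume "x \<in> snd c ` (fst c \<inter> fst d)"
    then obtain q where q: "q \<in> fst (chart p k)" "q \<in> fst (chart p' k')" "x = snd (chart p k) q"
      using c d by auto
    obtain z g where zg: "z \<in> patch_set p" "q = proj (k z)" "g \<in> Iso" "g z \<in> patch_set p'" "\<And>w. proj (k' (g w)) = proj (k w)"
      using overlap[OF c(1) d(1) q(1,2)] by blast
    define W where "W = overlap_coords p p' g"
    have x: "x = fwd p z" using q zg chart_apply[OF c(1)] by simp
    have W: "open W" "W \<subseteq> coord_region p"
      using open_overlap_coords[OF zg(3)] overlap_coords_def by (auto simp: W_def)
    show "\<exists>W F. open W \<and> x \<in> W \<and> (\<forall>l. Ck_on l W F) \<and> (\<forall>y\<in>snd c ` (fst c \<inter> fst d) \<inter> W. F y = transition c d y)"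
    proof (intro exI conjI allI ballI)
      show "open W" by (rule W)
      show "x \<in> W" using zg fwd_coord_region[of z p]
        by (simp add: W_def overlap_coords_def x patch_set_def bwd_fwd)
      show "Ck_on l W (\<lambda>x. fwd p' (g (bwd p x)))" for l
        by (rule Ck_on_fwd[OF W(1) Ck_on_iso[OF zg(3) W(1) Ck_on_bwd[OF W]]])
      fix y assume y: "y \<in> snd c ` (fst c \<inter> fst d) \<inter> W"
      then have "y \<in> img c" by blast
      then have "y \<in> half_space" using c by (simp add: img_chart)
      then show "fwd p' (g (bwd p y)) = transition c d y"
        using transition_overlap[OF c(1) d(1) zg(3,5)] y by (simp add: W_def c d)
    qed
  qed
qed

lemma riemannian_metric_bundle: "riemannian_metric Mfd"
  unfolding riemannian_metric_def
proof (intro conjI ballI allI)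
  fix c x assume "c \<in> atlas Mfd" "x \<in> img c"
  then obtain p k where "k \<in> Iso" "c = chart p k" "x \<in> img (chart p k)" by auto
  then have x: "x \<in> coord_region p" by (simp add: img_chart)
  show "bilinear (metric Mfd c x)" by (simp add: bilinear_met)
  show "metric Mfd c x u v = metric Mfd c x v u" for u v by (simp add: met_commute)
  show "v \<noteq> 0 \<longrightarrow> 0 < metric Mfd c x v v" for v by (simp add: met_pos[OF x])
next
  fix c u v assume "c \<in> atlas Mfd"
  then obtain p k where c: "k \<in> Iso" "c = chart p k" by auto
  show "smooth_on (img c) (\<lambda>x. metric Mfd c x u v)"
  proof (rule smooth_onI)
    fix x assume x: "x \<in> img c"
    have "\<exists>F. (\<forall>l. Ck_on l (coord_region p) F) \<and> (\<forall>y\<in>coord_region p. F y = met y u v)"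
    proof (cases p)
      case Collar
      show ?thesis
      proof (intro exI conjI allI ballI)
        show "Ck_on l (coord_region p) (\<lambda>y. u \<bullet> v - u $ nc * v $ nc + ell y u * ell y v * inverse (4 * rad y))" for l
        proof -
          have "4 * rad y \<noteq> 0" if "y \<in> coord_region p" for y using that Collar by simp
          then show ?thesis
            by (intro Ck_on_add Ck_on_mult Ck_on_inverse Ck_on_const Ck_on_ell Ck_on_rad Ck_on_ident open_coord_region)
        qed
        fix y assume "y \<in> coord_region p"
        then have "y $ nc < 1" using coord_region_nc(1) Collar by blast
        then show "u \<bullet> v - u $ nc * v $ nc + ell y u * ell y v * inverse (4 * rad y) = met y u v"
          by (simp only: met_def divide_inverse if_True)
      qed
    next
      case Core
      show ?thesis
      proof (intro exI conjI allI ballI)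
        show "Ck_on l (coord_region p) (\<lambda>y. u \<bullet> v)" for l
          by (rule Ck_on_const[OF open_coord_region])
        fix y assume "y \<in> coord_region p"
        then have "\<not> y $ nc < 1" using coord_region_nc(1)[of y p] Core by blast
        then show "u \<bullet> v = met y u v" by (simp add: met_def)
      qed
    qed
    then show "\<exists>W F. open W \<and> x \<in> W \<and> (\<forall>k. Ck_on k W F) \<and> (\<forall>y\<in>img c \<inter> W. F y = metric Mfd c y u v)"
      using x open_coord_region[of p] by (auto simp: c img_chart)
  qed
next
  fix c d x u v assume "c \<in> atlas Mfd" "d \<in> atlas Mfd" and x: "x \<in> snd c ` (fst c \<inter> fst d)"
  then obtain p k p' k' where c: "k \<in> Iso" "c = chart p k" and d: "k' \<in> Iso" "d = chart p' k'" by auto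
  from x obtain q where q: "q \<in> fst (chart p k)" "q \<in> fst (chart p' k')" "x = snd (chart p k) q"
    using c d by auto
  obtain z g where zg: "z \<in> patch_set p" "q = proj (k z)" "g \<in> Iso" "g z \<in> patch_set p'" "\<And>w. proj (k' (g w)) = proj (k w)"
    using overlap[OF c(1) d(1) q(1,2)] by blast
  have x: "x = fwd p z" using q zg chart_apply[OF c(1)] by simp
  have r: "z \<in> region p" "g z \<in> region p'" using zg by (auto simp: patch_set_def)
  define u' v' where "u' = dbwd p x u" and "v' = dbwd p x v"
  then have uv: "u = dfwd p z u'" "v = dfwd p z v'"
    using dfwd_dbwd[OF fwd_coord_region[OF r(1)]] by (simp_all add: x bwd_fwd[OF r(1)])
  show "metric Mfd c x u v = metric Mfd d (transition c d x)
          (deriv_half (transition c d) x u) (deriv_half (transition c d) x v)"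
    using deriv_transition[OF c(1) d(1) zg(3,5) zg(1,4)] transition_fwd[OF c(1) d(1) zg(3,5) zg(1,4)]
    by (simp add: c d x uv met_dfwd r lin_inner[OF zg(3)])
qed

lemma bdry_bundle: "bdry Mfd = proj ` {z. fib z \<bullet> z = 1}"
proof
  show "bdry Mfd \<subseteq> proj ` {z. fib z \<bullet> z = 1}"
  proof
    fix q assume "q \<in> bdry Mfd"
    then obtain c where "c \<in> atlas Mfd" "q \<in> fst c" "snd c q $ nc = 0" unfolding bdry_def by blast
    then obtain p k where k: "k \<in> Iso" "q \<in> fst (chart p k)" "snd (chart p k) q $ nc = 0" by auto
    then obtain z where z: "z \<in> patch_set p" "q = proj (k z)" "fwd p z $ nc = 0"
      using chart_apply[OF k(1)] by (auto simp: fst_chart)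
    then have "fwd p z \<in> coord_region p" using fwd_coord_region by (simp add: patch_set_def)
    then have "p = Collar" using coord_region_nc(1)[of "fwd p z" p] z(3) by simp
    then have "fib (k z) \<bullet> k z = 1" using z(3) fwd_Collar_nc[of z] by (simp add: fib_iso_inner[OF k(1)])
    then show "q \<in> proj ` {z. fib z \<bullet> z = 1}" using z by blast
  qed
  show "proj ` {z. fib z \<bullet> z = 1} \<subseteq> bdry Mfd"
  proof
    fix q assume "q \<in> proj ` {z. fib z \<bullet> z = 1}"
    then obtain z where z: "fib z \<bullet> z = 1" "q = proj z" by auto
    then have "norm (fib z) = 1" by (simp add: norm_eq_sqrt_inner inner_fib)
    then obtain k where k: "k \<in> Iso" "\<And>r. k (r *\<^sub>R e) = r *\<^sub>R fib z + (z - fib z)"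
      using iso_collar[of z] by (metis div_by_1 norm_zero zero_neq_one)
    have d: "e \<in> patch_set Collar" using patch_set_collar[of 1] by simp
    have "q = proj (k e)" using k(2)[of 1] z by simp
    then have "q \<in> fst (chart Collar k)" "snd (chart Collar k) q $ nc = 0"
      using d chart_apply[OF k(1) d] by (auto simp: fst_chart inner_e e_nth)
    moreover have "chart Collar k \<in> atlas Mfd" using k(1) by auto
    ultimately show "q \<in> bdry Mfd" unfolding bdry_def by blast
  qed
qed

lemma compact_bundle: "compact_riemannian_manifold_with_boundary Mfd"
proof -
  have "fib e \<bullet> e = 1" by (simp add: inner_e e_nth)
  then have "bdry Mfd \<noteq> {}" unfolding bdry_bundle by blast
  then show ?thesis
    unfolding compact_riemannian_manifold_with_boundary_def
    by (simp add: Hausdorff_quot second_countable_quot compact_quot connected_quot smooth_atlas_bundle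
        riemannian_metric_bundle)
qed

section \<open>Connection, curvature and second fundamental form\<close>

lemma met_linear:
  "met x (u + v) w = met x u w + met x v w" "met x (u - v) w = met x u w - met x v w"
  "met x (r *\<^sub>R u) w = r * met x u w" "met x u (v + w) = met x u v + met x u w"
  "met x u (v - w) = met x u v - met x u w" "met x u (r *\<^sub>R w) = r * met x u w"
  using bilinear_met[of x]
  by (simp_all add: bilinear_ladd bilinear_radd bilinear_lsub bilinear_rsub bilinear_lmul bilinear_rmul)

lemma met_e: "x $ nc < 1 \<Longrightarrow> met x e w = ell x w / (4 * rad x)"
  by (simp add: met_def inner_e e_nth ell_linear)

lemma christoffel_bundle:
  assumes x: "x \<in> half_space" "x \<in> coord_region p"
  shows "christoffel Mfd c x u v = chris x u v"
proof -
  have D: "deriv_half (\<lambda>y. metric Mfd c y v w) x u =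
      (if x $ nc < 1 then (side u v * ell x w + side u w * ell x v) / (2 * rad x)
                            + ell x u * ell x v * ell x w / (4 * (rad x)\<^sup>2) else 0)" for u v w
    using frechet_derivative_half_space[OF met_has_derivative[OF x(2)] x(1)] by simp
  have K: "2 * metric Mfd c x (chris x u v) w =
        deriv_half (\<lambda>y. metric Mfd c y v w) x u
        + deriv_half (\<lambda>y. metric Mfd c y u w) x v
        - deriv_half (\<lambda>y. metric Mfd c y u v) x w" for w
  proof (cases "x $ nc < 1")
    case True
    then have "0 < rad x" using coord_region_nc(1)[OF x(2)] x(2) by auto
    with True show ?thesis
      unfolding D by (simp add: chris_def met_linear met_e side_commute[of v u] side_commute[of w u]
        side_commute[of w v] field_simps power2_eq_square)
  next
    case False
    then show ?thesis unfolding D by (simp add: chris_def met_def)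
  qed
  show ?thesis
    unfolding christoffel_def
  proof (rule the_equality)
    show "\<forall>w. 2 * metric Mfd c x (chris x u v) w =
        deriv_half (\<lambda>y. metric Mfd c y v w) x u
        + deriv_half (\<lambda>y. metric Mfd c y u w) x v
        - deriv_half (\<lambda>y. metric Mfd c y u v) x w" using K by blast
    fix z assume z: "\<forall>w. 2 * metric Mfd c x z w =
        deriv_half (\<lambda>y. metric Mfd c y v w) x u
        + deriv_half (\<lambda>y. metric Mfd c y u w) x v
        - deriv_half (\<lambda>y. metric Mfd c y u v) x w"
    have "2 * metric Mfd c x z w = 2 * metric Mfd c x (chris x u v) w" for w using z K[of w] by metis
    then have "met x z w = met x (chris x u v) w" for w by simp
    then have "met x (z - chris x u v) (z - chris x u v) = 0" by (simp add: met_linear(2))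
    then show "z = chris x u v" using met_pos[OF x(2), of "z - chris x u v"] by auto
  qed
qed

lemma deriv_half_const: "x \<in> half_space \<Longrightarrow> deriv_half (\<lambda>_. v) x u = 0"
  using frechet_derivative_half_space[OF has_derivative_const] by metis

lemma nabla_const:
  assumes x: "x \<in> half_space" "x \<in> coord_region p"
  shows "nabla Mfd c (\<lambda>_. v) (\<lambda>_. w) x = chris x v w"
  by (simp add: nabla_def christoffel_bundle[OF x] deriv_half_const[OF x(1)])

text \<open>The metric is flat, but this has to be read off from the Christoffel map: its covariant derivative
  \<open>N\<close> is symmetric in the two directions \<open>u\<close> and \<open>v\<close>.\<close>

lemma curvature_bundle:
  assumes x: "x \<in> half_space" "x \<in> coord_region p"
  shows "curvature Mfd c x u v w = 0"
proof -
  have D: "deriv_half (\<lambda>y. nabla Mfd c (\<lambda>_. v) (\<lambda>_. w) y) x u =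
     (if x $ nc < 1 then ((side u v * ell x w + side u w * ell x v) / rad x
                            + ell x u * ell x v * ell x w / (2 * (rad x)\<^sup>2)) *\<^sub>R e else 0)" for u v w
  proof (rule frechet_derivative_half_space[THEN fun_cong, OF _ x(1)])
    show "((\<lambda>y. nabla Mfd c (\<lambda>_. v) (\<lambda>_. w) y) has_derivative
     (\<lambda>u. if x $ nc < 1 then ((side u v * ell x w + side u w * ell x v) / rad x
                            + ell x u * ell x v * ell x w / (2 * (rad x)\<^sup>2)) *\<^sub>R e else 0)) (at x within half_space)"
    proof (rule has_derivative_transform_eventually[OF chris_has_derivative[OF x(2)]])
      show "\<forall>\<^sub>F y in at x within half_space. chris y v w = nabla Mfd c (\<lambda>_. v) (\<lambda>_. w) y"
        unfolding eventually_at_topological using open_coord_region[of p] x(2) nabla_const by metis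
    qed (use x nabla_const in auto)
  qed
  have n0: "nabla Mfd c (lie_bracket (\<lambda>_. u) (\<lambda>_. v)) (\<lambda>_. w) x = 0"
  proof -
    have "lie_bracket (\<lambda>_. u) (\<lambda>_. v) x = 0"
      by (simp add: lie_bracket_def deriv_half_const[OF x(1)])
    then show ?thesis
      by (simp add: nabla_def christoffel_bundle[OF x] chris_def ell_linear deriv_half_const[OF x(1)])
  qed
  have N: "nabla Mfd c (\<lambda>_. u) (nabla Mfd c (\<lambda>_. v) (\<lambda>_. w)) x =
      (if x $ nc < 1 then ((side u v * ell x w + side u w * ell x v + side v w * ell x u) / rad x
                            + 3 * ell x u * ell x v * ell x w / (4 * (rad x)\<^sup>2)) *\<^sub>R e else 0)" for u v w
  proof (cases "x $ nc < 1")
    case True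
    then have "0 < rad x" using coord_region_nc(1)[OF x(2)] x(2) by auto
    with True show ?thesis
      unfolding nabla_def[of _ _ "\<lambda>_. u"] D nabla_const[OF x] christoffel_bundle[OF x]
      by (simp add: chris_def ell_linear side_linear field_simps power2_eq_square)
        (simp add: scaleR_add_left[symmetric] field_simps)
  next
    case False
    then show ?thesis
      unfolding nabla_def[of _ _ "\<lambda>_. u"] D nabla_const[OF x] christoffel_bundle[OF x] by (simp add: chris_def)
  qed
  show ?thesis
    unfolding curvature_def Let_def n0 N by (simp add: side_commute[of v u] algebra_simps)
qed

lemma collar_of_boundary: "z \<in> patch_set p \<Longrightarrow> fib z \<bullet> z = 1 \<Longrightarrow> p = Collar \<and> 0 < z $ nc"
  by (cases p) (auto simp: patch_set_def)

text \<open>The radial vector \<open>fib z\<close> is the outward unit normal. For it, the second fundamental form of the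
  unit sphere is minus the metric, and the torus directions contribute nothing.\<close>

lemma second_fundamental_form_bundle:
  assumes z: "z \<in> patch_set p" "fib z \<bullet> z = 1"
  shows "second_fundamental_form Mfd c (fwd p z) (dfwd p z (r *\<^sub>R fib z)) (dfwd p z v) (dfwd p z w) = - r * (fib v \<bullet> w)"
proof -
  have p: "p = Collar" "0 < z $ nc" using collar_of_boundary[OF z] by auto
  have r: "z \<in> region p" using z by (simp add: patch_set_def)
  note x = half_space_fwd[OF z(1)] fwd_coord_region[OF r]
  have "fwd p z $ nc < 1" using coord_region_nc(1)[OF x(2)] p by simp
  then show ?thesis
    unfolding second_fundamental_form_def nabla_const[OF x] chris_dfwd[OF r] using p
    by (simp add: met_linear met_e ell_fwd rad_fwd power2_eq_square del: fwd.simps dfwd.simps)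
qed

lemma normal_to_bdry_bundle:
  assumes z: "z \<in> patch_set p" "fib z \<bullet> z = 1"
  shows "normal_to_bdry Mfd c (fwd p z) (dfwd p z (r *\<^sub>R fib z))"
proof -
  have p: "p = Collar" "0 < z $ nc" using collar_of_boundary[OF z] by auto
  have r: "z \<in> region p" using z by (simp add: patch_set_def)
  show ?thesis
    unfolding normal_to_bdry_def
  proof (intro allI impI)
    fix w :: "real^'n" assume "tangent_to_bdry w"
    define w' where "w' = dbwd p (fwd p z) w"
    have w: "w = dfwd p z w'"
      using dfwd_dbwd[OF fwd_coord_region[OF r]] by (simp add: w'_def bwd_fwd[OF r])
    have "fib z \<bullet> w' = 0" using \<open>tangent_to_bdry w\<close> p(1) by (simp add: w tangent_to_bdry_def e_nth)
    then show "metric Mfd c (fwd p z) (dfwd p z (r *\<^sub>R fib z)) w = 0" by (simp add: w met_dfwd[OF r])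
  qed
qed

lemma unit_inward_normal_bundle:
  assumes z: "z \<in> patch_set p" "fib z \<bullet> z = 1"
  shows "unit_inward_normal Mfd c (fwd p z) (dfwd p z w) \<longleftrightarrow> w = - fib z"
proof
  have p: "p = Collar" "0 < z $ nc" using collar_of_boundary[OF z] by auto
  have r: "z \<in> region p" using z by (simp add: patch_set_def)
  have ff: "fib z \<bullet> fib z = 1" using z(2) by (simp add: inner_fib)
  have nc: "dfwd p z u $ nc = - 2 * (fib z \<bullet> u)" for u using p(1) by (simp add: e_nth)
  {
    assume w: "unit_inward_normal Mfd c (fwd p z) (dfwd p z w)"
    define u where "u = w - (fib z \<bullet> w) *\<^sub>R fib z"
    have zu: "fib z \<bullet> u = 0" by (simp add: u_def inner_diff_right ff)
    then have "met (fwd p z) (dfwd p z w) (dfwd p z u) = 0"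
      using w nc[of u] by (simp add: unit_inward_normal_def normal_to_bdry_def tangent_to_bdry_def)
    then have "w \<bullet> u = 0" by (simp add: met_dfwd[OF r])
    then have "u \<bullet> u = 0" using zu by (simp add: u_def inner_diff_left)
    then have w': "w = (fib z \<bullet> w) *\<^sub>R fib z" by (simp add: u_def)
    have "w \<bullet> w = 1" "0 < dfwd p z w $ nc" using w by (simp_all add: unit_inward_normal_def met_dfwd[OF r])
    then have "(fib z \<bullet> w)\<^sup>2 = 1" "fib z \<bullet> w < 0"
      using ff nc[of w] by (subst (asm) (1 2) w', simp add: power2_eq_square, simp)
    then have "fib z \<bullet> w = - 1" by (simp add: power2_eq_1_iff)
    then show "w = - fib z" using w' by simp
  next
    assume w: "w = - fib z"
    then have "dfwd p z w = dfwd p z ((- 1) *\<^sub>R fib z)" by simp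
    then have "normal_to_bdry Mfd c (fwd p z) (dfwd p z w)" using normal_to_bdry_bundle[OF z] by metis
    then show "unit_inward_normal Mfd c (fwd p z) (dfwd p z w)"
      using nc[of w] by (simp add: unit_inward_normal_def met_dfwd[OF r] w ff)
  }
qed

section \<open>Developing charts along curves in the tube\<close>

text \<open>\<open>lifts c z p k g\<close> says that \<open>c\<close> is the chart \<open>chart p k\<close> and that, near \<open>z\<close>, the composition of the
  quotient map with \<open>c\<close> is \<open>fwd p \<circ> g\<close>. One chart, as a set with a map on it, may be presented by several
  pairs \<open>p\<close> and \<open>k\<close>, and \<open>g\<close> is a matter of choice too.\<close>

definition lifts :: "(real^'n, 'n) chart \<Rightarrow> real^'n \<Rightarrow> patch \<Rightarrow> (real^'n \<Rightarrow> real^'n) \<Rightarrow> (real^'n \<Rightarrow> real^'n) \<Rightarrow> bool" where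
  "lifts c z p k g \<longleftrightarrow> k \<in> Iso \<and> g \<in> Iso \<and> c = chart p k \<and> g z \<in> patch_set p \<and> (\<forall>w. proj (k (g w)) = proj w)"

lemma lifts_exists:
  assumes "c \<in> atlas Mfd" "proj z \<in> fst c"
  obtains p k g where "lifts c z p k g"
proof -
  obtain p k where c: "k \<in> Iso" "c = chart p k" using assms(1) by auto
  then obtain z' where z': "z' \<in> patch_set p" "proj z = proj (k z')" using assms(2) by (auto simp: fst_chart)
  obtain g where "g \<in> Iso" "g z = z'" "\<And>w. proj (k (g w)) = proj w"
    using proj_eq_iso[OF iso_id c(1) z'(2)] by blast
  then show thesis using that[of p k g] c z' by (simp add: lifts_def)
qed

lemma liftsD:
  assumes "lifts c z p k g"
  shows "k \<in> Iso" "g \<in> Iso" "g z \<in> patch_set p" "g z \<in> region p" "proj (k (g w)) = proj w" "c \<in> atlas Mfd"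
    "proj z \<in> fst c" "snd c (proj z) = fwd p (g z)" "z \<in> tube"
    "snd c (proj z) \<in> half_space" "snd c (proj z) \<in> coord_region p"
proof -
  show l: "k \<in> Iso" "g \<in> Iso" "g z \<in> patch_set p" "g z \<in> region p" "proj (k (g w)) = proj w" for w
    using assms by (auto simp: lifts_def patch_set_def)
  show "c \<in> atlas Mfd" using assms by (auto simp: lifts_def)
  have c: "c = chart p k" using assms by (simp add: lifts_def)
  show "proj z \<in> fst c"
    unfolding c fst_chart by (rule image_eqI[OF _ l(3)]) (simp add: l(5))
  show "snd c (proj z) = fwd p (g z)"
    unfolding c using chart_apply[OF l(1,3)] by (simp add: l(5))
  then show "snd c (proj z) \<in> half_space" "snd c (proj z) \<in> coord_region p"
    using half_space_fwd[OF l(3)] fwd_coord_region[OF l(4)] by simp_all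
  show "z \<in> tube" using l(3) iso_tube[OF l(2)] by (simp add: patch_set_def)
qed

lemma lifts_nearby:
  "lifts c z p k g \<Longrightarrow> w \<in> tube \<Longrightarrow> g w \<in> region p \<Longrightarrow> lifts c w p k g"
  using iso_tube by (auto simp: lifts_def patch_set_def)

lemma lifts_change:
  assumes "lifts c z p k g" "lifts d z p' k' g'"
  shows "deriv_half (transition c d) (snd c (proj z)) (dfwd p (g z) (lin g u)) = dfwd p' (g' z) (lin g' u)"
proof -
  note l = liftsD[OF assms(1)] and l' = liftsD[OF assms(2)]
  define h where "h = (\<lambda>w. g' (inv g w))"
  have h: "h \<in> Iso" unfolding h_def by (rule iso_compose(1)[OF iso_inverse(1)[OF l(2)] l'(2)])
  have hg: "h (g z) = g' z" by (simp add: h_def iso_inverse(2)[OF l(2)])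
  have hp: "proj (k' (h w)) = proj (k w)" for w
    using l(5)[of "inv g w"] l'(5)[of "inv g w"] by (simp add: h_def iso_inverse(3)[OF l(2)])
  have "lin h (lin g u) = lin g' u"
    unfolding h_def iso_compose(2)[OF iso_inverse(1)[OF l(2)] l'(2)] by (simp add: lin_inv[OF l(2)])
  moreover have "h (g z) \<in> patch_set p'" using l'(3) hg by simp
  moreover have "c = chart p k" "d = chart p' k'" using assms by (auto simp: lifts_def)
  ultimately show ?thesis
    unfolding l(8) using deriv_transition[OF l(1) l'(1) h hp l(3)] by (simp add: hg)
qed

text \<open>Two presentations yield the same derivative since both compute the derivative of the transition
  map from the chart to itself.\<close>

lemma lifts_unique:
  assumes "lifts c z p k g" "lifts c z p' k' g'"
  shows "dfwd p (g z) (lin g u) = dfwd p' (g' z) (lin g' u)"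
proof -
  note l = liftsD[OF assms(1)]
  have c: "c = chart p k" using assms(1) by (simp add: lifts_def)
  have id: "transition c c y = y" if "y \<in> img c" for y
    using that by (simp add: transition_def f_inv_into_f)
  have img: "img c = half_space \<inter> coord_region p" unfolding c by (rule img_chart[OF l(1)])
  have "((\<lambda>y. y) has_derivative (\<lambda>u. u)) (at (snd c (proj z)) within half_space)" by simp
  then have "(transition c c has_derivative (\<lambda>u. u)) (at (snd c (proj z)) within half_space)"
  proof (rule has_derivative_transform_eventually)
    show "\<forall>\<^sub>F y in at (snd c (proj z)) within half_space. y = transition c c y"
      unfolding eventually_at_topological using open_coord_region[of p] l(11) id img by (metis IntI)
  qed (use l id img in auto)
  then have "deriv_half (transition c c) (snd c (proj z)) = (\<lambda>u. u)"
    by (rule frechet_derivative_half_space[OF _ l(10)])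
  then show ?thesis using lifts_change[OF assms] by simp
qed

text \<open>The derivative at \<open>z\<close> of the composition of the quotient map with the chart \<open>c\<close>. It identifies the
  tangent space of the manifold with \<open>\<real>\<^sup>n\<close>, isometrically and compatibly with changes of charts.\<close>

definition tmap :: "(real^'n, 'n) chart \<Rightarrow> real^'n \<Rightarrow> real^'n \<Rightarrow> real^'n" where
  "tmap c z u = (SOME v. \<exists>p k g. lifts c z p k g \<and> v = dfwd p (g z) (lin g u))"

lemma tmap_eq: "lifts c z p k g \<Longrightarrow> tmap c z u = dfwd p (g z) (lin g u)"
proof -
  assume l: "lifts c z p k g"
  then have "\<exists>v p k g. lifts c z p k g \<and> v = dfwd p (g z) (lin g u)" by blast
  from someI_ex[OF this] obtain p' k' g' where "lifts c z p' k' g'" "tmap c z u = dfwd p' (g' z) (lin g' u)"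
    unfolding tmap_def by blast
  then show ?thesis using lifts_unique[OF l] by metis
qed

context
  fixes c z assumes c: "c \<in> atlas Mfd" "proj z \<in> fst c"
begin

lemma linear_tmap: "linear (tmap c z)"
proof -
  obtain p k g where l: "lifts c z p k g" using lifts_exists[OF c] by blast
  have "tmap c z = dfwd p (g z) \<circ> lin g" using tmap_eq[OF l] by (simp add: fun_eq_iff)
  then show ?thesis using linear_compose[OF linear_lin linear_dfwd] liftsD(2)[OF l] by metis
qed

lemma met_tmap: "met (snd c (proj z)) (tmap c z u) (tmap c z v) = u \<bullet> v"
proof -
  obtain p k g where l: "lifts c z p k g" using lifts_exists[OF c] by blast
  show ?thesis using liftsD(2,4,8)[OF l] by (simp add: tmap_eq[OF l] met_dfwd lin_inner)
qed

lemma bij_tmap: "bij (tmap c z)"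
proof -
  have "u = v" if "tmap c z u = tmap c z v" for u v
  proof -
    have "tmap c z (u - v) = 0" using that by (simp add: linear_diff[OF linear_tmap])
    moreover have "met x 0 0 = 0" for x by (simp add: met_def ell_linear)
    ultimately have "(u - v) \<bullet> (u - v) = 0" using met_tmap[of "u - v" "u - v"] by metis
    then show ?thesis by simp
  qed
  then have "inj (tmap c z)" by (auto intro: injI)
  then show ?thesis using linear_injective_imp_surjective[OF linear_tmap] by (simp add: bij_def)
qed

lemma tmap_change:
  assumes d: "d \<in> atlas Mfd" "proj z \<in> fst d"
  shows "deriv_half (transition c d) (snd c (proj z)) (tmap c z u) = tmap d z u"
proof -
  obtain p k g where l: "lifts c z p k g" using lifts_exists[OF c] by blast
  obtain p' k' g' where l': "lifts d z p' k' g'" using lifts_exists[OF d] by blast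
  show ?thesis using lifts_change[OF l l'] by (simp add: tmap_eq[OF l] tmap_eq[OF l'])
qed

lemma second_fundamental_form_tmap:
  assumes "fib z \<bullet> z = 1"
  shows "second_fundamental_form Mfd c (snd c (proj z)) (tmap c z (r *\<^sub>R fib z)) (tmap c z v) (tmap c z w) = - r * (fib v \<bullet> w)"
proof -
  obtain p k g where l: "lifts c z p k g" using lifts_exists[OF c] by blast
  note g = liftsD(2)[OF l]
  have "lin g (r *\<^sub>R fib z) = r *\<^sub>R fib (g z)"
    by (simp add: linear_scale[OF linear_lin[OF g]] lin_fib[OF g] fib_iso[OF g])
  then show ?thesis
    using second_fundamental_form_bundle[OF liftsD(3)[OF l], of c r "lin g v" "lin g w"] assms
    by (simp add: tmap_eq[OF l] liftsD(8)[OF l] fib_iso_inner[OF g] lin_fib_inner[OF g])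
qed

lemma normal_tmap:
  assumes "fib z \<bullet> z = 1"
  shows "normal_to_bdry Mfd c (snd c (proj z)) (tmap c z (r *\<^sub>R fib z))"
    and "unit_inward_normal Mfd c (snd c (proj z)) (tmap c z w) \<longleftrightarrow> w = - fib z"
    and "tangent_to_bdry (tmap c z w) \<longleftrightarrow> fib z \<bullet> w = 0"
proof -
  obtain p k g where l: "lifts c z p k g" using lifts_exists[OF c] by blast
  note g = liftsD(2)[OF l]
  have gz: "fib (g z) \<bullet> g z = 1" using assms by (simp add: fib_iso_inner[OF g])
  have lg: "lin g (r *\<^sub>R fib z) = r *\<^sub>R fib (g z)" for r
    by (simp add: linear_scale[OF linear_lin[OF g]] lin_fib[OF g] fib_iso[OF g])
  show "normal_to_bdry Mfd c (snd c (proj z)) (tmap c z (r *\<^sub>R fib z))"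
    using normal_to_bdry_bundle[OF liftsD(3)[OF l] gz] by (simp add: tmap_eq[OF l] liftsD(8)[OF l] lg)
  have "lin g w = - fib (g z) \<longleftrightarrow> w = - fib z"
    using lg[of "- 1"] inj_lin[OF g, of w "- fib z"] by simp
  then show "unit_inward_normal Mfd c (snd c (proj z)) (tmap c z w) \<longleftrightarrow> w = - fib z"
    using unit_inward_normal_bundle[OF liftsD(3)[OF l] gz] by (simp add: tmap_eq[OF l] liftsD(8)[OF l])
  have "p = Collar" using collar_of_boundary[OF liftsD(3)[OF l] gz] by simp
  then show "tangent_to_bdry (tmap c z w) \<longleftrightarrow> fib z \<bullet> w = 0"
    by (simp add: tmap_eq[OF l] tangent_to_bdry_def e_nth fib_iso_lin_inner[OF g])
qed

end

section \<open>Geodesics\<close>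

text \<open>Projections of straight lines are geodesics, and constant vectors are parallel along them.\<close>

context
  fixes z0 w :: "real^'n" and a b :: real and \<gamma> :: "real \<Rightarrow> real^'n"
  assumes ab: "a < b" and tube: "\<And>s. s \<in> {a..b} \<Longrightarrow> z0 + s *\<^sub>R w \<in> tube"
    and \<gamma>: "\<And>s. s \<in> {a..b} \<Longrightarrow> \<gamma> s = proj (z0 + s *\<^sub>R w)"
begin

lemma line_lifts_eventually:
  assumes "lifts c (z0 + t *\<^sub>R w) p k g"
  shows "\<forall>\<^sub>F s in at t within {a..b}. lifts c (z0 + s *\<^sub>R w) p k g"
proof -
  note g = liftsD(2)[OF assms]
  have "continuous_on UNIV (\<lambda>s. g (z0 + s *\<^sub>R w))"
    by (rule continuous_on_compose2[OF iso_continuous_on[OF g, of UNIV]]) (auto intro!: continuous_intros)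
  then have "open ((\<lambda>s. g (z0 + s *\<^sub>R w)) -` region p)" by (rule open_vimage[OF open_region])
  moreover have "t \<in> (\<lambda>s. g (z0 + s *\<^sub>R w)) -` region p" using liftsD(4)[OF assms] by simp
  ultimately show ?thesis
    unfolding eventually_at_topological
    by (intro exI[of _ "(\<lambda>s. g (z0 + s *\<^sub>R w)) -` region p"]) (auto intro: lifts_nearby[OF assms tube])
qed

lemma line_has_vector_derivative:
  assumes t: "t \<in> {a..b}" and c: "c \<in> atlas Mfd" "\<gamma> t \<in> fst c"
  shows "((snd c \<circ> \<gamma>) has_vector_derivative tmap c (z0 + t *\<^sub>R w) w) (at t within {a..b})"
    and "((\<lambda>s. tmap c (z0 + s *\<^sub>R w) u) has_vector_derivative
      - christoffel Mfd c (snd c (\<gamma> t)) (tmap c (z0 + t *\<^sub>R w) w) (tmap c (z0 + t *\<^sub>R w) u)) (at t within {a..b})"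
proof -
  obtain p k g where l: "lifts c (z0 + t *\<^sub>R w) p k g" using lifts_exists[OF c(1)] c(2) \<gamma>[OF t] by metis
  note g = liftsD(2)[OF l]
  have 1: "((\<lambda>s. g (z0 + s *\<^sub>R w)) has_vector_derivative lin g w) (at t within {a..b})"
  proof -
    have "((\<lambda>s. z0 + s *\<^sub>R w) has_derivative (\<lambda>s. s *\<^sub>R w)) (at t within {a..b})"
      by (auto intro!: derivative_eq_intros)
    from has_derivative_compose[OF this iso_has_derivative[OF g]] show ?thesis
      by (simp add: has_vector_derivative_def linear_scale[OF linear_lin[OF g]])
  qed
  have "((\<lambda>s. fwd p (g (z0 + s *\<^sub>R w))) has_vector_derivative dfwd p (g (z0 + t *\<^sub>R w)) (lin g w)) (at t within {a..b})"
    using has_derivative_compose[OF 1[unfolded has_vector_derivative_def] fwd_has_derivative]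
    by (simp add: has_vector_derivative_def linear_scale[OF linear_dfwd])
  then have "((\<lambda>s. fwd p (g (z0 + s *\<^sub>R w))) has_vector_derivative tmap c (z0 + t *\<^sub>R w) w) (at t within {a..b})"
    by (simp add: tmap_eq[OF l])
  then show "((snd c \<circ> \<gamma>) has_vector_derivative tmap c (z0 + t *\<^sub>R w) w) (at t within {a..b})"
    unfolding has_vector_derivative_def
  proof (rule has_derivative_transform_eventually)
    have "\<forall>\<^sub>F s in at t within {a..b}. s \<in> {a..b}" by (simp add: eventually_at_filter)
    with line_lifts_eventually[OF l]
    show "\<forall>\<^sub>F s in at t within {a..b}. fwd p (g (z0 + s *\<^sub>R w)) = (snd c \<circ> \<gamma>) s"
      by eventually_elim (simp add: \<gamma> liftsD(8))
  qed (use t \<gamma> liftsD(8)[OF l] in auto)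
  have 2: "((\<lambda>s. dfwd p (g (z0 + s *\<^sub>R w)) (lin g u)) has_vector_derivative
      (if p = Collar then - 2 * (fib (lin g w) \<bullet> lin g u) else 0) *\<^sub>R e) (at t within {a..b})"
  proof (cases p)
    case Collar
    have "((\<lambda>s. lin g u + (- 2 * (fib (g (z0 + s *\<^sub>R w)) \<bullet> lin g u) - lin g u $ nc) *\<^sub>R e) has_vector_derivative
      (- 2 * (fib (lin g w) \<bullet> lin g u)) *\<^sub>R e) (at t within {a..b})"
    proof -
      have "((\<lambda>s. fib (g (z0 + s *\<^sub>R w)) \<bullet> lin g u) has_vector_derivative fib (lin g w) \<bullet> lin g u) (at t within {a..b})"
        by (rule bounded_linear.has_vector_derivative[OF bounded_linear_inner_left bl_fib_has_vector_derivative[OF 1]])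
      from bounded_linear.has_vector_derivative[OF bounded_linear_mult_right[of "- 2"] this]
      have "((\<lambda>s. - 2 * (fib (g (z0 + s *\<^sub>R w)) \<bullet> lin g u) - lin g u $ nc) has_vector_derivative
          - 2 * (fib (lin g w) \<bullet> lin g u) - 0) (at t within {a..b})"
        by (intro has_vector_derivative_diff has_vector_derivative_const)
      from has_vector_derivative_add[OF has_vector_derivative_const
          bounded_linear.has_vector_derivative[OF bounded_linear_scaleR_left[of e] this]]
      show ?thesis by simp
    qed
    then show ?thesis using Collar by simp
  qed simp
  have C: "christoffel Mfd c (snd c (\<gamma> t)) (tmap c (z0 + t *\<^sub>R w) w) (tmap c (z0 + t *\<^sub>R w) u) =
      (if p = Collar then 2 * (fib (lin g w) \<bullet> lin g u) else 0) *\<^sub>R e"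
    using christoffel_bundle[OF liftsD(10,11)[OF l]] chris_dfwd[OF liftsD(4)[OF l]] \<gamma>[OF t]
    by (simp add: tmap_eq[OF l] liftsD(8)[OF l])
  have "((\<lambda>s. dfwd p (g (z0 + s *\<^sub>R w)) (lin g u)) has_vector_derivative
      - christoffel Mfd c (snd c (\<gamma> t)) (tmap c (z0 + t *\<^sub>R w) w) (tmap c (z0 + t *\<^sub>R w) u)) (at t within {a..b})"
    unfolding C using 2 by (simp split: if_splits)
  then show "((\<lambda>s. tmap c (z0 + s *\<^sub>R w) u) has_vector_derivative
      - christoffel Mfd c (snd c (\<gamma> t)) (tmap c (z0 + t *\<^sub>R w) w) (tmap c (z0 + t *\<^sub>R w) u)) (at t within {a..b})"
    unfolding has_vector_derivative_def
  proof (rule has_derivative_transform_eventually)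
    show "\<forall>\<^sub>F s in at t within {a..b}. dfwd p (g (z0 + s *\<^sub>R w)) (lin g u) = tmap c (z0 + s *\<^sub>R w) u"
      using line_lifts_eventually[OF l] by eventually_elim (simp add: tmap_eq)
  qed (use t tmap_eq[OF l] in auto)
qed

lemma line_velocity:
  assumes "t \<in> {a..b}" "c \<in> atlas Mfd" "\<gamma> t \<in> fst c"
  shows "velocity {a..b} \<gamma> c t = tmap c (z0 + t *\<^sub>R w) w"
  using vector_derivative_within_closed_interval[OF ab assms(1) line_has_vector_derivative(1)[OF assms]] .

lemma line_continuous: "continuous_map (top_of_set {a..b}) quot \<gamma>"
proof -
  have "continuous_map (top_of_set {a..b}) (top_of_set tube) (\<lambda>s. z0 + s *\<^sub>R w)"
    by (rule continuous_map_into_subtopology) (use tube in \<open>auto intro!: continuous_intros\<close>)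
  from continuous_map_compose[OF this continuous_map_proj] show ?thesis
    by (rule continuous_map_eq) (simp add: \<gamma>)
qed

lemma line_geodesic: "geodesic_on Mfd {a..b} \<gamma>"
  unfolding geodesic_on_def
proof (intro conjI ballI impI)
  show "continuous_map (top_of_set {a..b}) (space_of Mfd) \<gamma>" using line_continuous by simp
  fix c t assume c: "c \<in> atlas Mfd" and t: "t \<in> {a..b}" and tc: "\<gamma> t \<in> fst c"
  show "(snd c \<circ> \<gamma>) differentiable at t within {a..b}"
    using line_has_vector_derivative(1)[OF t c tc] unfolding has_vector_derivative_def differentiable_def by blast
  obtain p k g where l: "lifts c (z0 + t *\<^sub>R w) p k g" using lifts_exists[OF c] tc \<gamma>[OF t] by metis
  show "(velocity {a..b} \<gamma> c has_vector_derivative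
           - christoffel Mfd c (snd c (\<gamma> t)) (velocity {a..b} \<gamma> c t) (velocity {a..b} \<gamma> c t)) (at t within {a..b})"
    using line_has_vector_derivative(2)[OF t c tc, of w]
    unfolding line_velocity[OF t c tc] has_vector_derivative_def
  proof (rule has_derivative_transform_eventually)
    have "\<forall>\<^sub>F s in at t within {a..b}. s \<in> {a..b}" by (simp add: eventually_at_filter)
    with line_lifts_eventually[OF l]
    show "\<forall>\<^sub>F s in at t within {a..b}. tmap c (z0 + s *\<^sub>R w) w = velocity {a..b} \<gamma> c s"
      by eventually_elim (use line_velocity c \<gamma> liftsD(7) in metis)
  qed (use t line_velocity[OF t c tc] in auto)
qed

end

text \<open>If \<open>v\<close> is the velocity of a geodesic \<open>x\<close> then the velocity of the developed curve is constant. On the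
  collar its normal component is \<open>- ell x v / (2 s)\<close> with \<open>s = sqrt (rad x)\<close>; here \<open>s' = - ell x v / (2 s)\<close> since
  \<open>- ell\<close> is the differential of \<open>rad\<close>, and the geodesic equation gives
  \<open>(ell x v)' = - (ell x v)\<^sup>2 / (2 s\<^sup>2)\<close>. So the quotient has derivative zero.\<close>

lemma dbwd_parallel:
  assumes x: "x t \<in> coord_region p"
    and "(x has_vector_derivative v t) (at t within J)"
    and "(v has_vector_derivative - chris (x t) (v t) (v t)) (at t within J)"
  shows "((\<lambda>s. dbwd p (x s) (v s)) has_vector_derivative 0) (at t within J)"
proof (cases p)
  case Core
  then have "\<not> x t $ nc < 1" using coord_region_nc(1)[OF x] by simp
  then show ?thesis using assms(3) Core by (simp add: chris_def)
next
  case Collar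
  then have r: "0 < rad (x t)" "x t $ nc < 1" using x coord_region_nc(1)[OF x] by auto
  define s where "s = sqrt (rad (x t))"
  have s: "0 < s" "rad (x t) = s\<^sup>2" using r by (auto simp: s_def)
  define l where "l = ell (x t) (v t)"
  define \<beta> where "\<beta> = 2 * side (v t) (v t) + l * l / (2 * s\<^sup>2)"
  have "chris (x t) (v t) (v t) = \<beta> *\<^sub>R e" using r by (simp add: chris_def \<beta>_def l_def s)
  then have v: "(v has_vector_derivative - \<beta> *\<^sub>R e) (at t within J)" using assms(3) by simp
  have vnc: "((\<lambda>s. v s $ nc) has_real_derivative - \<beta>) (at t within J)"
    using bounded_linear.has_vector_derivative[OF bounded_linear_vec_nth[of nc] v]
    by (simp add: e_nth has_real_derivative_iff_has_vector_derivative)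
  have "((\<lambda>s. fib (x s) \<bullet> v s) has_vector_derivative (fib (x t) \<bullet> (- \<beta> *\<^sub>R e) + fib (v t) \<bullet> v t)) (at t within J)"
    by (rule bounded_bilinear.has_vector_derivative[OF bounded_bilinear_inner bl_fib_has_vector_derivative[OF assms(2)] v])
  moreover have "((\<lambda>s. x s $ nc * v s $ nc) has_vector_derivative (x t $ nc * (- \<beta>) + v t $ nc * v t $ nc)) (at t within J)"
    using bounded_bilinear.has_vector_derivative[OF bounded_bilinear_mult
       bounded_linear.has_vector_derivative[OF bounded_linear_vec_nth[of nc] assms(2)]
       bounded_linear.has_vector_derivative[OF bounded_linear_vec_nth[of nc] v]] by (simp add: e_nth)
  ultimately have "((\<lambda>s. side (x s) (v s)) has_vector_derivative
      (fib (x t) \<bullet> (- \<beta> *\<^sub>R e) + fib (v t) \<bullet> v t) - (x t $ nc * (- \<beta>) + v t $ nc * v t $ nc)) (at t within J)"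
    unfolding side_def by (rule has_vector_derivative_diff)
  then have side: "((\<lambda>s. side (x s) (v s)) has_real_derivative side (v t) (v t)) (at t within J)"
    by (simp add: has_real_derivative_iff_has_vector_derivative fib_inner_e side_def)
  have ell: "((\<lambda>s. ell (x s) (v s)) has_real_derivative - (l * l / (2 * s\<^sup>2))) (at t within J)"
    unfolding ell_def by (rule derivative_eq_intros vnc side refl)+ (simp add: \<beta>_def)
  have rad: "((\<lambda>s. rad (x s)) has_real_derivative - l) (at t within J)"
    using has_derivative_compose[OF assms(2)[unfolded has_vector_derivative_def] rad_has_derivative]
    by (simp add: has_real_derivative_iff_has_vector_derivative has_vector_derivative_def ell_linear l_def)
  have "((\<lambda>s. sqrt (rad (x s))) has_real_derivative - l / (2 * s)) (at t within J)"
    using DERIV_chain2[OF DERIV_real_sqrt[OF r(1)] rad] by (simp add: s_def[symmetric] field_simps)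
  note quotient = DERIV_divide[OF DERIV_minus[OF ell] DERIV_cmult[OF this, of 2]]
  have "((\<lambda>s. - ell (x s) (v s) / (2 * sqrt (rad (x s)))) has_real_derivative 0) (at t within J)"
    by (rule DERIV_cong[OF quotient])
      (use s(1) in \<open>simp_all add: l_def[symmetric] s_def[symmetric] field_simps power2_eq_square\<close>)
  then have "((\<lambda>s. - ell (x s) (v s) / (2 * sqrt (rad (x s))) - v s $ nc) has_real_derivative 0 - (- \<beta>)) (at t within J)"
    by (rule DERIV_diff[OF _ vnc])
  then have "((\<lambda>s. v s + (- ell (x s) (v s) / (2 * sqrt (rad (x s))) - v s $ nc) *\<^sub>R e) has_vector_derivative
      - \<beta> *\<^sub>R e + (0 - (- \<beta>)) *\<^sub>R e) (at t within J)"
    unfolding has_real_derivative_iff_has_vector_derivative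
    by (intro has_vector_derivative_add v bounded_linear.has_vector_derivative[OF bounded_linear_scaleR_left])
  then show ?thesis using Collar by simp
qed

text \<open>The uniqueness of geodesics with given initial velocity is obtained without a general theorem on
  differential equations: in the chart the developed curve has constant velocity.\<close>

lemma geodesic_locally_line:
  assumes ab: "a < b" and geo: "geodesic_on Mfd {a..b} \<gamma>" and T: "T \<in> {a..b}"
    and k: "k \<in> Iso" and z: "z \<in> patch_set p" "\<gamma> T = proj (k z)"
  obtains r w where "0 < r" "velocity {a..b} \<gamma> (chart p k) T = dfwd p z w"
    "\<And>t. t \<in> {a..b} \<Longrightarrow> \<bar>t - T\<bar> < r \<Longrightarrow> \<gamma> t = proj (k z + (t - T) *\<^sub>R lin k w)"
proof -
  define c where "c = chart p k"
  have c: "c \<in> atlas Mfd" using k by (auto simp: c_def)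
  have "continuous_map (top_of_set {a..b}) quot \<gamma>" using geo by (simp add: geodesic_on_def)
  then have "openin (top_of_set {a..b}) {t \<in> topspace (top_of_set {a..b}). \<gamma> t \<in> fst c}"
    using homeomorphic_map_local_section(2)[OF k, of p] unfolding c_def by (rule openin_continuous_map_preimage)
  moreover have Tc: "\<gamma> T \<in> fst c" using z by (simp add: c_def fst_chart)
  ultimately obtain r where r: "0 < r" "\<And>t. t \<in> {a..b} \<Longrightarrow> dist t T < r \<Longrightarrow> \<gamma> t \<in> fst c"
    using T unfolding openin_euclidean_subtopology_iff by force
  define J where "J = {a..b} \<inter> ball T r"
  have J: "convex J" "T \<in> J" "J \<subseteq> {a..b}" using T r(1) by (auto simp: J_def intro!: convex_Int)
  have Jc: "\<gamma> t \<in> fst c" if "t \<in> J" for t using that r(2) by (auto simp: J_def dist_commute)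
  define x where "x = snd c \<circ> \<gamma>"
  define v where "v = velocity {a..b} \<gamma> c"
  have lift: "\<exists>y\<in>patch_set p. \<gamma> t = proj (k y) \<and> x t = fwd p y" if "t \<in> J" for t
    using Jc[OF that] chart_apply[OF k] by (auto simp: c_def fst_chart x_def)
  have xr: "x t \<in> half_space" "x t \<in> coord_region p" "bwd p (x t) \<in> patch_set p" "\<gamma> t = proj (k (bwd p (x t)))"
    if "t \<in> J" for t
  proof -
    obtain y where y: "y \<in> patch_set p" "\<gamma> t = proj (k y)" "x t = fwd p y" using lift[OF \<open>t \<in> J\<close>] by blast
    then have "y \<in> region p" by (simp add: patch_set_def)
    then show "x t \<in> half_space" "x t \<in> coord_region p" "bwd p (x t) \<in> patch_set p" "\<gamma> t = proj (k (bwd p (x t)))"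
      using y half_space_fwd fwd_coord_region bwd_fwd by auto
  qed
  have xd: "(x has_vector_derivative v t) (at t within J)"
    and vd: "(v has_vector_derivative - chris (x t) (v t) (v t)) (at t within J)" if t: "t \<in> J" for t
  proof -
    have "\<forall>t\<in>{a..b}. \<gamma> t \<in> fst c \<longrightarrow> (snd c \<circ> \<gamma>) differentiable (at t within {a..b}) \<and>
        (v has_vector_derivative - christoffel Mfd c (snd c (\<gamma> t)) (v t) (v t)) (at t within {a..b})"
      using geo c unfolding geodesic_on_def v_def by blast
    then have "x differentiable at t within {a..b}"
      "(v has_vector_derivative - christoffel Mfd c (x t) (v t) (v t)) (at t within {a..b})"
      using J(3) Jc[OF t] t by (auto simp: x_def)
    then show "(x has_vector_derivative v t) (at t within J)"
      "(v has_vector_derivative - chris (x t) (v t) (v t)) (at t within J)"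
      using has_vector_derivative_within_subset[OF _ J(3)] christoffel_bundle[OF xr(1,2)[OF t]]
      by (auto simp: v_def x_def vector_derivative_works)
  qed
  have der: "((\<lambda>s. dbwd p (x s) (v s)) has_vector_derivative 0) (at t within J)" if "t \<in> J" for t
    by (rule dbwd_parallel[OF xr(2) xd vd]) (use that in auto)
  obtain w where w: "\<And>t. t \<in> J \<Longrightarrow> dbwd p (x t) (v t) = w"
    using has_vector_derivative_zero_constant[OF J(1) der] by blast
  have der2: "((\<lambda>s. bwd p (x s) - (s - T) *\<^sub>R w) has_vector_derivative 0) (at t within J)" if t: "t \<in> J" for t
  proof -
    have "((\<lambda>s. bwd p (x s)) has_vector_derivative w) (at t within J)"
      using has_derivative_compose[OF xd[OF t, unfolded has_vector_derivative_def] bwd_has_derivative[OF xr(2)[OF t]]] w[OF t]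
      by (simp add: has_vector_derivative_def linear_scale[OF linear_dbwd[OF xr(2)[OF t]]])
    then show ?thesis by (auto intro!: derivative_eq_intros)
  qed
  obtain y where y: "\<And>t. t \<in> J \<Longrightarrow> bwd p (x t) - (t - T) *\<^sub>R w = y"
    using has_vector_derivative_zero_constant[OF J(1) der2] by blast
  have xT: "x T = fwd p z" using chart_apply[OF k z(1)] z(2) by (simp add: x_def c_def)
  have zr: "z \<in> region p" using z by (simp add: patch_set_def)
  have "y = z" using y[OF J(2)] by (simp add: xT bwd_fwd[OF zr])
  show thesis
  proof (rule that[OF r(1)])
    show "velocity {a..b} \<gamma> (chart p k) T = dfwd p z w"
      using w[OF J(2)] dfwd_dbwd[OF fwd_coord_region[OF zr], of "v T"] by (simp add: v_def c_def xT bwd_fwd[OF zr])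
    fix t assume "t \<in> {a..b}" "\<bar>t - T\<bar> < r"
    then have t: "t \<in> J" by (simp add: J_def dist_real_def abs_minus_commute)
    have "bwd p (x t) = z + (t - T) *\<^sub>R w" using y[OF t] \<open>y = z\<close> by (simp add: algebra_simps)
    then show "\<gamma> t = proj (k z + (t - T) *\<^sub>R lin k w)"
      using xr(4)[OF t] by (simp add: iso_add[OF k] linear_scale[OF linear_lin[OF k]])
  qed
qed

lemma fib_ray: "fib (z - t *\<^sub>R fib z) = (1 - t) *\<^sub>R fib z" "fib (z - t *\<^sub>R fib z) \<bullet> (z - t *\<^sub>R fib z) = (1 - t)\<^sup>2 * (fib z \<bullet> z)"
proof -
  show 1: "fib (z - t *\<^sub>R fib z) = (1 - t) *\<^sub>R fib z" for z t by (simp add: fib_diff fib_scale algebra_simps)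
  show "fib (z - t *\<^sub>R fib z) \<bullet> (z - t *\<^sub>R fib z) = (1 - t)\<^sup>2 * (fib z \<bullet> z)"
    unfolding 1[of z t] by (simp add: inner_diff_right inner_fib fib_diff fib_scale power2_eq_square algebra_simps)
qed

lemma ray_in_tube: "fib z \<bullet> z = 1 \<Longrightarrow> 0 \<le> t \<Longrightarrow> t \<le> 2 \<Longrightarrow> z - t *\<^sub>R fib z \<in> tube"
  by (simp add: tube_def fib_ray(2) abs_square_le_1)

lemma proj_in_bdry: "proj z \<in> bdry Mfd \<longleftrightarrow> fib z \<bullet> z = 1"
proof
  assume "proj z \<in> bdry Mfd"
  then obtain w where "fib w \<bullet> w = 1" "proj z = proj w" unfolding bdry_bundle by blast
  then show "fib z \<bullet> z = 1" by (metis fib_proj_inner)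
qed (auto simp: bdry_bundle)

lemma bdryD: "q \<in> bdry Mfd \<Longrightarrow> proj q = q \<and> fib q \<bullet> q = 1 \<and> q \<in> tube"
  unfolding bdry_bundle by (auto simp: fib_proj_inner tube_def)

lemma free_boundary_geodesic_ray:
  assumes "q \<in> bdry Mfd"
  shows "free_boundary_geodesic Mfd 2 (\<lambda>t. proj (q - t *\<^sub>R fib q))"
proof -
  have q: "proj q = q" "fib q \<bullet> q = 1" "q \<in> tube" using bdryD[OF assms] by auto
  have tube: "q + s *\<^sub>R (- fib q) \<in> tube" if "s \<in> {0..2}" for s using ray_in_tube[OF q(2), of s] that by simp
  note line = line_geodesic[of 0 2 q "- fib q" "\<lambda>t. proj (q - t *\<^sub>R fib q)", OF _ tube]
    line_velocity[of 0 2 q "- fib q" "\<lambda>t. proj (q - t *\<^sub>R fib q)", OF _ tube]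
  show ?thesis
    unfolding free_boundary_geodesic_def
  proof (intro conjI ballI impI allI)
    show "geodesic_on Mfd {0..2} (\<lambda>t. proj (q - t *\<^sub>R fib q))" by (rule line) auto
    show "proj (q - 0 *\<^sub>R fib q) \<in> bdry Mfd" "proj (q - 2 *\<^sub>R fib q) \<in> bdry Mfd"
      using q(2) fib_ray(2)[of q 2] by (simp_all add: proj_in_bdry)
    show "proj (q - t *\<^sub>R fib q) \<notin> bdry Mfd" if "0 < t \<and> t < 2" for t
    proof -
      have "\<bar>1 - t\<bar> < 1" using that by linarith
      then have "(1 - t)\<^sup>2 < 1" by (simp add: abs_square_less_1)
      then show ?thesis by (simp add: proj_in_bdry fib_ray(2) q(2))
    qed
    fix c assume c: "c \<in> atlas Mfd"
    show "unit_inward_normal Mfd c (snd c (proj (q - 0 *\<^sub>R fib q)))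
        (velocity {0..2} (\<lambda>t. proj (q - t *\<^sub>R fib q)) c 0)" if "proj (q - 0 *\<^sub>R fib q) \<in> fst c"
      using line(2)[of 0 c] that c normal_tmap(2)[OF c _ q(2)] by simp
    show "normal_to_bdry Mfd c (snd c (proj (q - 2 *\<^sub>R fib q)))
        (velocity {0..2} (\<lambda>t. proj (q - t *\<^sub>R fib q)) c 2)" if that: "proj (q - 2 *\<^sub>R fib q) \<in> fst c"
    proof -
      have 1: "fib (q - 2 *\<^sub>R fib q) \<bullet> (q - 2 *\<^sub>R fib q) = 1" by (simp add: fib_ray(2) q(2))
      have 2: "fib (q - 2 *\<^sub>R fib q) = - fib q" by (simp add: fib_ray(1))
      show ?thesis using line(2)[of 2 c] that c normal_tmap(1)[OF c that 1, of 1] 2 by simp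
    qed
  qed simp
qed

lemma zoll_bundle: "2 \<le> CARD('n) \<Longrightarrow> zoll_manifold_with_boundary Mfd"
  unfolding zoll_manifold_with_boundary_def
proof (intro conjI ballI)
  fix q assume "q \<in> bdry Mfd"
  from free_boundary_geodesic_ray[OF this] show "\<exists>R \<gamma>. free_boundary_geodesic Mfd R \<gamma> \<and> \<gamma> 0 = q"
    using bdryD[OF \<open>q \<in> bdry Mfd\<close>] by (intro exI[of _ 2] exI[of _ "\<lambda>t. proj (q - t *\<^sub>R fib q)"]) simp
qed (simp_all add: compact_bundle)

text \<open>The geodesic agrees with the diameter \<open>\<zeta>\<close> near \<open>0\<close> because the inward unit normal is determined. The
  set of times near which both agree is closed as well as open: at a limit time both are locally
  projections of straight lines through the same point, and they share a second nearby point. Hence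
  they agree up to the smaller one of the times \<open>R\<close> and 2, at which they return to the boundary, and
  so these times are equal.\<close>

lemma free_boundary_geodesic_unique:
  assumes "free_boundary_geodesic Mfd R \<gamma>"
  shows "R = 2" "\<gamma> 0 \<in> bdry Mfd" "\<And>t. t \<in> {0..2} \<Longrightarrow> \<gamma> t = proj (\<gamma> 0 - t *\<^sub>R fib (\<gamma> 0))"
proof -
  define q where "q = \<gamma> 0"
  have R: "0 < R" "geodesic_on Mfd {0..R} \<gamma>" "q \<in> bdry Mfd" "\<gamma> R \<in> bdry Mfd"
    "\<And>t. 0 < t \<Longrightarrow> t < R \<Longrightarrow> \<gamma> t \<notin> bdry Mfd"
    "\<And>c. c \<in> atlas Mfd \<Longrightarrow> q \<in> fst c \<Longrightarrow> unit_inward_normal Mfd c (snd c q) (velocity {0..R} \<gamma> c 0)"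
    using assms unfolding free_boundary_geodesic_def q_def by auto
  have q: "proj q = q" "fib q \<bullet> q = 1" "q \<in> tube" using bdryD[OF R(3)] by auto
  define \<zeta> where "\<zeta> = (\<lambda>t::real. q - t *\<^sub>R fib q)"
  \<comment> \<open>After time 2 the line leaves the tube.\<close>
  define L where "L = min R 2"
  have L: "0 < L" "L \<le> R" "L \<le> 2" using R(1) by (auto simp: L_def)
  have \<zeta>t: "\<zeta> t \<in> tube" if "t \<in> {0..L}" for t using ray_in_tube[OF q(2), of t] that L by (simp add: \<zeta>_def)
  define E where "E = {t \<in> {0..L}. \<gamma> t = proj (\<zeta> t)}"
  define D where "D = {t \<in> {0..L}. \<exists>r>0. \<forall>s\<in>{0..L}. dist s t < r \<longrightarrow> s \<in> E}"
  have DE: "D \<subseteq> E" by (auto simp: D_def)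
  have cont: "continuous_map (top_of_set {0..R}) quot \<gamma>" using R(2) by (simp add: geodesic_on_def)
  have "closedin (top_of_set {0..L}) E"
  proof -
    have "continuous_map (top_of_set {0..R}) euclidean (sep \<circ> \<gamma>)"
      by (rule continuous_map_compose[OF cont continuous_map_sep])
    then have "continuous_on {0..L} (\<lambda>t. sep (\<gamma> t))"
      using continuous_on_subset[of "{0..R}" _ "{0..L}"] L by (simp add: comp_def)
    moreover have "continuous_on {0..L} (\<lambda>t. sep (\<zeta> t))"
    proof -
      have "continuous_map (top_of_set {0..L}) (top_of_set tube) \<zeta>"
        by (rule continuous_map_into_subtopology) (use \<zeta>t in \<open>auto simp: \<zeta>_def intro!: continuous_intros\<close>)
      from continuous_map_compose[OF continuous_map_compose[OF this continuous_map_proj] continuous_map_sep]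
      show ?thesis by (simp add: comp_def sep_proj)
    qed
    ultimately have "continuous_on {0..L} (\<lambda>t. sep (\<gamma> t) - sep (\<zeta> t))" by (rule continuous_on_diff)
    then have "closedin (top_of_set {0..L}) {t \<in> {0..L}. sep (\<gamma> t) - sep (\<zeta> t) = 0}"
      by (rule continuous_closedin_preimage_constant)
    moreover have "sep (\<gamma> t) - sep (\<zeta> t) = 0 \<longleftrightarrow> \<gamma> t = proj (\<zeta> t)" if "t \<in> {0..L}" for t
    proof -
      have "\<gamma> t \<in> proj ` tube"
        using continuous_map_image_subset_topspace[OF cont] that L by (auto simp: topspace_quot)
      moreover have "proj (\<zeta> t) \<in> proj ` tube" using \<zeta>t[OF that] by simp
      ultimately show ?thesis using inj_on_eq_iff[OF inj_on_sep, of "\<gamma> t" "proj (\<zeta> t)"] by (simp add: sep_proj)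
    qed
    ultimately show ?thesis by (simp add: E_def cong: conj_cong)
  qed
  have local: "\<exists>r>0. \<exists>w. \<forall>t\<in>{0..L}. dist t T < r \<longrightarrow> \<gamma> t = proj (\<zeta> T + (t - T) *\<^sub>R w)"
    "T = 0 \<Longrightarrow> \<exists>r>0. \<forall>t\<in>{0..L}. dist t T < r \<longrightarrow> \<gamma> t = proj (\<zeta> t)"
    if "T \<in> E" for T
  proof -
    have T: "T \<in> {0..L}" "\<gamma> T = proj (\<zeta> T)" using that by (auto simp: E_def)
    obtain p k z where k: "k \<in> Iso" "z \<in> patch_set p" "k z = \<zeta> T" using atlas_covers[OF \<zeta>t[OF T(1)]] by blast
    have "T \<in> {0..R}" "\<gamma> T = proj (k z)" using T L k by auto
    from geodesic_locally_line[OF R(1,2) this(1) k(1,2) this(2)]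
    obtain r w where r: "0 < r" "velocity {0..R} \<gamma> (chart p k) T = dfwd p z w"
      "\<And>t. t \<in> {0..R} \<Longrightarrow> \<bar>t - T\<bar> < r \<Longrightarrow> \<gamma> t = proj (k z + (t - T) *\<^sub>R lin k w)" by blast
    then show "\<exists>r>0. \<exists>w. \<forall>t\<in>{0..L}. dist t T < r \<longrightarrow> \<gamma> t = proj (\<zeta> T + (t - T) *\<^sub>R w)"
      using L k(3) by (intro exI[of _ r] conjI exI[of _ "lin k w"]) (auto simp: dist_real_def)
    assume "T = 0"
    then have kz: "k z = q" using k(3) by (simp add: \<zeta>_def)
    then have "fib z \<bullet> z = 1" using q(2) fib_iso_inner[OF k(1)] by metis
    moreover have qk: "q = proj (k z)" using kz q(1) by simp
    moreover have "q \<in> fst (chart p k)" unfolding fst_chart using qk k(2) by (rule image_eqI)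
    moreover have "chart p k \<in> atlas Mfd" using k(1) by auto
    ultimately have "w = - fib z"
      using R(6)[of "chart p k"] r(2) \<open>T = 0\<close> chart_apply[OF k(1,2)] unit_inward_normal_bundle[OF k(2)] by metis
    then have "lin k w = - fib q"
      using kz linear_neg[OF linear_lin[OF k(1)], of "fib z"] by (simp add: lin_fib[OF k(1)] fib_iso[OF k(1), symmetric])
    then show "\<exists>r>0. \<forall>t\<in>{0..L}. dist t T < r \<longrightarrow> \<gamma> t = proj (\<zeta> t)"
      using r(1,3) L kz \<open>T = 0\<close> by (intro exI[of _ r]) (auto simp: dist_real_def \<zeta>_def)
  qed
  have "0 \<in> E" using L q by (simp add: E_def \<zeta>_def q_def[symmetric])
  then have "0 \<in> D" using local(2)[of 0] L unfolding D_def E_def by auto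
  moreover have "openin (top_of_set {0..L}) D"
    unfolding openin_euclidean_subtopology_iff
  proof (intro conjI ballI)
    fix t assume "t \<in> D"
    then obtain r where r: "0 < r" "\<And>s. s \<in> {0..L} \<Longrightarrow> dist s t < r \<Longrightarrow> s \<in> E" by (auto simp: D_def)
    have "s \<in> D" if "s \<in> {0..L}" "dist s t < r / 2" for s
    proof -
      have "u \<in> E" if "u \<in> {0..L}" "dist u s < r / 2" for u
      proof -
        have "dist u t < r" using that(2) \<open>dist s t < r / 2\<close> dist_triangle[of u t s] by linarith
        then show ?thesis by (rule r(2)[OF that(1)])
      qed
      then show ?thesis using that(1) r(1) unfolding D_def by (auto intro!: exI[of _ "r / 2"])
    qed
    then show "\<exists>e>0. \<forall>x'\<in>{0..L}. dist x' t < e \<longrightarrow> x' \<in> D" using r(1) by (intro exI[of _ "r / 2"]) auto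
  qed (auto simp: D_def)
  moreover have "closedin (top_of_set {0..L}) D"
    unfolding closedin_limpt
  proof (intro conjI allI impI)
    fix T assume T: "T islimpt D \<and> T \<in> {0..L}"
    then have "T islimpt E" using DE islimpt_subset by blast
    then have "T \<in> E" using T \<open>closedin (top_of_set {0..L}) E\<close> unfolding closedin_limpt by blast
    then obtain r w where r: "0 < r" "\<And>t. t \<in> {0..L} \<Longrightarrow> dist t T < r \<Longrightarrow> \<gamma> t = proj (\<zeta> T + (t - T) *\<^sub>R w)"
      using local(1) by blast
    \<comment> \<open>Points of the two lines at distance less than 1 with the same image in the quotient are equal.\<close>
    define M where "M = norm (w + fib q) + 1"
    have M: "0 < M" unfolding M_def by (simp add: add_nonneg_pos)
    obtain t where t: "t \<in> E" "t \<noteq> T" "dist t T < min r (1 / M)"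
      using \<open>T islimpt E\<close> r(1) M unfolding islimpt_approachable by (metis min_less_iff_conj zero_less_divide_1_iff)
    have td: "t \<in> {0..L}" "\<gamma> t = proj (\<zeta> t)" using t by (auto simp: E_def)
    have dif: "(\<zeta> T + (t - T) *\<^sub>R w) - \<zeta> t = (t - T) *\<^sub>R (w + fib q)" by (simp add: \<zeta>_def algebra_simps)
    have "norm ((t - T) *\<^sub>R (w + fib q)) \<le> \<bar>t - T\<bar> * M" by (simp add: M_def mult_left_mono)
    also have "\<dots> < 1" using t(3) M by (simp add: dist_real_def field_simps)
    finally have lt1: "norm ((t - T) *\<^sub>R (w + fib q)) < 1" .
    have near: "\<bar>(\<zeta> T + (t - T) *\<^sub>R w) $ i - \<zeta> t $ i\<bar> < 1" for i
      unfolding vector_minus_component[symmetric] dif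
      by (rule le_less_trans[OF component_le_norm_cart lt1])
    have "\<gamma> t = proj (\<zeta> T + (t - T) *\<^sub>R w)" by (rule r(2)[OF td(1)]) (use t(3) in simp)
    then have "proj (\<zeta> T + (t - T) *\<^sub>R w) = proj (\<zeta> t)" using td(2) by metis
    from proj_separated[OF this near] have "\<zeta> T + (t - T) *\<^sub>R w = \<zeta> t" .
    then have "w = - fib q" using dif t(2) by (simp add: add_eq_0_iff2)
    then have "\<zeta> T + (s - T) *\<^sub>R w = \<zeta> s" for s by (simp add: \<zeta>_def algebra_simps)
    then show "T \<in> D" using r T unfolding D_def E_def by (auto intro!: exI[of _ r])
  qed (auto simp: D_def)
  ultimately have "D = {0..L}" using connected_clopen[of "{0..L}"] connected_Icc by blast
  then have on: "\<gamma> t = proj (\<zeta> t)" if "t \<in> {0..L}" for t using that DE by (auto simp: E_def)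
  have "\<not> R < 2"
  proof
    assume "R < 2"
    then have "\<gamma> R = proj (\<zeta> R)" using on[of R] R(1) by (simp add: L_def)
    then have "(1 - R)\<^sup>2 = 1" using R(4) by (simp add: proj_in_bdry \<zeta>_def fib_ray(2) q(2))
    then show False using R(1) \<open>R < 2\<close> by (simp add: power2_eq_1_iff)
  qed
  moreover have "\<not> 2 < R"
  proof
    assume "2 < R"
    then have "\<gamma> 2 = proj (\<zeta> 2)" using on[of 2] by (simp add: L_def)
    then have "\<gamma> 2 \<in> bdry Mfd" by (simp add: proj_in_bdry \<zeta>_def fib_ray(2) q(2))
    then show False using R(5)[of 2] \<open>2 < R\<close> by simp
  qed
  ultimately show "R = 2" by simp
  then show "\<gamma> t = proj (\<gamma> 0 - t *\<^sub>R fib (\<gamma> 0))" if "t \<in> {0..2}" for t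
    using on[of t] that by (simp add: L_def \<zeta>_def q_def)
  show "\<gamma> 0 \<in> bdry Mfd" using R(3) by (simp add: q_def)
qed

section \<open>Vector fields along a free boundary geodesic\<close>

text \<open>The lift to the tube of a free boundary geodesic, reparametrized by \<open>[0,1]\<close>, is \<open>ray q\<close>. A field along
  the geodesic is described by its developed version, which takes values in \<open>\<real>\<^sup>n\<close>; at each time it is
  computed in the chart that \<open>index_form\<close> uses, but by \<open>field_developed\<close> any other chart gives the
  same value. The fields \<open>parallel q u\<close> are those whose developed version is constant.\<close>

definition ray :: "real^'n \<Rightarrow> real \<Rightarrow> real^'n" where
  "ray q t = q + t *\<^sub>R (- 2 *\<^sub>R fib q)"

definition developed :: "real^'n \<Rightarrow> (real^'n, 'n) field \<Rightarrow> real \<Rightarrow> real^'n" where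
  "developed q V t = inv (tmap (chart_at Mfd (proj (ray q t))) (ray q t)) (V (chart_at Mfd (proj (ray q t))) t)"

definition parallel :: "real^'n \<Rightarrow> real^'n \<Rightarrow> (real^'n, 'n) field" where
  "parallel q u = (\<lambda>c t. if c \<in> atlas Mfd \<and> t \<in> {0..1} \<and> proj (ray q t) \<in> fst c then tmap c (ray q t) u else 0)"

lemma fib_ray_eq: "fib (ray q t) = (1 - 2 * t) *\<^sub>R fib q"
  by (simp add: ray_def fib_add fib_scale fib_diff fib_minus algebra_simps)

lemma ray_eq: "ray q t = (1 - 2 * t) *\<^sub>R fib q + (q - fib q)"
  by (simp add: ray_def algebra_simps)

context
  fixes q :: "real^'n" and \<sigma> :: "real \<Rightarrow> real^'n"
  assumes q: "fib q \<bullet> q = 1" and \<sigma>: "\<And>t. t \<in> {0..1} \<Longrightarrow> \<sigma> t = proj (ray q t)"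
begin

lemma fib_q: "fib q \<bullet> fib q = 1" "norm (fib q) = 1"
  using q by (simp_all add: inner_fib norm_eq_sqrt_inner)

lemma ray_inner: "fib (ray q t) \<bullet> ray q t = (1 - 2 * t)\<^sup>2"
proof -
  have "fib (ray q t) \<bullet> ray q t = fib (ray q t) \<bullet> fib (ray q t)" by (simp add: inner_fib)
  then show ?thesis by (simp add: fib_ray_eq fib_q power2_eq_square)
qed

lemma ray_tube: "t \<in> {0..1} \<Longrightarrow> ray q t \<in> tube"
  by (auto simp: tube_def ray_inner abs_square_le_1 abs_le_iff)

lemma chart_at_ray:
  assumes "t \<in> {0..1}"
  shows "chart_at Mfd (proj (ray q t)) \<in> atlas Mfd" "proj (ray q t) \<in> fst (chart_at Mfd (proj (ray q t)))"
proof -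
  obtain p k w where k: "k \<in> Iso" "w \<in> patch_set p" "k w = ray q t" using atlas_covers[OF ray_tube[OF assms]] by blast
  have "proj (ray q t) \<in> fst (chart p k)" unfolding fst_chart using k by (intro image_eqI[of _ _ w]) auto
  then have "\<exists>c. c \<in> atlas Mfd \<and> proj (ray q t) \<in> fst c" using k(1) by (intro exI[of _ "chart p k"]) auto
  from someI_ex[OF this] show "chart_at Mfd (proj (ray q t)) \<in> atlas Mfd"
    "proj (ray q t) \<in> fst (chart_at Mfd (proj (ray q t)))" by (auto simp: chart_at_def)
qed

lemma tmap_inv:
  assumes "c \<in> atlas Mfd" "proj z \<in> fst c"
  shows "tmap c z (inv (tmap c z) v) = v" "inv (tmap c z) (tmap c z v) = v"
  using bij_tmap[OF assms] by (simp_all add: bij_is_inj bij_is_surj surj_f_inv_f)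

lemma field_developed:
  assumes V: "field_along Mfd \<sigma> V" and t: "t \<in> {0..1}" and c: "c \<in> atlas Mfd" "proj (ray q t) \<in> fst c"
  shows "V c t = tmap c (ray q t) (developed q V t)"
proof -
  let ?d = "chart_at Mfd (proj (ray q t))"
  note d = chart_at_ray[OF t]
  have "V c t = deriv_half (transition ?d c) (snd ?d (proj (ray q t))) (V ?d t)"
    using V t c d unfolding field_along_def \<sigma>[OF t, symmetric] by blast
  also have "V ?d t = tmap ?d (ray q t) (developed q V t)"
    by (simp only: developed_def tmap_inv[OF d])
  also have "deriv_half (transition ?d c) (snd ?d (proj (ray q t))) \<dots> = tmap c (ray q t) (developed q V t)"
    by (rule tmap_change[OF d c])
  finally show ?thesis .
qed

lemma developed_linear:
  assumes "t \<in> {0..1}"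
  shows "developed q (V + W) t = developed q V t + developed q W t"
    "developed q (field_scale r V) t = r *\<^sub>R developed q V t"
proof -
  note d = chart_at_ray[OF assms]
  let ?d = "chart_at Mfd (proj (ray q t))"
  have "linear (inv (tmap ?d (ray q t)))"
    using inj_linear_imp_inv_linear[OF linear_tmap[OF d]] bij_tmap[OF d] by (simp add: bij_is_inj)
  then show "developed q (V + W) t = developed q V t + developed q W t"
    "developed q (field_scale r V) t = r *\<^sub>R developed q V t"
    by (simp_all add: developed_def field_scale_def linear_add linear_scale)
qed

lemma ray_line:
  "\<And>s. s \<in> {0..1} \<Longrightarrow> q + s *\<^sub>R (- 2 *\<^sub>R fib q) \<in> tube"
  "\<And>s. s \<in> {0..1} \<Longrightarrow> \<sigma> s = proj (q + s *\<^sub>R (- 2 *\<^sub>R fib q))"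
  using ray_tube \<sigma> by (simp_all add: ray_def)

lemma velocity_ray:
  assumes "t \<in> {0..1}" "c \<in> atlas Mfd" "proj (ray q t) \<in> fst c"
  shows "velocity {0..1} \<sigma> c t = tmap c (ray q t) (- 2 *\<^sub>R fib q)"
  using line_velocity[of 0 1 q "- 2 *\<^sub>R fib q" \<sigma>, OF _ ray_line(1) ray_line(2) assms(1,2)] assms(3) \<sigma>[OF assms(1)]
  by (simp add: ray_def)

lemma parallel_derivative:
  assumes "t \<in> {0..1}" "c \<in> atlas Mfd" "proj (ray q t) \<in> fst c"
  shows "((\<lambda>s. tmap c (ray q s) u) has_vector_derivative
      - christoffel Mfd c (snd c (\<sigma> t)) (velocity {0..1} \<sigma> c t) (tmap c (ray q t) u)) (at t within {0..1})"
  using line_has_vector_derivative(2)[of 0 1 q "- 2 *\<^sub>R fib q" \<sigma>, OF _ ray_line(1) ray_line(2) assms(1,2)] assms(3) \<sigma>[OF assms(1)]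
  unfolding velocity_ray[OF assms] by (simp add: ray_def)

text \<open>The two boundary terms have the same sign because the velocity is 2 times the inward unit normal at
  time \<open>0\<close> and 2 times the outward one at time \<open>1\<close>.\<close>

lemma index_form_developed:
  assumes V: "field_along Mfd \<sigma> V" "field_along Mfd \<sigma> (cov_deriv Mfd \<sigma> V)"
  shows "index_form Mfd \<sigma> V V =
    integral {0..1} (\<lambda>t. developed q (cov_deriv Mfd \<sigma> V) t \<bullet> developed q (cov_deriv Mfd \<sigma> V) t)
      - 2 * (fib (developed q V 0) \<bullet> developed q V 0) - 2 * (fib (developed q V 1) \<bullet> developed q V 1)"
proof -
  define W where "W = cov_deriv Mfd \<sigma> V"
  define c where "c t = chart_at Mfd (\<sigma> t)" for t
  have c: "c t \<in> atlas Mfd" "proj (ray q t) \<in> fst (c t)" if "t \<in> {0..1}" for t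
    using chart_at_ray[OF that] \<sigma>[OF that] by (simp_all add: c_def)
  have Vc: "V (c t) t = tmap (c t) (ray q t) (developed q V t)"
    and Wc: "W (c t) t = tmap (c t) (ray q t) (developed q W t)" if "t \<in> {0..1}" for t
    using field_developed[OF V(1) that c[OF that]] field_developed[OF V(2) that c[OF that]] by (simp_all add: W_def)
  have curv: "curvature Mfd (c t) (snd (c t) (\<sigma> t)) u v w = 0" if t: "t \<in> {0..1}" for t u v w
  proof -
    obtain p k g where "lifts (c t) (ray q t) p k g" using lifts_exists[OF c[OF t]] by blast
    from liftsD(10,11)[OF this] show ?thesis by (simp add: curvature_bundle \<sigma>[OF t])
  qed
  have I: "integral {0..1} (\<lambda>t.
           metric Mfd (c t) (snd (c t) (\<sigma> t)) (W (c t) t) (W (c t) t)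
           + metric Mfd (c t) (snd (c t) (\<sigma> t)) (curvature Mfd (c t) (snd (c t) (\<sigma> t))
               (velocity {0..1} \<sigma> (c t) t) (V (c t) t) (velocity {0..1} \<sigma> (c t) t)) (V (c t) t))
      = integral {0..1} (\<lambda>t. developed q W t \<bullet> developed q W t)"
  proof (rule integral_cong)
    fix t :: real assume t: "t \<in> {0..1}"
    have "met x 0 v = 0" for x v using met_linear(3)[of x 0 0 v] by simp
    then show "metric Mfd (c t) (snd (c t) (\<sigma> t)) (W (c t) t) (W (c t) t)
           + metric Mfd (c t) (snd (c t) (\<sigma> t)) (curvature Mfd (c t) (snd (c t) (\<sigma> t))
               (velocity {0..1} \<sigma> (c t) t) (V (c t) t) (velocity {0..1} \<sigma> (c t) t)) (V (c t) t)
        = developed q W t \<bullet> developed q W t"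
      unfolding curv[OF t] Wc[OF t] by (simp add: \<sigma>[OF t] met_tmap[OF c[OF t]])
  qed
  have S: "second_fundamental_form Mfd (c t) (snd (c t) (\<sigma> t)) (velocity {0..1} \<sigma> (c t) t) (V (c t) t) (V (c t) t)
      = - r * (fib (developed q V t) \<bullet> developed q V t)"
    if t: "t \<in> {0..1}" and r: "- 2 *\<^sub>R fib q = r *\<^sub>R fib (ray q t)" "(1 - 2 * t)\<^sup>2 = 1" for t r
    unfolding Vc[OF t] velocity_ray[OF t c[OF t]] r \<sigma>[OF t]
    by (rule second_fundamental_form_tmap[OF c[OF t]]) (simp add: ray_inner r)
  show ?thesis
    using S[of 0 "- 2"] S[of 1 2] I
    unfolding index_form_def Let_def c_def W_def[symmetric] by (simp add: fib_ray_eq)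
qed

text \<open>The interior of the geodesic lies in one core chart, in which developed fields are the coordinate
  expressions. Each half lies in a collar chart in which it runs along the axis; the sign \<open>s\<close> tells
  which half, and \<open>s (1 - 2 t)\<close> is the distance from the central fibre.\<close>

lemma core_chart:
  obtains c where "\<And>t. 0 < t \<Longrightarrow> t < 1 \<Longrightarrow> proj (ray q t) \<in> fst c" "c \<in> atlas Mfd"
    "\<And>t u. 0 < t \<Longrightarrow> t < 1 \<Longrightarrow> tmap c (ray q t) u = u"
    "\<And>t u v. 0 < t \<Longrightarrow> t < 1 \<Longrightarrow> christoffel Mfd c (snd c (proj (ray q t))) u v = 0"
proof -
  define k where "k = (\<lambda>w. w + (q - fib q))"
  define g where "g = (\<lambda>w. w + - (q - fib q))"
  have f0: "fib (q - fib q) = 0" "fib (- (q - fib q)) = 0" by (simp_all add: fib_diff fib_minus)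
  note kg = translation_iso[OF f0(1), folded k_def] translation_iso[OF f0(2), folded g_def]
  have l: "lifts (chart Core k) (ray q t) Core k g" if "0 < t" "t < 1" for t
  proof -
    have gr: "g (ray q t) = fib (ray q t)" unfolding fib_ray_eq by (simp add: g_def ray_eq)
    have "\<bar>1 - 2 * t\<bar> < 1" using that by linarith
    then have "fib (ray q t) \<bullet> ray q t < 1" by (simp add: ray_inner abs_square_less_1)
    then show ?thesis
      unfolding lifts_def gr using kg patch_set_core by (simp add: k_def g_def)
  qed
  show thesis
  proof (rule that)
    fix t :: real and u v assume t: "0 < t" "t < 1"
    note l = l[OF t]
    show "proj (ray q t) \<in> fst (chart Core k)" by (rule liftsD(7)[OF l])
    show "tmap (chart Core k) (ray q t) u = u" by (simp add: tmap_eq[OF l] kg)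
    have "\<not> snd (chart Core k) (proj (ray q t)) $ nc < 1"
      using coord_region_nc(1)[OF liftsD(11)[OF l]] by simp
    then show "christoffel Mfd (chart Core k) (snd (chart Core k) (proj (ray q t))) u v = 0"
      by (simp add: christoffel_bundle[OF liftsD(10,11)[OF l]] chris_def)
  next
    show "chart Core k \<in> atlas Mfd" using kg by auto
  qed
qed

lemma collar_chart:
  assumes s: "s = 1 \<or> s = - 1"
  obtains c T where "c \<in> atlas Mfd" "linear T" "\<And>u v. T u \<bullet> T v = u \<bullet> v" "\<And>u. T u $ nc = s * (fib q \<bullet> u)"
    "\<And>t. 0 < s * (1 - 2 * t) \<Longrightarrow> s * (1 - 2 * t) \<le> 1 \<Longrightarrow> proj (ray q t) \<in> fst c"
    "\<And>t u. 0 < s * (1 - 2 * t) \<Longrightarrow> s * (1 - 2 * t) \<le> 1 \<Longrightarrow>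
       tmap c (ray q t) u = T u + (- 2 * (s * (1 - 2 * t)) * T u $ nc - T u $ nc) *\<^sub>R e"
proof -
  have ss: "s * s = 1" using s by auto
  have "fib (s *\<^sub>R fib q) = s *\<^sub>R fib q" "norm (s *\<^sub>R fib q) = 1" "fib (q - fib q) = 0"
    using s fib_q by (auto simp: fib_scale fib_diff fib_minus)
  then obtain k where k: "k \<in> Iso" "lin k e = s *\<^sub>R fib q" "\<And>z. k z = lin k z + (q - fib q)"
    using iso_moving by metis
  note ik = iso_inverse[OF k(1)]
  have "k ((s * (1 - 2 * t)) *\<^sub>R e) = ray q t" for t
    using ss by (subst k(3)) (simp add: linear_scale[OF linear_lin[OF k(1)]] k(2) ray_eq mult.commute mult.left_commute)
  then have ir: "inv k (ray q t) = (s * (1 - 2 * t)) *\<^sub>R e" for t using ik(2) by metis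
  have l: "lifts (chart Collar k) (ray q t) Collar k (inv k)" if "0 < s * (1 - 2 * t)" "s * (1 - 2 * t) \<le> 1" for t
    unfolding lifts_def ir using that k(1) ik patch_set_collar by simp
  define T where "T = lin (inv k)"
  have Tnc: "T u $ nc = s * (fib q \<bullet> u)" for u
  proof -
    have "T u $ nc = T u \<bullet> T (lin k e)" by (simp add: T_def lin_inv[OF k(1)] inner_e)
    also have "\<dots> = u \<bullet> lin k e" by (simp add: T_def lin_inner[OF ik(1)])
    finally show ?thesis by (simp add: k(2) inner_commute)
  qed
  show thesis
  proof (rule that)
    show "chart Collar k \<in> atlas Mfd" using k(1) by auto
    show "linear T" unfolding T_def by (rule linear_lin[OF ik(1)])
    show "T u \<bullet> T v = u \<bullet> v" for u v unfolding T_def by (rule lin_inner[OF ik(1)])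
    show "T u $ nc = s * (fib q \<bullet> u)" for u by (rule Tnc)
    fix t assume t: "0 < s * (1 - 2 * t)" "s * (1 - 2 * t) \<le> 1"
    show "proj (ray q t) \<in> fst (chart Collar k)" by (rule liftsD(7)[OF l[OF t]])
    show "tmap (chart Collar k) (ray q t) u = T u + (- 2 * (s * (1 - 2 * t)) * T u $ nc - T u $ nc) *\<^sub>R e" for u
      by (simp add: tmap_eq[OF l[OF t]] ir T_def[symmetric] fib_scale inner_e del: scaleR_scaleR)
  qed
qed

lemma parallel_along: "field_along Mfd \<sigma> (parallel q u)"
  unfolding field_along_def
proof (intro conjI allI ballI impI)
  fix c t assume "\<not> (c \<in> atlas Mfd \<and> t \<in> {0..1} \<and> \<sigma> t \<in> fst c)"
  then show "parallel q u c t = 0" using \<sigma>[of t] by (auto simp: parallel_def)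
next
  fix c d t assume c: "c \<in> atlas Mfd" "d \<in> atlas Mfd" and t: "t \<in> {0..1}" and "\<sigma> t \<in> fst c \<inter> fst d"
  then have m: "proj (ray q t) \<in> fst c" "proj (ray q t) \<in> fst d" using \<sigma>[OF t] by auto
  have "parallel q u c t = tmap c (ray q t) u" "parallel q u d t = tmap d (ray q t) u"
    using c t m unfolding parallel_def by (simp_all only: if_True simp_thms)
  then show "parallel q u d t = deriv_half (transition c d) (snd c (\<sigma> t)) (parallel q u c t)"
    using tmap_change[OF c(1) m(1) c(2) m(2)] \<sigma>[OF t] by simp
qed

lemma parallel_eq:
  "c \<in> atlas Mfd \<Longrightarrow> t \<in> {0..1} \<Longrightarrow> proj (ray q t) \<in> fst c \<Longrightarrow> parallel q u c t = tmap c (ray q t) u"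
  unfolding parallel_def by (simp only: if_True simp_thms)

lemma weak_cov_deriv_parallel: "weak_cov_deriv Mfd \<sigma> (parallel q u) (\<lambda>c t. 0)"
  unfolding weak_cov_deriv_def
proof (intro conjI ballI allI impI)
  have "parallel q 0 = (\<lambda>c t. 0)"
    unfolding parallel_def fun_eq_iff using linear_0[OF linear_tmap] by auto
  then show "field_along Mfd \<sigma> (\<lambda>c t. 0)" using parallel_along[of 0] by simp
  fix c a b assume c: "c \<in> atlas Mfd" and ab: "0 \<le> a \<and> a \<le> b \<and> b \<le> 1 \<and> \<sigma> ` {a..b} \<subseteq> fst c"
  have t: "t \<in> {0..1}" "proj (ray q t) \<in> fst c" if "t \<in> {a..b}" for t
  proof -
    show t: "t \<in> {0..1}" using ab that by auto
    have "\<sigma> t \<in> fst c" using ab that by blast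
    then show "proj (ray q t) \<in> fst c" using \<sigma>[OF t] by simp
  qed
  show "(\<lambda>t. 0) absolutely_integrable_on {a..b}" "(\<lambda>t. (norm 0)\<^sup>2) integrable_on {a..b}" by auto
  show "((\<lambda>t. 0 - christoffel Mfd c (snd c (\<sigma> t)) (velocity {0..1} \<sigma> c t) (parallel q u c t))
      has_integral parallel q u c b - parallel q u c a) {a..b}"
  proof (rule fundamental_theorem_of_calculus)
    fix s assume s: "s \<in> {a..b}"
    show "(parallel q u c has_vector_derivative
        0 - christoffel Mfd c (snd c (\<sigma> s)) (velocity {0..1} \<sigma> c s) (parallel q u c s)) (at s within {a..b})"
    proof (rule has_vector_derivative_transform[OF s])
      show "parallel q u c r = tmap c (ray q r) u" if "r \<in> {a..b}" for r
        using parallel_eq[OF c t[OF that]] .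
      have "{a..b} \<subseteq> {0..1}" using ab by auto
      then show "((\<lambda>r. tmap c (ray q r) u) has_vector_derivative
          0 - christoffel Mfd c (snd c (\<sigma> s)) (velocity {0..1} \<sigma> c s) (parallel q u c s)) (at s within {a..b})"
        using has_vector_derivative_within_subset[OF parallel_derivative[OF t(1)[OF s] c t(2)[OF s], of u]]
          parallel_eq[OF c t[OF s]] by simp
    qed
  qed (use ab in simp)
qed

lemma parallel_H1:
  assumes "fib q \<bullet> u = 0"
  shows "parallel q u \<in> H1_fields Mfd \<sigma>"
  unfolding H1_fields_def
proof (intro CollectI conjI ballI impI)
  fix c t assume c: "c \<in> atlas Mfd" and t: "t \<in> {0, 1::real}" and "\<sigma> t \<in> fst c"
  then have t1: "t \<in> {0..1}" "proj (ray q t) \<in> fst c" using \<sigma>[of t] by auto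
  have "fib (ray q t) \<bullet> ray q t = 1" using t by (auto simp: ray_inner)
  from normal_tmap(3)[OF c t1(2) this] show "tangent_to_bdry (parallel q u c t)"
    using assms by (simp only: parallel_eq[OF c t1]) (simp add: fib_ray_eq)
qed (use parallel_along weak_cov_deriv_parallel in blast)+

lemma developed_parallel: "t \<in> {0..1} \<Longrightarrow> developed q (parallel q u) t = u"
proof -
  assume t: "t \<in> {0..1}"
  note c = chart_at_ray[OF t]
  show ?thesis unfolding developed_def parallel_eq[OF c(1) t c(2)] by (rule tmap_inv(2)[OF c])
qed

lemma developed_tangent:
  assumes "V \<in> H1_fields Mfd \<sigma>" "t \<in> {0, 1}"
  shows "fib q \<bullet> developed q V t = 0"
proof -
  have t: "t \<in> {0..1}" using assms(2) by auto
  note c = chart_at_ray[OF t]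
  have V: "field_along Mfd \<sigma> V" using assms(1) by (simp add: H1_fields_def)
  have "tangent_to_bdry (V (chart_at Mfd (proj (ray q t))) t)"
  proof -
    have "\<forall>c\<in>atlas Mfd. \<forall>t\<in>{0, 1}. \<sigma> t \<in> fst c \<longrightarrow> tangent_to_bdry (V c t)"
      using assms(1) unfolding H1_fields_def by blast
    then show ?thesis using assms(2) c \<sigma>[OF t] by metis
  qed
  moreover have "fib (ray q t) \<bullet> ray q t = 1" using assms(2) by (auto simp: ray_inner)
  ultimately have "fib (ray q t) \<bullet> developed q V t = 0"
    using normal_tmap(3)[OF c] field_developed[OF V t c] by metis
  then show ?thesis using assms(2) by (auto simp: fib_ray_eq)
qed

context
  fixes V W assumes V: "field_along Mfd \<sigma> V" and W: "weak_cov_deriv Mfd \<sigma> V W"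
begin

lemma W_along: "field_along Mfd \<sigma> W"
  using W by (simp add: weak_cov_deriv_def)

lemma weak_cov_derivD:
  assumes "c \<in> atlas Mfd" "0 \<le> a" "a \<le> b" "b \<le> 1" "\<And>t. t \<in> {a..b} \<Longrightarrow> proj (ray q t) \<in> fst c"
  shows "W c absolutely_integrable_on {a..b}" "(\<lambda>t. (norm (W c t))\<^sup>2) integrable_on {a..b}"
    "((\<lambda>t. W c t - christoffel Mfd c (snd c (\<sigma> t)) (velocity {0..1} \<sigma> c t) (V c t))
           has_integral (V c b - V c a)) {a..b}"
proof -
  have "\<sigma> ` {a..b} \<subseteq> fst c" using assms \<sigma> by auto
  then show "W c absolutely_integrable_on {a..b}" "(\<lambda>t. (norm (W c t))\<^sup>2) integrable_on {a..b}"
    "((\<lambda>t. W c t - christoffel Mfd c (snd c (\<sigma> t)) (velocity {0..1} \<sigma> c t) (V c t))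
           has_integral (V c b - V c a)) {a..b}"
    using W assms(1-4) unfolding weak_cov_deriv_def by blast+
qed

lemma developed_interior:
  assumes "0 < a" "a \<le> b" "b < 1"
  shows "developed q W absolutely_integrable_on {a..b}"
    "(\<lambda>t. developed q W t \<bullet> developed q W t) integrable_on {a..b}"
    "(developed q W has_integral (developed q V b - developed q V a)) {a..b}"
proof -
  obtain c where c: "\<And>t. 0 < t \<Longrightarrow> t < 1 \<Longrightarrow> proj (ray q t) \<in> fst c" "c \<in> atlas Mfd"
    "\<And>t u. 0 < t \<Longrightarrow> t < 1 \<Longrightarrow> tmap c (ray q t) u = u"
    "\<And>t u v. 0 < t \<Longrightarrow> t < 1 \<Longrightarrow> christoffel Mfd c (snd c (proj (ray q t))) u v = 0"
    using core_chart by blast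
  have t: "0 < t" "t < 1" "t \<in> {0..1}" if "t \<in> {a..b}" for t using that assms by auto
  have Vc: "V c t = developed q V t" and Wc: "W c t = developed q W t" if "t \<in> {a..b}" for t
    using field_developed[OF V t(3)[OF that] c(2) c(1)[OF t(1,2)[OF that]]]
      field_developed[OF W_along t(3)[OF that] c(2) c(1)[OF t(1,2)[OF that]]] c(3)[OF t(1,2)[OF that]]
    by simp_all
  have chr: "christoffel Mfd c (snd c (\<sigma> t)) u v = 0" if "t \<in> {a..b}" for t u v
    using c(4)[OF t(1,2)[OF that]] \<sigma>[OF t(3)[OF that]] by simp
  note D = weak_cov_derivD[OF c(2) _ assms(2) _ c(1)[OF t(1,2)]]
  have "W c absolutely_integrable_on {a..b}" by (rule D) (use assms in auto)
  then show "developed q W absolutely_integrable_on {a..b}"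
    using set_integrable_cong[of lebesgue lebesgue "{a..b}" "{a..b}" "W c" "developed q W"] Wc by simp
  have "(\<lambda>t. (norm (W c t))\<^sup>2) integrable_on {a..b}" by (rule D) (use assms in auto)
  then show "(\<lambda>t. developed q W t \<bullet> developed q W t) integrable_on {a..b}"
    by (rule integrable_eq) (simp add: Wc dot_square_norm)
  have "((\<lambda>t. W c t - christoffel Mfd c (snd c (\<sigma> t)) (velocity {0..1} \<sigma> c t) (V c t))
           has_integral (V c b - V c a)) {a..b}" by (rule D) (use assms in auto)
  then have "((\<lambda>t. W c t - christoffel Mfd c (snd c (\<sigma> t)) (velocity {0..1} \<sigma> c t) (V c t))
           has_integral (developed q V b - developed q V a)) {a..b}" using Vc assms by simp
  then show "(developed q W has_integral (developed q V b - developed q V a)) {a..b}"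
    by (rule has_integral_eq[rotated]) (simp add: Wc chr)
qed

text \<open>In a collar chart along the axis only the component in the direction of the geodesic is rescaled by a
  factor that depends on time. The components orthogonal to the geodesic are those of the chart, so
  that they extend continuously to the end point, and no product of a weak derivative with the
  rescaling factor has to be integrated. The energy density differs from the square norm in the chart
  by the factor \<open>1 / (4 \<rho>\<^sup>2) \<le> 1\<close> on the rescaled component.\<close>

lemma developed_end:
  fixes s l r :: real
  assumes lr: "(s = 1 \<and> l = 0 \<and> r = 1/4) \<or> (s = - 1 \<and> l = 3/4 \<and> r = 1)"
  shows "(\<lambda>t. developed q W t \<bullet> developed q W t) integrable_on {l..r}"
    "fib q \<bullet> d = 0 \<Longrightarrow> continuous_on {l..r} (\<lambda>t. d \<bullet> developed q V t)"
proof -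
  have s: "s = 1 \<or> s = - 1" using lr by auto
  define \<rho> where "\<rho> t = s * (1 - 2 * t)" for t
  have \<rho>: "1 / 2 \<le> \<rho> t" "\<rho> t \<le> 1" "0 < s * (1 - 2 * t)" "s * (1 - 2 * t) \<le> 1" "t \<in> {0..1}" if "t \<in> {l..r}" for t
    using lr that by (auto simp: \<rho>_def)
  have lr1: "0 \<le> l" "l \<le> r" "r \<le> 1" using lr by auto
  obtain c T where c: "c \<in> atlas Mfd" "linear T" "\<And>u v. T u \<bullet> T v = u \<bullet> v" "\<And>u. T u $ nc = s * (fib q \<bullet> u)"
    "\<And>t. 0 < s * (1 - 2 * t) \<Longrightarrow> s * (1 - 2 * t) \<le> 1 \<Longrightarrow> proj (ray q t) \<in> fst c"
    "\<And>t u. 0 < s * (1 - 2 * t) \<Longrightarrow> s * (1 - 2 * t) \<le> 1 \<Longrightarrow>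
       tmap c (ray q t) u = T u + (- 2 * (s * (1 - 2 * t)) * T u $ nc - T u $ nc) *\<^sub>R e"
    using collar_chart[OF s] by blast
  have m: "proj (ray q t) \<in> fst c" if "t \<in> {l..r}" for t by (rule c(5)[OF \<rho>(3,4)[OF that]])
  have Vc: "V c t = T (developed q V t) + (- 2 * \<rho> t * T (developed q V t) $ nc - T (developed q V t) $ nc) *\<^sub>R e"
    and Wc: "W c t = T (developed q W t) + (- 2 * \<rho> t * T (developed q W t) $ nc - T (developed q W t) $ nc) *\<^sub>R e"
    if "t \<in> {l..r}" for t
    unfolding \<rho>_def
    using field_developed[OF V \<rho>(5)[OF that] c(1) m[OF that]] c(6)[OF \<rho>(3,4)[OF that]]
      field_developed[OF W_along \<rho>(5)[OF that] c(1) m[OF that]] by metis+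
  note D = weak_cov_derivD[OF c(1) lr1 m]
  have Wm: "W c \<in> borel_measurable (lebesgue_on {l..r})"
    by (rule absolutely_integrable_imp_borel_measurable[OF D(1)]) auto
  have g: "W c t \<bullet> W c t - (W c t \<bullet> e)\<^sup>2 * (1 - 1 / (4 * (\<rho> t)\<^sup>2)) = developed q W t \<bullet> developed q W t" if t: "t \<in> {l..r}" for t
  proof -
    define y where "y = T (developed q W t)"
    have "0 < \<rho> t" using \<rho>(1)[OF t] by linarith
    have W: "W c t = y + (- 2 * \<rho> t * y $ nc - y $ nc) *\<^sub>R e" using Wc[OF t] by (simp add: y_def)
    have We: "W c t \<bullet> e = - 2 * \<rho> t * y $ nc" by (simp add: W inner_add_left inner_e e_nth)
    have "W c t \<bullet> W c t = y \<bullet> y + (W c t \<bullet> e)\<^sup>2 - (y $ nc)\<^sup>2"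
      unfolding We by (simp add: W inner_add_left inner_add_right inner_e e_nth power2_eq_square algebra_simps)
    moreover have "(W c t \<bullet> e)\<^sup>2 * (1 / (4 * (\<rho> t)\<^sup>2)) = (y $ nc)\<^sup>2"
      unfolding We using \<open>0 < \<rho> t\<close> by (simp add: power2_eq_square)
    ultimately show ?thesis using c(3) by (simp add: y_def algebra_simps)
  qed
  have "(\<lambda>t. W c t \<bullet> W c t - (W c t \<bullet> e)\<^sup>2 * (1 - 1 / (4 * (\<rho> t)\<^sup>2))) integrable_on {l..r}"
  proof (rule measurable_bounded_by_integrable_imp_integrable[OF _ D(2)])
    have "\<rho> t \<noteq> 0" if "t \<in> {l..r}" for t using \<rho>(1)[OF that] by auto
    then have "(\<lambda>t. 1 - 1 / (4 * (\<rho> t)\<^sup>2)) \<in> borel_measurable (lebesgue_on {l..r})"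
      by (intro continuous_imp_measurable_on_sets_lebesgue) (auto simp: \<rho>_def intro!: continuous_intros)
    with Wm show "(\<lambda>t. W c t \<bullet> W c t - (W c t \<bullet> e)\<^sup>2 * (1 - 1 / (4 * (\<rho> t)\<^sup>2))) \<in> borel_measurable (lebesgue_on {l..r})"
      by (intro borel_measurable_diff[OF borel_measurable_inner borel_measurable_times] borel_measurable_inner
          borel_measurable_power borel_measurable_const)
    fix t assume t: "t \<in> {l..r}"
    have "1 / 4 \<le> (\<rho> t)\<^sup>2" using power_mono[OF \<rho>(1)[OF t], of 2] by (simp add: power2_eq_square)
    then have "1 / (4 * (\<rho> t)\<^sup>2) \<le> 1" by (intro divide_le_eq_1[THEN iffD2]) auto
    then have "0 \<le> 1 - 1 / (4 * (\<rho> t)\<^sup>2)" by simp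
    then have "0 \<le> (W c t \<bullet> e)\<^sup>2 * (1 - 1 / (4 * (\<rho> t)\<^sup>2))" by simp
    moreover have "norm (W c t \<bullet> W c t - (W c t \<bullet> e)\<^sup>2 * (1 - 1 / (4 * (\<rho> t)\<^sup>2))) = developed q W t \<bullet> developed q W t"
      unfolding g[OF t] by simp
    ultimately show "norm (W c t \<bullet> W c t - (W c t \<bullet> e)\<^sup>2 * (1 - 1 / (4 * (\<rho> t)\<^sup>2))) \<le> (norm (W c t))\<^sup>2"
      using g[OF t] unfolding power2_norm_eq_inner by linarith
  qed auto
  then show "(\<lambda>t. developed q W t \<bullet> developed q W t) integrable_on {l..r}"
    by (rule integrable_eq) (rule g)
  assume d: "fib q \<bullet> d = 0"
  have dV: "d \<bullet> developed q V t = T d \<bullet> V c t" if "t \<in> {l..r}" for t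
    unfolding Vc[OF that] using c(3,4) d by (simp add: inner_add_right inner_e)
  define f where "f t = W c t - christoffel Mfd c (snd c (\<sigma> t)) (velocity {0..1} \<sigma> c t) (V c t)" for t
  have f: "(f has_integral (V c t - V c l)) {l..t}" if "t \<in> {l..r}" for t
    unfolding f_def by (rule weak_cov_derivD(3)[OF c(1)]) (use that lr1 m in auto)
  have "f integrable_on {l..r}" using f[of r] lr1 by auto
  then have "continuous_on {l..r} (\<lambda>t. V c l + integral {l..t} f)"
    by (intro continuous_intros indefinite_integral_continuous_1)
  then have "continuous_on {l..r} (V c)"
    by (rule continuous_on_eq) (simp add: integral_unique[OF f])
  then have "continuous_on {l..r} (\<lambda>t. T d \<bullet> V c t)" by (intro continuous_intros)
  then show "continuous_on {l..r} (\<lambda>t. d \<bullet> developed q V t)"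
    by (rule continuous_on_eq) (simp add: dV)
qed

lemma energy_integrable: "(\<lambda>t. developed q W t \<bullet> developed q W t) integrable_on {0..1}"
proof -
  have "(\<lambda>t. developed q W t \<bullet> developed q W t) integrable_on {0..3/4}"
    by (rule Henstock_Kurzweil_Integration.integrable_combine[of 0 "1/4"])
      (use developed_end(1)[of 1 0 "1/4"] developed_interior(2)[of "1/4" "3/4"] in auto)
  then show ?thesis
    by (rule Henstock_Kurzweil_Integration.integrable_combine[of 0 "3/4" 1, rotated 2])
      (use developed_end(1)[of "-1" "3/4" 1] in auto)
qed

text \<open>Integrate \<open>|W - d|\<^sup>2 \<ge> 0\<close>. For the difference \<open>d\<close> of the boundary values the energy is
  thus at least \<open>|d|\<^sup>2\<close>. That \<open>W\<close> integrates to the increments of \<open>V\<close> is known on closed subintervals of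
  the interior; for \<open>d\<close> orthogonal to the geodesic one can pass to the limit at both ends.\<close>

lemma energy_ge:
  assumes d: "fib q \<bullet> d = 0"
  shows "2 * (d \<bullet> developed q V 1 - d \<bullet> developed q V 0) - d \<bullet> d
    \<le> integral {0..1} (\<lambda>t. developed q W t \<bullet> developed q W t)"
proof -
  define F where "F = integral {0..1} (\<lambda>t. developed q W t \<bullet> developed q W t)"
  define \<phi> where "\<phi> t = d \<bullet> developed q V t" for t
  have 1: "2 * \<phi> b - 2 * \<phi> a \<le> F + d \<bullet> d" if ab: "0 < a" "a \<le> b" "b < 1" for a b
  proof -
    note D = developed_interior[OF ab]
    have "((\<lambda>t. d \<bullet> developed q W t) has_integral d \<bullet> (developed q V b - developed q V a)) {a..b}"
      using has_integral_linear[OF D(3) bounded_linear_inner_right[of d]] by (simp add: o_def)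
    then have "((\<lambda>t. 2 * (d \<bullet> developed q W t) - d \<bullet> d) has_integral
        2 * (d \<bullet> (developed q V b - developed q V a)) - (b - a) *\<^sub>R (d \<bullet> d)) {a..b}"
      using has_integral_const_real[of "d \<bullet> d" a b] ab by (intro has_integral_diff has_integral_mult_right) auto
    then have I: "((\<lambda>t. 2 * (d \<bullet> developed q W t) - d \<bullet> d) has_integral (2 * \<phi> b - 2 * \<phi> a - (b - a) * (d \<bullet> d))) {a..b}"
      using ab by (simp add: \<phi>_def inner_diff_right algebra_simps)
    have "2 * (d \<bullet> u) - d \<bullet> d \<le> u \<bullet> u" for u
      using inner_ge_zero[of "u - d"] by (simp add: inner_diff_left inner_diff_right inner_commute algebra_simps)
    then have "2 * \<phi> b - 2 * \<phi> a - (b - a) * (d \<bullet> d) \<le> integral {a..b} (\<lambda>t. developed q W t \<bullet> developed q W t)"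
      using has_integral_le[OF I integrable_integral[OF D(2)]] by simp
    also have "\<dots> \<le> F"
      unfolding F_def by (rule integral_subset_le[OF _ D(2) energy_integrable]) (use ab in auto)
    moreover have "(b - a) * (d \<bullet> d) \<le> 1 * (d \<bullet> d)" by (rule mult_right_mono) (use ab in auto)
    ultimately show ?thesis by linarith
  qed
  have cont: "continuous_on {0..1/4} \<phi>" "continuous_on {3/4..1} \<phi>"
    unfolding \<phi>_def using developed_end(2)[of 1 0 "1/4" d] developed_end(2)[of "-1" "3/4" 1 d] d by auto
  have 2: "2 * \<phi> 1 - 2 * \<phi> a \<le> F + d \<bullet> d" if a: "0 < a" "a \<le> 1/4" for a
  proof -
    have "\<phi> 1 \<le> (F + d \<bullet> d) / 2 + \<phi> a"
    proof (rule continuous_le_on_closure[of "{3/4..<1}" \<phi>])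
      fix b :: real assume "b \<in> {3/4..<1}"
      then have "2 * \<phi> b - 2 * \<phi> a \<le> F + d \<bullet> d" using a by (intro 1) auto
      then show "\<phi> b \<le> (F + d \<bullet> d) / 2 + \<phi> a" by (simp add: field_simps)
    qed (use cont in auto)
    then show ?thesis by (simp add: field_simps)
  qed
  have "- \<phi> 0 \<le> (F + d \<bullet> d) / 2 - \<phi> 1"
  proof (rule continuous_le_on_closure[of "{0<..1/4}" "\<lambda>t. - \<phi> t"])
    fix a :: real assume "a \<in> {0<..1/4}"
    then have "2 * \<phi> 1 - 2 * \<phi> a \<le> F + d \<bullet> d" by (intro 2) auto
    then show "- \<phi> a \<le> (F + d \<bullet> d) / 2 - \<phi> 1" by (simp add: field_simps)
  qed (use cont in \<open>auto intro: continuous_on_minus\<close>)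
  then have "2 * (\<phi> 1 - \<phi> 0) - d \<bullet> d \<le> F" by (simp add: field_simps)
  then show ?thesis by (simp add: F_def \<phi>_def)
qed

end

section \<open>The Morse index\<close>

text \<open>The covariant derivative of a field is determined almost everywhere only, so that for a parallel field
  its choice may differ from zero on a null set.\<close>

lemma parallel_energy:
  assumes W: "weak_cov_deriv Mfd \<sigma> (parallel q u) W"
  shows "integral {0..1} (\<lambda>t. developed q W t \<bullet> developed q W t) = 0"
proof -
  \<comment> \<open>The core chart sees compact subintervals of the interior only.\<close>
  define N where "N n = {t \<in> {inverse (real (Suc n))..1 - inverse (real (Suc n))}. developed q W t \<noteq> 0}" for n
  have "negligible (N n)" for n
  proof (cases "inverse (real (Suc n)) \<le> 1 - inverse (real (Suc n))")
    case True
    have pos: "0 < inverse (real (Suc n))" by simp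
    show ?thesis
      unfolding N_def
    proof (rule negligible_nonzero_of_integrals_zero)
      show "developed q W absolutely_integrable_on {inverse (real (Suc n))..1 - inverse (real (Suc n))}"
        by (rule developed_interior(1)[OF parallel_along W pos True]) (use pos in linarith)
      fix c d assume cd: "inverse (real (Suc n)) \<le> c" "c \<le> d" "d \<le> 1 - inverse (real (Suc n))"
      then have "0 < c" "d < 1" using pos by linarith+
      from developed_interior(3)[OF parallel_along W this(1) cd(2) this(2)]
      show "integral {c..d} (developed q W) = 0"
        using \<open>0 < c\<close> \<open>d < 1\<close> cd(2) by (simp add: developed_parallel integral_unique)
    qed
  next
    case False
    then have "N n = {}" by (auto simp: N_def)
    then show ?thesis by simp
  qed
  then have "negligible (\<Union>n. N n)" by (rule negligible_Union_nat)
  then have neg: "negligible ((\<Union>n. N n) \<union> {0, 1})" by (rule negligible_Un) simp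
  have zero: "developed q W t = 0" if t: "t \<in> {0..1} - ((\<Union>n. N n) \<union> {0, 1})" for t
  proof (rule ccontr)
    assume nz: "developed q W t \<noteq> 0"
    have "0 < min t (1 - t)" using t by auto
    then obtain n where "inverse (real (Suc n)) < min t (1 - t)" using reals_Archimedean by blast
    then have "t \<in> N n" using nz by (auto simp: N_def)
    then show False using t by blast
  qed
  have "((\<lambda>t. developed q W t \<bullet> developed q W t) has_integral 0) {0..1}"
    by (rule has_integral_spike[OF neg _ has_integral_0]) (simp only: zero inner_zero_left)
  then show ?thesis by (rule integral_unique)
qed

lemma index_form_parallel:
  assumes "fib u = u"
  shows "index_form Mfd \<sigma> (parallel q u) (parallel q u) = - 4 * (u \<bullet> u)"
proof -
  have W: "weak_cov_deriv Mfd \<sigma> (parallel q u) (cov_deriv Mfd \<sigma> (parallel q u))"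
    unfolding cov_deriv_def
    by (rule someI[of "weak_cov_deriv Mfd \<sigma> (parallel q u)", OF weak_cov_deriv_parallel])
  then have "field_along Mfd \<sigma> (cov_deriv Mfd \<sigma> (parallel q u))" by (simp add: weak_cov_deriv_def)
  then show ?thesis
    by (simp add: index_form_developed[OF parallel_along] parallel_energy[OF W] developed_parallel assms)
qed

lemma index_form_nonneg:
  assumes V: "V \<in> H1_fields Mfd \<sigma>" and sym: "fib (developed q V 0 + developed q V 1) = 0"
  shows "0 \<le> index_form Mfd \<sigma> V V"
proof -
  have Va: "field_along Mfd \<sigma> V" and ex: "\<exists>W. weak_cov_deriv Mfd \<sigma> V W" using V by (auto simp: H1_fields_def)
  define W where "W = cov_deriv Mfd \<sigma> V"
  have W: "weak_cov_deriv Mfd \<sigma> V W" unfolding W_def cov_deriv_def using ex by (rule someI_ex)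
  define v where "v = developed q V 1"
  define v' where "v' = developed q V 0"
  have f: "fib v' = - fib v" using sym by (simp add: v_def v'_def fib_add add_eq_0_iff2)
  define d where "d = 2 *\<^sub>R fib v"
  have "fib q \<bullet> v = 0" using developed_tangent[OF V, of 1] by (simp add: v_def)
  then have "fib q \<bullet> d = 0" by (simp add: d_def inner_fib)
  have 1: "d \<bullet> v = 2 * (fib v \<bullet> v)" by (simp add: d_def)
  have "d \<bullet> v' = 2 * (fib v' \<bullet> v)" by (simp add: d_def inner_fib_commute[of v' v])
  then have 2: "d \<bullet> v' = - 2 * (fib v \<bullet> v)" by (simp add: f)
  have 3: "d \<bullet> d = 4 * (fib v \<bullet> v)" by (simp add: d_def inner_fib fib_scale)
  have 4: "fib v' \<bullet> v' = fib v \<bullet> v"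
  proof -
    have "fib v' \<bullet> v' = fib v' \<bullet> fib v'" by (simp add: inner_fib)
    also have "\<dots> = fib v \<bullet> v" by (simp add: f inner_fib fib_minus)
    finally show ?thesis .
  qed
  have "2 * (d \<bullet> v - d \<bullet> v') - d \<bullet> d \<le> integral {0..1} (\<lambda>t. developed q W t \<bullet> developed q W t)"
    unfolding v_def v'_def by (rule energy_ge[OF Va W \<open>fib q \<bullet> d = 0\<close>])
  then have "4 * (fib v \<bullet> v) \<le> integral {0..1} (\<lambda>t. developed q W t \<bullet> developed q W t)"
    unfolding 1 2 3 by simp
  then show ?thesis
    using index_form_developed[OF Va W_along[OF Va W, unfolded W_def]]
    by (simp add: W_def[symmetric] v_def[symmetric] v'_def[symmetric] 4)
qed

text \<open>The vectors of the ball factor that are tangent to the sphere at both end points of the geodesic.\<close>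

definition tangents :: "(real^'n) set" where
  "tangents = {u. fib u = u \<and> fib q \<bullet> u = 0}"

lemma subspace_tangents: "subspace tangents"
  by (rule subspaceI) (auto simp: tangents_def fib_add fib_scale inner_add_right)

lemma dim_tangents: "dim tangents = card A - 1"
proof -
  define S where "S = {u::real^'n. fib u = u}"
  have S: "S = {x. \<forall>i\<in>Basis. i \<notin> (\<lambda>i. axis i 1) ` A \<longrightarrow> x \<bullet> i = 0}"
  proof (intro set_eqI)
    fix u :: "real^'n"
    have ax: "axis i (1::real) \<in> (\<lambda>i. axis i 1) ` A \<longleftrightarrow> i \<in> A" for i by (auto simp: axis_eq_axis)
    have ball: "(\<forall>b\<in>(Basis :: (real^'n) set). Q b) \<longleftrightarrow> (\<forall>i. Q (axis i 1))" for Q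
      by (auto simp: Basis_vec_def)
    show "u \<in> S \<longleftrightarrow> u \<in> {x. \<forall>i\<in>Basis. i \<notin> (\<lambda>i. axis i 1) ` A \<longrightarrow> x \<bullet> i = 0}"
      unfolding mem_Collect_eq ball ax by (auto simp: S_def vec_eq_iff fib_nth inner_axis)
  qed
  have "(\<lambda>i. axis i 1) ` A \<subseteq> (Basis :: (real^'n) set)" by (auto simp: Basis_vec_def)
  from dim_substandard[OF this] have "dim S = card ((\<lambda>i. axis i 1 :: real^'n) ` A)" unfolding S .
  also have "\<dots> = card A" by (rule card_image) (auto simp: inj_on_def axis_eq_axis)
  finally have dS: "dim S = card A" .
  have sS: "subspace S" by (rule subspaceI) (auto simp: S_def fib_add fib_scale)
  have "span {fib q} \<subseteq> S" by (rule span_minimal[OF _ sS]) (simp add: S_def)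
  from dim_subspace_orthogonal_to_vectors[OF subspace_span sS this]
  have "dim {y \<in> S. \<forall>x\<in>span {fib q}. orthogonal x y} + dim (span {fib q}) = card A" using dS by simp
  moreover have "{y \<in> S. \<forall>x\<in>span {fib q}. orthogonal x y} = tangents"
    by (auto simp: S_def tangents_def span_singleton orthogonal_def dest!: spec[of _ 1])
  moreover have "dim (span {fib q}) = 1" using fib_q by (auto simp: dim_span)
  ultimately show ?thesis by simp
qed

lemma linear_parallel: "Vector_Spaces.linear scaleR field_scale (parallel q)"
  unfolding Vector_Spaces.linear_iff
proof (intro conjI allI)
  show "vector_space (scaleR :: real \<Rightarrow> real^'n \<Rightarrow> real^'n)" by (rule real_vector.vector_space_axioms)
  show "vector_space (field_scale :: real \<Rightarrow> (real^'n, 'n) field \<Rightarrow> _)" by (rule vfield.vector_space_axioms)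
  show "parallel q (u + v) = parallel q u + parallel q v" for u v
    unfolding parallel_def fun_eq_iff plus_fun_apply using linear_add[OF linear_tmap] by auto
  show "parallel q (r *\<^sub>R u) = field_scale r (parallel q u)" for r u
    unfolding parallel_def fun_eq_iff field_scale_def using linear_scale[OF linear_tmap] by auto
qed

text \<open>By \<open>index_form_nonneg\<close> the kernel of this linear map contains no field on which the index form is
  negative. So it is injective on each subspace on which the form is negative definite.\<close>

definition end_sum :: "(real^'n, 'n) field \<Rightarrow> real^'n" where
  "end_sum V = fib (developed q V 0 + developed q V 1)"

lemma linear_end_sum: "Vector_Spaces.linear field_scale scaleR end_sum"
  unfolding Vector_Spaces.linear_iff
proof (intro conjI allI)
  show "vector_space (scaleR :: real \<Rightarrow> real^'n \<Rightarrow> real^'n)" by (rule real_vector.vector_space_axioms)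
  show "vector_space (field_scale :: real \<Rightarrow> (real^'n, 'n) field \<Rightarrow> _)" by (rule vfield.vector_space_axioms)
qed (simp_all add: end_sum_def developed_linear fib_add fib_scale scaleR_add_right)

lemma end_sum_tangents: "V \<in> H1_fields Mfd \<sigma> \<Longrightarrow> end_sum V \<in> tangents"
  using developed_tangent[of V 0] developed_tangent[of V 1]
  by (simp add: end_sum_def tangents_def inner_fib inner_add_right fib_add)

lemma morse_index_ray: "morse_index Mfd \<sigma> = enat (card A - 1)"
  unfolding morse_index_def
proof (rule antisym)
  interpret up: vector_space_pair field_scale "scaleR :: real \<Rightarrow> real^'n \<Rightarrow> real^'n" by unfold_locales
  interpret low: vector_space_pair "scaleR :: real \<Rightarrow> real^'n \<Rightarrow> real^'n" field_scale by unfold_locales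
  let ?\<B> = "{B. finite B \<and> vfield.independent B \<and> vfield.span B \<subseteq> H1_fields Mfd \<sigma> \<and>
                  (\<forall>V\<in>vfield.span B. V \<noteq> 0 \<longrightarrow> index_form Mfd \<sigma> V V < 0)}"
  show "(SUP B\<in>?\<B>. enat (card B)) \<le> enat (card A - 1)"
  proof (rule SUP_least)
    fix B assume "B \<in> ?\<B>"
    then have B: "finite B" "vfield.independent B" "vfield.span B \<subseteq> H1_fields Mfd \<sigma>"
      "\<And>V. V \<in> vfield.span B \<Longrightarrow> V \<noteq> 0 \<Longrightarrow> index_form Mfd \<sigma> V V < 0" by auto
    have "V = 0" if "V \<in> vfield.span B" "end_sum V = 0" for V
      using index_form_nonneg[of V] B(3,4) that by (force simp: end_sum_def)
    then have inj: "inj_on end_sum (vfield.span B)"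
      using up.linear_inj_on_iff_eq_0[OF linear_end_sum vfield.subspace_span] by blast
    have "independent (end_sum ` B)"
      using up.linear_independent_injective_image[OF linear_end_sum B(2) inj] by (simp add: dependent_raw_def)
    moreover have "end_sum ` B \<subseteq> tangents" using B(3) vfield.span_superset[of B] end_sum_tangents by blast
    ultimately have "card (end_sum ` B) \<le> dim tangents" by (intro independent_card_le_dim)
    moreover have "card (end_sum ` B) = card B"
      by (rule card_image[OF inj_on_subset[OF inj vfield.span_superset]])
    ultimately show "enat (card B) \<le> enat (card A - 1)" by (simp add: dim_tangents)
  qed
  obtain C where C: "C \<subseteq> tangents" "independent C" "tangents \<subseteq> span C" "card C = dim tangents"
    using basis_exists by blast
  have sC: "span C = tangents" using C(1,3) span_minimal[OF C(1) subspace_tangents] by blast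
  have inj: "inj (parallel q)"
    by (rule injI) (metis developed_parallel atLeastAtMost_iff order_refl zero_le_one)
  have span: "vfield.span (parallel q ` C) = parallel q ` tangents"
    using low.linear_span_image[OF linear_parallel, of C] sC by (simp add: span_raw_def)
  have "parallel q ` C \<in> ?\<B>"
  proof (intro CollectI conjI ballI impI)
    show "finite (parallel q ` C)" using C(2) independent_imp_finite by blast
    show "vfield.independent (parallel q ` C)"
      using low.linear_independent_injective_image[OF linear_parallel _ inj_on_subset[OF inj]] C(2)
      by (simp add: dependent_raw_def)
    show "vfield.span (parallel q ` C) \<subseteq> H1_fields Mfd \<sigma>"
      unfolding span using parallel_H1 by (auto simp: tangents_def)
    fix V assume V: "V \<in> vfield.span (parallel q ` C)" "V \<noteq> 0"
    then obtain u where u: "u \<in> tangents" "V = parallel q u" unfolding span by blast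
    then have "u \<noteq> 0" using V(2) low.linear_0[OF linear_parallel] by auto
    then show "index_form Mfd \<sigma> V V < 0" using u by (simp add: index_form_parallel tangents_def)
  qed
  then have "enat (card (parallel q ` C)) \<le> (SUP B\<in>?\<B>. enat (card B))" by (rule SUP_upper)
  moreover have "card (parallel q ` C) = card A - 1"
    using C(4) dim_tangents card_image[OF inj_on_subset[OF inj], of C] by simp
  ultimately show "enat (card A - 1) \<le> (SUP B\<in>?\<B>. enat (card B))" by simp
qed

end

lemma morse_index_free_boundary_geodesic:
  assumes "free_boundary_geodesic Mfd R \<gamma>"
  shows "morse_index Mfd (\<lambda>t. \<gamma> (R * t)) = enat (card A - 1)"
proof (rule morse_index_ray)
  note \<gamma> = free_boundary_geodesic_unique[OF assms]
  show "fib (\<gamma> 0) \<bullet> \<gamma> 0 = 1" using bdryD[OF \<gamma>(2)] by simp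
  fix t :: real assume "t \<in> {0..1}"
  then show "\<gamma> (R * t) = proj (ray (\<gamma> 0) t)"
    using \<gamma>(1) \<gamma>(3)[of "2 * t"] by (simp add: ray_def mult.commute)
qed

section \<open>Connectedness of the boundary\<close>

text \<open>In the boundary of the tube, remove the points over one pole of the sphere. The rest is a retract,
  by normalisation of the ball component, of a set which is starlike about the opposite pole.\<close>

lemma connected_punctured:
  assumes s: "s = 1 \<or> s = (- 1 :: real)"
  shows "connected {z. fib z \<bullet> z = 1 \<and> fib z \<noteq> - s *\<^sub>R e}"
proof -
  define S where "S = {z. \<forall>r\<ge>0. fib z \<noteq> - (r * s) *\<^sub>R e}"
  define f where "f z = fib z /\<^sub>R norm (fib z) + (z - fib z)" for z
  have ss: "s * s = 1" "norm s = 1" using s by auto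
  have "starlike S"
    unfolding starlike_def
  proof (intro bexI ballI subsetI)
    show seS: "s *\<^sub>R e \<in> S"
    proof -
      have "s *\<^sub>R e \<noteq> - (r * s) *\<^sub>R e" if "0 \<le> r" for r
        using that s by (auto simp: scaleR_left.minus[symmetric] simp del: scaleR_minus_left)
      then show ?thesis by (simp add: S_def fib_scale)
    qed
    fix z y assume z: "z \<in> S" and "y \<in> closed_segment (s *\<^sub>R e) z"
    then obtain u where u: "0 \<le> u" "u \<le> 1" "y = (1 - u) *\<^sub>R (s *\<^sub>R e) + u *\<^sub>R z" by (auto simp: in_segment)
    have "fib y \<noteq> - (r * s) *\<^sub>R e" if r: "0 \<le> r" for r
    proof
      assume "fib y = - (r * s) *\<^sub>R e"
      then have "u *\<^sub>R fib z = - ((r + (1 - u)) * s) *\<^sub>R e"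
        by (simp add: u(3) fib_add fib_diff fib_scale algebra_simps)
      show False
      proof (cases "u = 0")
        case True
        then have "y = s *\<^sub>R e" using u(3) by simp
        then show False using \<open>fib y = - (r * s) *\<^sub>R e\<close> seS r unfolding S_def by blast
      next
        case False
        then have "fib z = (1 / u) *\<^sub>R (u *\<^sub>R fib z)" by simp
        also have "\<dots> = - (((r + (1 - u)) / u) * s) *\<^sub>R e"
          unfolding \<open>u *\<^sub>R fib z = - ((r + (1 - u)) * s) *\<^sub>R e\<close> by simp
        finally have "fib z = - (((r + (1 - u)) / u) * s) *\<^sub>R e" .
        moreover have "0 \<le> (r + (1 - u)) / u" using r u by simp
        ultimately show False using z unfolding S_def by blast
      qed
    qed
    then show "y \<in> S" by (simp add: S_def)
  qed
  then have "connected S" by (rule starlike_imp_connected)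
  moreover have nz: "fib z \<noteq> 0" if "z \<in> S" for z using that by (auto simp: S_def dest: spec[of _ 0])
  then have "continuous_on S f"
    unfolding f_def by (auto intro!: continuous_intros)
  ultimately have "connected (f ` S)" by (rule connected_continuous_image[rotated])
  moreover have "f ` S = {z. fib z \<bullet> z = 1 \<and> fib z \<noteq> - s *\<^sub>R e}"
  proof (intro equalityI subsetI)
    fix y assume "y \<in> f ` S"
    then obtain z where z: "z \<in> S" "y = f z" by auto
    have fy: "fib y = fib z /\<^sub>R norm (fib z)" by (simp add: z(2) f_def fib_add fib_diff fib_scale)
    have "fib y \<bullet> y = fib y \<bullet> fib y" by (simp add: inner_fib)
    also have "\<dots> = 1" unfolding fy using nz[OF z(1)] by (simp add: dot_square_norm power2_eq_square field_simps)
    moreover have "fib y \<noteq> - s *\<^sub>R e"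
    proof
      assume "fib y = - s *\<^sub>R e"
      then have "fib z = - (norm (fib z) * s) *\<^sub>R e"
        using nz[OF z(1)] fy by (metis mult_minus_right scaleR_one scaleR_scaleR right_inverse norm_eq_zero)
      then show False using z(1) unfolding S_def by (metis (mono_tags, lifting) mem_Collect_eq norm_ge_zero)
    qed
    ultimately show "y \<in> {z. fib z \<bullet> z = 1 \<and> fib z \<noteq> - s *\<^sub>R e}" by simp
  next
    fix y assume "y \<in> {z. fib z \<bullet> z = 1 \<and> fib z \<noteq> - s *\<^sub>R e}"
    then have y: "fib y \<bullet> y = 1" "fib y \<noteq> - s *\<^sub>R e" by auto
    then have n: "norm (fib y) = 1" by (simp add: norm_eq_sqrt_inner inner_fib)
    have "fib y \<noteq> - (r * s) *\<^sub>R e" if "0 \<le> r" for r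
    proof
      assume eq: "fib y = - (r * s) *\<^sub>R e"
      then have "r = 1" using n that ss by (simp add: abs_mult)
      then show False using eq y(2) by simp
    qed
    then have "y \<in> S" by (simp add: S_def)
    moreover have "f y = y" by (simp add: f_def n)
    ultimately show "y \<in> f ` S" by (metis imageI)
  qed
  ultimately show ?thesis by simp
qed

text \<open>The boundary is covered by the images of the two punctured pieces. If the ball has dimension at least
  2, they share a point of the equator. Otherwise there is a torus coordinate, and a unit step in it maps
  one end of the interval to the other one.\<close>

lemma connected_bdry:
  assumes "2 \<le> CARD('n)"
  shows "connectedin quot (bdry Mfd)"
proof -
  define P where "P s = {z. fib z \<bullet> z = 1 \<and> fib z \<noteq> - s *\<^sub>R e}" for s :: real
  have sub: "P s \<subseteq> tube" for s by (auto simp: P_def tube_def)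
  have con: "connectedin quot (proj ` P s)" if "s = 1 \<or> s = - 1" for s
    by (rule connectedin_continuous_map_image[OF continuous_map_proj])
      (use connected_punctured[OF that] sub in \<open>simp add: connectedin_subtopology P_def\<close>)
  have "proj ` P 1 \<inter> proj ` P (- 1) \<noteq> {}"
  proof (cases "\<exists>j\<in>A. j \<noteq> nc")
    case True
    then obtain j where j: "j \<in> A" "j \<noteq> nc" by blast
    have f: "fib (axis j 1) = axis j (1::real)" using j by (auto simp: vec_eq_iff fib_nth axis_def)
    have "axis j 1 $ nc = (0::real)" "e $ nc = 1" using j by (simp_all add: axis_def)
    then have "axis j 1 \<in> P 1" "axis j 1 \<in> P (- 1)" by (auto simp: P_def f inner_axis)
    then show ?thesis by blast
  next
    case False
    have "\<exists>j. j \<noteq> nc"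
    proof (rule ccontr)
      assume "\<nexists>j. j \<noteq> nc"
      then have "(UNIV :: 'n set) = {nc}" by auto
      then have "CARD('n) = card {nc}" by (rule arg_cong)
      then show False using assms by simp
    qed
    then obtain j where j: "j \<notin> A" using False by blast
    define m where "m i = (if i = j then 1 else 0 :: int)" for i
    have "(\<Sum>i\<in>-A. m i) = 1" using j by (simp add: m_def)
    then have fd: "fib (deck m e) = - e" using nc_A by (auto simp: vec_eq_iff fib_nth deck_def axis_def)
    have ee: "e \<noteq> - e" by (metis e_nth one_neq_neg_one vector_uminus_component)
    have "e \<in> P 1" using ee by (simp add: P_def inner_e e_nth)
    moreover have "deck m e \<in> P (- 1)"
      using ee fib_iso_inner[OF deck_iso, of m e e] by (auto simp: P_def fd inner_e e_nth)
    moreover have "proj (deck m e) = proj e" by simp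
    ultimately show ?thesis by (metis IntI empty_iff imageI)
  qed
  then have "connectedin quot (proj ` P 1 \<union> proj ` P (- 1))" by (intro connectedin_Un con) auto
  moreover have "proj ` P 1 \<union> proj ` P (- 1) = bdry Mfd"
  proof -
    have "e \<noteq> - e" by (metis e_nth one_neq_neg_one vector_uminus_component)
    then have "P 1 \<union> P (- 1) = {z. fib z \<bullet> z = 1}" by (auto simp: P_def)
    then show ?thesis unfolding bdry_bundle by (metis image_Un)
  qed
  ultimately show ?thesis by simp
qed

end

theorem proposition1p3:
  fixes k :: nat
  assumes "CARD('n::finite) \<ge> 2"
    and "k \<in> {0..CARD('n) - 1}"
  shows "\<exists>M :: (real^'n, 'n) riem.
           zoll_manifold_with_boundary M \<and>
           connectedin (space_of M) (bdry M) \<and>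
           (\<forall>R \<gamma>. free_boundary_geodesic M R \<gamma> \<longrightarrow> morse_index M (\<lambda>t. \<gamma> (R * t)) = enat k)"
proof -
  have "k \<le> card (UNIV - {normal_coord :: 'n})" using assms(2) by (simp add: card_Diff_singleton)
  then obtain B :: "'n set" where B: "B \<subseteq> UNIV - {normal_coord}" "card B = k"
    using obtain_subset_with_card_n by metis
  define A where "A = insert normal_coord B"
  have card: "card A = Suc k" using B by (simp add: A_def subset_Diff_insert)
  interpret disc_bundle A by unfold_locales (simp add: A_def)
  show ?thesis
    using zoll_bundle[OF assms(1)] connected_bdry[OF assms(1)] morse_index_free_boundary_geodesic card
    by (intro exI[of _ Mfd]) simp
qed

end
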